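(* Consider a sequence of factor models $\mathbf{X}_t=\mathbf{B}\mathbf{f}_t+\mathbf{u}_t$, $t=1,\dots,T$, as described in the context, with $\mathbf{f}_t$ and $\mathbf{u}_t$ independent and normally distributed, along which $T-K\to\infty$ (where $p$, $K$, $T$ and the model parameters may vary along the sequence, and $p\le T-K$). Suppose $H_0$ holds, i.e. $\boldsymbol{\Omega}_{11}=\mathrm{diag}(\omega_{11},\dots,\omega_{pp})$ is diagonal with positive diagonal entries. Let $$T_{LR}^*=\left(\frac{\det\mathbf{V}_{11}^{-1}}{\prod_{i=1}^p v_{ii}^{(-)}}\right)^{-T/2}=\det(\mathbf{R})^{-T/2}.$$ If either $p/(T-K)\to c\in(0,1)$ as $T-K\to\infty$, or $T-K-p\to d\in(0,\infty)$ as $T-K\to\infty$ with $d\ge4$, then $$\frac{\frac{2}{T}\ln(T_{LR}^* )+\mu_{LR}}{\sigma_{LR}}\stackrel{d}{\longrightarrow}\mathcal{N}(0,1),$$ where $$\mu_{LR}=\Big(p-1-(T-K)+\frac32\Big)\ln\Big(1-\frac{p}{T-K}\Big)-\frac{T-K-1}{T-K}\,p$$ and $\sigma_{LR}>0$ is given by $$\sigma_{LR}^2=-2\Big\{\frac{p}{T-K}+\ln\Big(1-\frac{p}{T-K}\Big)\Big\}.$$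
   Context: Model (for each member of the sequence): $\mathbf{B}$ is a deterministic $p\times K$ matrix; $\mathbf{f}_1,\dots,\mathbf{f}_T$ are i.i.d. $K$-dimensional normal vectors with mean zero and positive definite covariance matrix; $\mathbf{u}_1,\dots,\mathbf{u}_T$ are i.i.d. $p$-dimensional normal vectors with mean zero and positive definite covariance matrix $\boldsymbol{\Sigma}_u$; the sequences $(\mathbf{f}_t)$ and $(\mathbf{u}_t)$ are independent. Put $\mathbf{Y}_t=(\mathbf{X}_t^\top,\mathbf{f}_t^\top)^\top\in\mathbb{R}^{p+K}$ and $\boldsymbol{\Omega}=\{\mathrm{cov}(\mathbf{Y}_t)\}^{-1}=(\omega_{ij})$, with upper-left $p\times p$ block $\boldsymbol{\Omega}_{11}$. Let $\mathbf{Y}=(\mathbf{Y}_1,\dots,\mathbf{Y}_T)$, $\mathbf{S}=\frac1T\mathbf{Y}\mathbf{Y}^\top$, $\mathbf{V}=(T\mathbf{S})^{-1}$, with upper-left $p\times p$ block $\mathbf{V}_{11}$; write $\mathbf{V}_{11}^{-1}=(v_{ij}^{(-)})_{1\le i,j\le p}$. $\mathbf{R}$ is the correlation matrix obtained from $\mathbf{V}_{11}^{-1}$: $$\mathbf{R}=\mathrm{diag}\{(v_{11}^{(-)})^{-1/2},\dots,(v_{pp}^{(-)})^{-1/2}\}\,\mathbf{V}_{11}^{-1}\,\mathrm{diag}\{(v_{11}^{(-)})^{-1/2},\dots,(v_{pp}^{(-)})^{-1/2}\}.$$ $\stackrel{d}{\longrightarrow}$ is convergence in distribution. The number of factors $K$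 may stay bounded or tend to infinity. *)

theory Defs
  imports
    "HOL-Probability.Probability"
    "Jordan_Normal_Form.Gauss_Jordan_Elimination"
    "Jordan_Normal_Form.Determinant"
begin

unbundle no vec_syntax
unbundle no inner_syntax

section \<open>Matrices\<close>

text \<open>On a singular matrix this is an unspecified constant.\<close>

definition mat_inv :: "real Matrix.mat \<Rightarrow> real Matrix.mat" where
  "mat_inv A = the (mat_inverse A)"

definition upper_left_block :: "nat \<Rightarrow> real Matrix.mat \<Rightarrow> real Matrix.mat" where
  "upper_left_block p A = Matrix.mat p p (\<lambda>(i, j). A $$ (i, j))"

definition positive_definite_mat :: "nat \<Rightarrow> real Matrix.mat \<Rightarrow> bool" where
  "positive_definite_mat k A \<longleftrightarrow>
     A \<in> carrier_mat k k \<and> transpose_mat A = A \<and>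
     (\<forall>v \<in> carrier_vec k. v \<noteq> 0\<^sub>v k \<longrightarrow> 0 < v \<bullet> (A *\<^sub>v v))"

section \<open>Normal random vectors\<close>

text \<open>A random vector is a map into \<^term>\<open>carrier_vec k\<close>. As the type \<^typ>\<open>real Matrix.vec\<close> carries
  no measurable structure, laws and independence are expressed through its coordinates, seen as a
  point of the product space over \<^term>\<open>{..<k}\<close>.\<close>

definition coords :: "nat \<Rightarrow> ('a \<Rightarrow> real Matrix.vec) \<Rightarrow> 'a \<Rightarrow> (nat \<Rightarrow> real)" where
  "coords k X \<omega> = (\<lambda>i\<in>{..<k}. X \<omega> $ i)"

abbreviation coord_space :: "nat \<Rightarrow> (nat \<Rightarrow> real) measure" where
  "coord_space k \<equiv> Pi\<^sub>M {..<k} (\<lambda>_. borel)"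

definition mean_vec :: "'a measure \<Rightarrow> nat \<Rightarrow> ('a \<Rightarrow> real Matrix.vec) \<Rightarrow> real Matrix.vec" where
  "mean_vec M k X = Matrix.vec k (\<lambda>i. \<integral>\<omega>. X \<omega> $ i \<partial>M)"

definition cov_mat :: "'a measure \<Rightarrow> nat \<Rightarrow> ('a \<Rightarrow> real Matrix.vec) \<Rightarrow> real Matrix.mat" where
  "cov_mat M k X = Matrix.mat k k (\<lambda>(i, j).
     \<integral>\<omega>. (X \<omega> $ i - mean_vec M k X $ i) * (X \<omega> $ j - mean_vec M k X $ j) \<partial>M)"

definition mvn_density ::
  "nat \<Rightarrow> real Matrix.vec \<Rightarrow> real Matrix.mat \<Rightarrow> real Matrix.vec \<Rightarrow> real" where
  "mvn_density k \<mu> \<Sigma> x =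
     exp (- ((x - \<mu>) \<bullet> (mat_inv \<Sigma> *\<^sub>v (x - \<mu>))) / 2) / sqrt ((2 * pi) ^ k * det \<Sigma>)"

text \<open>Normality with nonsingular covariance matrix: the vector has the normal density whose parameters
  are its own mean and covariance matrix.\<close>

definition normal_vector :: "'a measure \<Rightarrow> nat \<Rightarrow> ('a \<Rightarrow> real Matrix.vec) \<Rightarrow> bool" where
  "normal_vector M k X \<longleftrightarrow>
     (\<forall>\<omega> \<in> space M. X \<omega> \<in> carrier_vec k) \<and>
     distributed M (Pi\<^sub>M {..<k} (\<lambda>_. lborel)) (coords k X)
       (\<lambda>x. ennreal (mvn_density k (mean_vec M k X) (cov_mat M k X) (Matrix.vec k x)))"

section \<open>The factor model\<close>

text \<open>Observation times are \<^term>\<open>{..<T}\<close>. Identical distribution of the factors, and of the errors,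
  is contained in the clauses on normality, mean and covariance, which determine the law.\<close>

locale gaussian_factor_model = prob_space M
  for M :: "'a measure" +
  fixes p K T :: nat
    and B \<Sigma>f \<Sigma>u :: "real Matrix.mat"
    and f u X :: "nat \<Rightarrow> 'a \<Rightarrow> real Matrix.vec"
  assumes loadings: "B \<in> carrier_mat p K"
    and factor_normal: "\<And>t. t < T \<Longrightarrow> normal_vector M K (f t)"
    and factor_mean: "\<And>t. t < T \<Longrightarrow> mean_vec M K (f t) = 0\<^sub>v K"
    and factor_cov: "\<And>t. t < T \<Longrightarrow> cov_mat M K (f t) = \<Sigma>f"
    and factor_cov_pos: "positive_definite_mat K \<Sigma>f"
    and factor_indep: "indep_vars (\<lambda>_. coord_space K) (\<lambda>t. coords K (f t)) {..<T}"
    and error_normal: "\<And>t. t < T \<Longrightarrow> normal_vector M p (u t)"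
    and error_mean: "\<And>t. t < T \<Longrightarrow> mean_vec M p (u t) = 0\<^sub>v p"
    and error_cov: "\<And>t. t < T \<Longrightarrow> cov_mat M p (u t) = \<Sigma>u"
    and error_cov_pos: "positive_definite_mat p \<Sigma>u"
    and error_indep: "indep_vars (\<lambda>_. coord_space p) (\<lambda>t. coords p (u t)) {..<T}"
    and factor_error_indep:
      "indep_var (Pi\<^sub>M {..<T} (\<lambda>_. coord_space K)) (\<lambda>\<omega>. \<lambda>t\<in>{..<T}. coords K (f t) \<omega>)
                 (Pi\<^sub>M {..<T} (\<lambda>_. coord_space p)) (\<lambda>\<omega>. \<lambda>t\<in>{..<T}. coords p (u t) \<omega>)"
    and model: "\<And>t \<omega>. t < T \<Longrightarrow> \<omega> \<in> space M \<Longrightarrow> X t \<omega> = B *\<^sub>v f t \<omega> + u t \<omega>"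

definition joint_vec ::
  "(nat \<Rightarrow> 'a \<Rightarrow> real Matrix.vec) \<Rightarrow> (nat \<Rightarrow> 'a \<Rightarrow> real Matrix.vec) \<Rightarrow> nat \<Rightarrow> 'a \<Rightarrow> real Matrix.vec" where
  "joint_vec X f t \<omega> = X t \<omega> @\<^sub>v f t \<omega>"

definition precision_mat :: "'a measure \<Rightarrow> nat \<Rightarrow> ('a \<Rightarrow> real Matrix.vec) \<Rightarrow> real Matrix.mat" where
  "precision_mat M k Y = mat_inv (cov_mat M k Y)"

section \<open>The likelihood ratio statistic\<close>

definition data_mat :: "nat \<Rightarrow> nat \<Rightarrow> (nat \<Rightarrow> 'a \<Rightarrow> real Matrix.vec) \<Rightarrow> 'a \<Rightarrow> real Matrix.mat" where
  "data_mat k T Y \<omega> = mat_of_cols k (map (\<lambda>t. Y t \<omega>) [0..<T])"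

definition sample_cov :: "nat \<Rightarrow> nat \<Rightarrow> (nat \<Rightarrow> 'a \<Rightarrow> real Matrix.vec) \<Rightarrow> 'a \<Rightarrow> real Matrix.mat" where
  "sample_cov k T Y \<omega> =
     (1 / real T) \<cdot>\<^sub>m (data_mat k T Y \<omega> * transpose_mat (data_mat k T Y \<omega>))"

definition V_mat :: "nat \<Rightarrow> nat \<Rightarrow> (nat \<Rightarrow> 'a \<Rightarrow> real Matrix.vec) \<Rightarrow> 'a \<Rightarrow> real Matrix.mat" where
  "V_mat k T Y \<omega> = mat_inv (real T \<cdot>\<^sub>m sample_cov k T Y \<omega>)"

definition V11_inv ::
  "nat \<Rightarrow> nat \<Rightarrow> nat \<Rightarrow> (nat \<Rightarrow> 'a \<Rightarrow> real Matrix.vec) \<Rightarrow> 'a \<Rightarrow> real Matrix.mat" where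
  "V11_inv p K T Y \<omega> = mat_inv (upper_left_block p (V_mat (p + K) T Y \<omega>))"

definition correlation_mat :: "nat \<Rightarrow> real Matrix.mat \<Rightarrow> real Matrix.mat" where
  "correlation_mat p W =
     mat_diag p (\<lambda>i. (W $$ (i, i)) powr (- 1 / 2)) * W *
     mat_diag p (\<lambda>i. (W $$ (i, i)) powr (- 1 / 2))"

definition R_mat ::
  "nat \<Rightarrow> nat \<Rightarrow> nat \<Rightarrow> (nat \<Rightarrow> 'a \<Rightarrow> real Matrix.vec) \<Rightarrow> 'a \<Rightarrow> real Matrix.mat" where
  "R_mat p K T Y \<omega> = correlation_mat p (V11_inv p K T Y \<omega>)"

definition T_LR ::
  "nat \<Rightarrow> nat \<Rightarrow> nat \<Rightarrow> (nat \<Rightarrow> 'a \<Rightarrow> real Matrix.vec) \<Rightarrow> 'a \<Rightarrow> real" where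
  "T_LR p K T Y \<omega> =
     (det (V11_inv p K T Y \<omega>) / (\<Prod>i<p. V11_inv p K T Y \<omega> $$ (i, i))) powr (- real T / 2)"

text \<open>Both normalising constants below are meant for \<^term>\<open>K + p < T\<close>.\<close>

definition mu_LR :: "nat \<Rightarrow> nat \<Rightarrow> nat \<Rightarrow> real" where
  "mu_LR p K T =
     (real p - 1 - (real T - real K) + 3 / 2) * ln (1 - real p / (real T - real K))
     - (real T - real K - 1) / (real T - real K) * real p"

definition sigma_LR :: "nat \<Rightarrow> nat \<Rightarrow> nat \<Rightarrow> real" where
  "sigma_LR p K T =
     sqrt (- 2 * (real p / (real T - real K) + ln (1 - real p / (real T - real K))))"

end

theory Submission
  imports Defs "HOL-Real_Asymp.Real_Asymp"
begin

unbundle no vec_syntax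
unbundle no inner_syntax

text \<open>Let \<open>N = T - K\<close>. Writing the inverse of \<open>V\<^sub>1\<^sub>1\<close> as a Schur complement, the statistic is the
  product over the
  rows \<open>u\<^sub>i\<close> of the error matrix of the ratio of the squared distance from \<open>u\<^sub>i\<close> to the span of the
    factor
  rows and the previous error rows, and its squared distance to the span of the factor rows alone.
  Under the null hypothesis the error rows are independent, so conditionally on what precedes them
  these ratios are beta variables, and the characteristic function of the log-determinant is a
  product of quotients of Gamma functions at \<open>j / 2 + \<i> y\<close> and \<open>N / 2 + \<i> y\<close> for \<open>N - p < j
    \<le> N\<close>. A Taylor
  expansion of \<open>ln \<Gamma>\<close>, with bounds on the polygamma functions, gives mean
    and variance up to \<open>O(1 / (N - p))\<close>
  and a cubic remainder of the same order; Levy's continuity theorem concludes.\<close>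

section \<open>Asymptotics of polygamma functions\<close>

text \<open>The errors in mean, variance and remainder are only O(1/m) with m = N - p, and m stays
  bounded in the second regime. The division by the standard deviation \<sigma> rescues the
  argument: all three errors become at most constants times 1/(m \<sigma>), which vanishes either
  because m grows while \<sigma> has a positive limit, or because \<sigma>^2 grows like 2 ln N while
  m stays near d. Hence the estimates are explicit and uniform in N and m. Beta densities are
  avoided. A Gaussian quadratic form has an elementary Laplace transform; it determines negative
  moments of the two residual sums of squares, and moving the exponents to the imaginary axis gives
  the characteristic function of the log-ratio. The value does not involve the earlier rows, so rows
  can be integrated out one at a time. Almost sure linear independence of the error rows is the same
  integral at argument 0; for the factor rows, of arbitrary positive definite covariance, it is
  transferred from standard normal columns by absolute continuity. The loadings enter one
  off-diagonal block of a triangular factor, which drops out.\<close>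

definition trapez :: "real \<Rightarrow> real" where
  "trapez x = ln (x + 1) - ln x - (1 / x + 1 / (x + 1)) / 2"

text \<open>\<open>trapez x\<close> is the integral of 1/t over [x, x + 1] minus its trapezoidal
  value, hence nonpositive by convexity of 1/t. Concretely, it increases to its limit 0, with
  derivative (u - v)^2 / 2.\<close>

lemma trapez_nonpos:
  assumes "x > 0" shows "trapez x \<le> 0"
proof -
  have "trapez x \<le> 0"
  proof (rule tendsto_lowerbound[of trapez])
    show "(trapez \<longlongrightarrow> 0) at_top" unfolding trapez_def by real_asymp
    show "\<forall>\<^sub>F y in at_top. trapez x \<le> trapez y"
      using eventually_ge_at_top[of x]
    proof eventually_elim
      case (elim y)
      show ?case
      proof (rule DERIV_nonneg_imp_nondecreasing[OF elim])
        fix z assume z: "x \<le> z" "z \<le> y"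
        define u v where "u = inverse z" and "v = inverse (z + 1)"
        have uv: "u - v = u * v" using assms z by (simp add: u_def v_def field_simps)
        have 1: "1 / z = u" "1 / (z + 1) = v" "1 / (1 + z) = v"
          by (simp_all add: u_def v_def inverse_eq_divide add.commute)
        have t: "trapez = (\<lambda>x. ln (x + 1) - ln x - (inverse x + inverse (x + 1)) / 2)"
          by (rule ext) (simp add: trapez_def inverse_eq_divide)
        have "(trapez has_real_derivative (v - u + (u^2 + v^2)/2)) (at z)"
          unfolding t using assms z
          by (auto intro!: derivative_eq_intros simp: 1 simp flip: u_def v_def)
             (simp add: power2_eq_square field_simps)
        moreover have "v - u + (u^2 + v^2)/2 = (u - v)^2/2"
        proof -
          have "v - u + (u^2 + v^2)/2 = (u - v)^2/2 + (u * v - (u - v))"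
            by (simp add: power2_diff field_simps)
          then show ?thesis using uv by simp
        qed
        ultimately show "\<exists>D. (trapez has_real_derivative D) (at z) \<and> 0 \<le> D" by auto
      qed
    qed
  qed simp
  thus ?thesis .
qed

text \<open>The right-hand side is the first Euler-Maclaurin correction - (f'(x + 1) - f'(x)) / 12
  for f(t) = 1/t. The difference then decreases to 0, its derivative being exactly - (u v)^3 / 6,
  and the bound itself telescopes in x.\<close>

lemma trapez_lower:
  assumes "x > 0" shows "trapez x \<ge> - (1/12) * (1/x^2 - 1/(x+1)^2)"
proof -
  let ?g = "\<lambda>x. trapez x + (1/12) * (1/x^2 - 1/(x+1)^2)"
  have "?g x \<ge> 0"
  proof (rule tendsto_upperbound[of ?g])
    show "(?g \<longlongrightarrow> 0) at_top" unfolding trapez_def by real_asymp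
    show "\<forall>\<^sub>F y in at_top. ?g x \<ge> ?g y"
      using eventually_ge_at_top[of x]
    proof eventually_elim
      case (elim y)
      show ?case
      proof (rule DERIV_nonpos_imp_nonincreasing[OF elim])
        fix z assume z: "x \<le> z" "z \<le> y"
        then have z0: "z > 0" using assms by auto
        define u v where "u = inverse z" and "v = inverse (z + 1)"
        have uv: "u - v = u * v" using z0 by (simp add: u_def v_def field_simps)
        have 1: "1 / z = u" "1 / (z + 1) = v" "1 / (1 + z) = v"
          by (simp_all add: u_def v_def inverse_eq_divide add.commute)
        have pos: "u > 0" "v > 0" using z0 by (auto simp: u_def v_def)
        have g: "?g = (\<lambda>x. ln (x + 1) - ln x - (inverse x + inverse (x + 1)) / 2
                  + (1/12) * (inverse x ^ 2 - inverse (x+1) ^ 2))"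
          by (rule ext) (simp add: trapez_def inverse_eq_divide power_one_over)
        have "(?g has_real_derivative (v - u + (u^2 + v^2)/2 - (1/6) * (u^3 - v^3))) (at z)"
          unfolding g using z0
          by (auto intro!: derivative_eq_intros simp: 1 simp flip: u_def v_def)
             (simp add: power2_eq_square power3_eq_cube field_simps)
        moreover have "v - u + (u^2 + v^2)/2 - (1/6) * (u^3 - v^3) = - (1/6) * (u * v)^3"
        proof -
          have "u^3 - v^3 = (u - v) * ((u - v)^2 + 3 * (u * v))"
            by (simp add: power2_eq_square power3_eq_cube algebra_simps)
          also have "\<dots> = (u * v) * ((u * v)^2 + 3 * (u * v))" unfolding uv ..
          finally have 1: "u^3 - v^3 = (u * v) * ((u * v)^2 + 3 * (u * v))" .
          have "u^2 + v^2 = (u - v)^2 + 2 * (u * v)" by (simp add: power2_eq_square power3_eq_cube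
            algebra_simps)
          then have 2: "u^2 + v^2 = (u * v)^2 + 2 * (u * v)" unfolding uv .
          have 3: "v - u = - (u * v)" using uv by simp
          show ?thesis unfolding 1 2 3 by (simp add: power2_eq_square power3_eq_cube field_simps)
        qed
        moreover have "- (1/6) * (u * v)^3 \<le> 0" using pos by simp
        ultimately show "\<exists>D. (?g has_real_derivative D) (at z) \<and> D \<le> 0"
          by (intro exI conjI) (assumption, simp)
      qed
    qed
  qed simp
  thus ?thesis by simp
qed

text \<open>Summing \<open>trapez (x + real k)\<close> telescopes the logarithms and leaves the
  partial sums of the limit formula for \<open>Digamma\<close>, with end corrections 1/(2x) and
  1/(2(x + M)). The two trapezoidal bounds, the lower one rounded from 1/12 to 1, give the
  error.\<close>

lemma Digamma_asymp:
  assumes "x > (0::real)"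
  shows "\<bar>Digamma x - ln x + 1 / (2 * x)\<bar> \<le> 1 / x^2"
proof -
  have tele: "(\<Sum>k<M. trapez (x + real k)) = ln (x + real M) - ln x - (\<Sum>k<M. inverse (x + real k))
       + 1 / (2*x) - 1 / (2 * (x + real M))" for M
  proof (induction M)
    case (Suc M)
    define v w where "v = x + real M" and "w = x + real (Suc M)"
    have "trapez v = ln w - ln v - (1 / v + 1 / w) / 2"
      by (simp add: trapez_def v_def w_def add.commute add.left_commute)
    moreover have "1 / (2 * v) = (1 / v) / 2" "1 / (2 * w) = (1 / w) / 2" by simp_all
    ultimately show ?case using Suc unfolding sum.lessThan_Suc inverse_eq_divide
      v_def[symmetric] w_def[symmetric] by (simp add: add_divide_distrib)
  qed simp
  have "(\<lambda>M. (ln (real M) - (\<Sum>k<M. inverse (x + real k))) + (ln (x + real M) - ln (real M)) - ln x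
      + 1 / (2*x) - 1 / (2 * (x + real M))) \<longlonglongrightarrow> Digamma x + 0 - ln x + 1/(2*x) - 0"
    using assms
    by (intro tendsto_intros, use Digamma_LIMSEQ[of x] in simp; real_asymp)
  hence lim: "(\<lambda>M. \<Sum>k<M. trapez (x + real k)) \<longlonglongrightarrow> Digamma x - ln x + 1/(2*x)"
    unfolding tele by (simp add: algebra_simps)
  have up: "(\<Sum>k<M. trapez (x + real k)) \<le> 0" for M
    by (rule sum_nonpos) (use assms in \<open>auto intro!: trapez_nonpos add_pos_nonneg\<close>)
  have lo: "(\<Sum>k<M. trapez (x + real k)) \<ge> - (1 / x^2)" for M
  proof -
    have "(\<Sum>k<M. trapez (x + real k)) \<ge> - (1/12) * (1/x^2 - 1/(x + real M)^2)"
    proof (induction M)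
      case (Suc M)
      have "trapez (x + real M) \<ge> - (1/12) * (1/(x + real M)^2 - 1/(x + real M + 1)^2)"
        using assms by (intro trapez_lower) auto
      with Suc show ?case by (simp add: algebra_simps)
    qed simp
    moreover have "1/x^2 \<ge> 0" "1/(x + real M)^2 \<ge> 0" by simp_all
    moreover have "- a \<le> s" if "- (1/12) * (a - b) \<le> s" "0 \<le> a" "0 \<le> b" for a b s :: real
      using that by argo
    ultimately show ?thesis by blast
  qed
  have "Digamma x - ln x + 1/(2*x) \<le> 0"
    by (rule LIMSEQ_le_const2[OF lim]) (use up in auto)
  moreover have "Digamma x - ln x + 1/(2*x) \<ge> -(1/x^2)"
    by (rule LIMSEQ_le_const[OF lim]) (use lo in auto)
  moreover have "1 / x^2 \<ge> 0" by simp
  ultimately show ?thesis unfolding abs_le_iff by linarith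
qed

text \<open>Since 1/((x + k)(x + k + 1)) lies between 1/(x + k + 1)^2 and 1/(x + k)^2 and telescopes
  to 1/x, the trigamma series exceeds 1/x by at most its first term 1/x^2.\<close>

lemma Polygamma_1_asymp:
  assumes "x > (0::real)"
  shows "\<bar>Polygamma 1 x - 1 / x\<bar> \<le> 1 / x^2"
proof -
  have s: "(\<lambda>k. inverse ((x + real k)^2)) sums Polygamma 1 x"
    using Polygamma_LIMSEQ[of x 1] assms by (simp add: numeral_2_eq_2)
  have t: "(\<lambda>k. 1 / (x + real k) - 1 / (x + real (Suc k))) sums (1/x)"
  proof -
    have "(\<lambda>k. 1 / (x + real k)) \<longlonglongrightarrow> 0" by real_asymp
    from telescope_sums'[OF this] show ?thesis by simp
  qed
  have lo: "1 / x \<le> Polygamma 1 x"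
  proof (rule sums_le[OF _ t s])
    fix k show "1 / (x + real k) - 1 / (x + real (Suc k)) \<le> inverse ((x + real k)^2)"
      using assms by (simp add: field_simps power2_eq_square add_pos_nonneg)
  qed
  have "(\<lambda>k. inverse ((x + real (Suc k))^2)) sums (Polygamma 1 x - inverse (x^2))"
    using s by (subst sums_Suc_iff) simp
  then have "Polygamma 1 x - inverse (x^2) \<le> 1 / x"
  proof (rule sums_le[OF _ _ t, rotated])
    fix k show "inverse ((x + real (Suc k))^2) \<le> 1 / (x + real k) - 1 / (x + real (Suc k))"
      using assms by (simp add: field_simps power2_eq_square add_pos_nonneg)
  qed
  with lo show ?thesis by (simp add: field_simps)
qed

text \<open>In the series of 1/(z + k)^3 every modulus of z + k is at least r + k; one factor 1/r is
  pulled out, so that the real trigamma series at r bounds the rest.\<close>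

lemma norm_Polygamma_2_le:
  assumes "r > 0" "Re z \<ge> r"
  shows "norm (Polygamma 2 z) \<le> 2 * (1 / r^2 + 1 / r^3)"
proof -
  have z: "z \<noteq> 0" using assms by auto
  have s: "(\<lambda>k. inverse ((z + of_nat k)^3)) sums (- Polygamma 2 z / 2)"
    using Polygamma_LIMSEQ[of z 2] z by (simp add: numeral_3_eq_3 fact_numeral)
  have s1: "(\<lambda>k. inverse ((r + real k)^2)) sums Polygamma 1 r"
    using Polygamma_LIMSEQ[of r 1] assms by (simp add: numeral_2_eq_2)
  have b: "norm (inverse ((z + of_nat k)^3)) \<le> inverse r * inverse ((r + real k)^2)" for k
  proof -
    have "r + real k \<le> norm (z + of_nat k)"
      using assms complex_Re_le_cmod[of "z + of_nat k"] by simp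
    then have "(r + real k)^3 \<le> norm (z + of_nat k)^3"
      using assms by (intro power_mono) auto
    moreover have "r * (r + real k)^2 \<le> (r + real k)^3"
      using assms by (simp add: power3_eq_cube power2_eq_square mult_right_mono)
    ultimately have "r * (r + real k)^2 \<le> norm (z + of_nat k)^3" by linarith
    moreover have "0 < r * (r + real k)^2" using assms by (simp add: add_pos_nonneg)
    ultimately have "inverse (norm (z + of_nat k)^3) \<le> inverse (r * (r + real k)^2)"
      by (rule le_imp_inverse_le)
    then show ?thesis by (simp add: norm_inverse norm_power inverse_mult_distrib mult.commute)
  qed
  have "norm (- Polygamma 2 z / 2) \<le> inverse r * Polygamma 1 r"
    by (rule norm_sums_le[OF s sums_mult[OF s1] b])
  also have "Polygamma 1 r \<le> 1 / r + 1 / r^2" using Polygamma_1_asymp[OF assms(1)] by linarith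
  finally show ?thesis using assms
    by (simp add: norm_divide field_simps power2_eq_square power3_eq_cube)
qed

text \<open>Second-order Taylor formula on the convex half-plane Re z \<ge> a, where the third
  derivative \<open>Polygamma 2\<close> is bounded. The linear term is imaginary and the quadratic
  one real and negative: the exponent of a Gaussian characteristic function.\<close>

lemma ln_Gamma_Taylor:
  assumes "a \<ge> (1/2 :: real)"
  shows "norm (ln_Gamma (complex_of_real a + \<i> * of_real y) - ln_Gamma (of_real a)
           - \<i> * of_real y * of_real (Digamma a) + of_real (y^2 / 2 * Polygamma 1 a))
         \<le> 3 * \<bar>y\<bar>^3 / a^2"
proof -
  define S where "S = {z. Re z \<ge> a}"
  define F where "F = (\<lambda>i::nat. if i = 0 then ln_Gamma else Polygamma (i - 1) :: complex \<Rightarrow> complex)"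
  have conv: "convex S" unfolding S_def by (rule convex_halfspace_Re_ge)
  have a: "of_real a \<in> S" "of_real a + \<i> * of_real y \<in> S" by (auto simp: S_def)
  have nr: "z \<notin> \<real>\<^sub>\<le>\<^sub>0" if "z \<in> S" for z
    using that assms by (auto simp: S_def complex_nonpos_Reals_iff)
  then have ni: "z \<notin> \<int>\<^sub>\<le>\<^sub>0" if "z \<in> S" for z
    using that nonpos_Ints_subset_nonpos_Reals by blast
  have der: "(F i has_field_derivative F (Suc i) z) (at z within S)" if "z \<in> S" "i \<le> 2" for i z
  proof (cases i)
    case 0
    then show ?thesis using has_field_derivative_ln_Gamma_complex[OF nr[OF that(1)]]
      by (simp add: F_def has_field_derivative_at_within)
  next
    case (Suc j)
    then show ?thesis using has_field_derivative_Polygamma[OF ni[OF that(1)], of j S]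
      by (simp add: F_def)
  qed
  have bnd: "norm (F (Suc 2) z) \<le> 6 / a^2" if "z \<in> S" for z
  proof -
    have "norm (F (Suc 2) z) \<le> 2 * (1/a^2 + 1/a^3)"
      using norm_Polygamma_2_le[of a z] that assms by (simp add: F_def S_def numeral_2_eq_2)
    also have "1 / a^3 = 1 / a * (1 / a^2)" by (simp add: power2_eq_square power3_eq_cube)
    \<comment> \<open>From a \<ge> 1/2 one has 1/a \<le> 2, which makes the constant 2 (1 + 2) =
      6.\<close>
    also have "\<dots> \<le> 2 * (1 / a^2)" using assms by (intro mult_right_mono) (auto simp: field_simps)
    finally show ?thesis by simp
  qed
  have "norm (F 0 (of_real a + \<i> * of_real y) - (\<Sum>i\<le>2. F i (of_real a) * ((of_real a
    + \<i> * of_real y) - of_real a) ^ i / fact i))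
      \<le> 6 / a^2 * norm ((of_real a + \<i> * of_real y) - (of_real a :: complex)) ^ Suc 2 / fact 2"
    by (rule complex_Taylor[where f = F and S = S and B = "6 / a^2", OF conv der bnd a])
  also have "(\<Sum>i\<le>2. F i (of_real a) * ((of_real a + \<i> * of_real y) - of_real a) ^ i / fact i)
     = ln_Gamma (of_real a) + \<i> * of_real y * of_real (Digamma a) - of_real (y^2 / 2 * Polygamma 1 a)"
  proof -
    have "Polygamma n (complex_of_real a) = of_real (Polygamma n a)" for n
      using Polygamma_of_real[of a n] assms by simp
    moreover have "{..2::nat} = {0, 1, 2}" by auto
    moreover have "(\<i> * complex_of_real y)^2 = - of_real (y^2)"
      by (simp add: power_mult_distrib)
    ultimately show ?thesis by (simp add: F_def mult.commute)
  qed
  also have "6 / a^2 * norm ((of_real a + \<i> * of_real y) - (of_real a :: complex)) ^ Suc 2 / fact 2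
    = 3 * \<bar>y\<bar>^3 / a^2"
    by (simp add: norm_mult numeral_3_eq_3 fact_numeral)
  also have "F 0 = ln_Gamma" by (simp add: F_def)
  finally show ?thesis by (simp add: algebra_simps)
qed

section \<open>Mean and variance of the log-determinant\<close>

lemma inverse_diff_Suc:
  "x > 0 \<Longrightarrow> 1 / x - 1 / (x + 1) = 1 / (x * (x + 1))" for x :: real
  by (simp add: divide_simps)

text \<open>Telescoping majorant: k (k + 1) \<le> 2 k^2 gives 1/k^2 \<le> 2/k - 2/(k + 1).\<close>

lemma inverse_square_step:
  assumes "k \<ge> (1::nat)" and that: "c \<ge> 0"
  shows "2 * c / real (Suc k) + c / (real k)^2 \<le> 2 * c / real k"
proof -
  have "real k * (real k + 1) \<le> 2 * (real k)^2"
    using assms by (simp add: algebra_simps power2_eq_square)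
  then have "2 / (2 * (real k)^2) \<le> 2 / (real k * (real k + 1))"
    using assms by (intro divide_left_mono) auto
  also have "\<dots> = 2 * (1 / real k - 1 / (real k + 1))"
    using assms by (subst inverse_diff_Suc) auto
  also have "\<dots> = 2 / real k - 2 / real (Suc k)" by (simp add: add.commute)
  also have "2 / (2 * (real k)^2) = 1 / (real k)^2" by simp
  finally have "c * (1 / (real k)^2) \<le> c * (2 / real k - 2 / real (Suc k))"
    using that by (rule mult_left_mono)
  thus ?thesis by (simp add: right_diff_distrib mult.commute)
qed

text \<open>Backward induction from \<open>E N = 0\<close>: increments of order 1/k^2 add up to
  order 1/m, uniformly in N. Comparing a sum over \<open>{m<..N}\<close> with a closed form is
  thereby reduced to a one-step estimate.\<close>

lemma telescoped_bound:
  fixes E :: "nat \<Rightarrow> real"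
  assumes "E N = 0" "1 \<le> m" "m \<le> N" "c \<ge> 0"
    and step: "\<And>k. m \<le> k \<Longrightarrow> k < N \<Longrightarrow> \<bar>E k - E (Suc k)\<bar> \<le> c / (real k)^2"
  shows "\<bar>E m\<bar> \<le> 2 * c / real m"
  using \<open>m \<le> N\<close>
proof (induction rule: inc_induct)
  case base thus ?case using assms by simp
next
  case (step k)
  have "\<bar>E k\<bar> \<le> \<bar>E (Suc k)\<bar> + \<bar>E k - E (Suc k)\<bar>" by simp
  also have "\<dots> \<le> 2 * c / real (Suc k) + c / (real k)^2"
    using step assms(5)[of k] by linarith
  also have "\<dots> \<le> 2 * c / real k" using step assms by (intro inverse_square_step) auto
  finally show ?case .
qed

text \<open>Expectation of the logarithm of a product of independent Beta(j/2, (N - j)/2) variables;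
  with \<open>Polygamma 1\<close> one gets the variance. The term j = N is 0: it belongs to the
  first error row, whose two distances coincide.\<close>

definition mean_logdet :: "nat \<Rightarrow> nat \<Rightarrow> real" where
  "mean_logdet N m = (\<Sum>j\<in>{m<..N}. Digamma (real j / 2) - Digamma (real N / 2))"

definition var_logdet :: "nat \<Rightarrow> nat \<Rightarrow> real" where
  "var_logdet N m = (\<Sum>j\<in>{m<..N}. Polygamma 1 (real j / 2) - Polygamma 1 (real N / 2))"

text \<open>At m = N - p this is \<open>mu_LR\<close>, and \<open>var_approx\<close> is the
  expression under the root in \<open>sigma_LR\<close>.\<close>

definition mean_approx :: "nat \<Rightarrow> nat \<Rightarrow> real" where
  "mean_approx N m = (1/2 - real m) * ln (real m / real N) - (real N - 1) / real N * (real N - real m)"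

definition var_approx :: "nat \<Rightarrow> nat \<Rightarrow> real" where
  "var_approx N m = - 2 * ((real N - real m) / real N + ln (real m / real N))"

lemma sum_greaterThanAtMost_first:
  "k < N \<Longrightarrow> (\<Sum>j\<in>{k<..N}. g j) = g (Suc k) + (\<Sum>j\<in>{Suc k<..N}. g j :: 'b :: comm_monoid_add)"
    for k N :: nat
proof -
  assume "k < N"
  then have "{k<..N} = insert (Suc k) {Suc k<..N}" by auto
  then show ?thesis by simp
qed

lemma inverse_square_mono: "1 \<le> k \<Longrightarrow> k \<le> j \<Longrightarrow> 1 / (real j)^2 \<le> 1 / (real k)^2" for j k :: nat
  by (intro divide_left_mono power_mono mult_pos_pos zero_less_power) auto

lemma four_inverse_square_mono: "0 < x \<Longrightarrow> x \<le> y \<Longrightarrow> 1 / (y / 2)^2 \<le> 4 / x^2" for x y :: real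
  using power_mono[of x y 2] by (auto simp: power_divide intro!: divide_left_mono mult_pos_pos)

lemma Digamma_half_asymp:
  fixes x :: real
  assumes "0 < x" "x \<le> y"
  shows "\<bar>Digamma (y / 2) - (ln y - ln 2) + 1 / y\<bar> \<le> 4 / x^2"
  using Digamma_asymp[of "y / 2"] four_inverse_square_mono[OF assms] assms by (simp add: ln_div)

lemma Polygamma_1_half_asymp:
  fixes x :: real
  assumes "0 < x" "x \<le> y"
  shows "\<bar>Polygamma 1 (y / 2) - 2 / y\<bar> \<le> 4 / x^2"
  using Polygamma_1_asymp[of "y / 2"] four_inverse_square_mono[OF assms] assms by simp

lemma mean_logdet_approx:
  assumes "1 \<le> m" "m \<le> N"
  shows "\<bar>mean_logdet N m - mean_approx N m\<bar> \<le> 18 / real m"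
proof -
  have "\<bar>mean_logdet N m - mean_approx N m\<bar> \<le> 2 * 9 / real m"
  proof (rule telescoped_bound[where E = "\<lambda>m. mean_logdet N m - mean_approx N m" and N = N])
    show "mean_logdet N N - mean_approx N N = 0"
      using assms by (simp add: mean_logdet_def mean_approx_def)
  next
    fix k assume k: "m \<le> k" "k < N"
    define x n where "x = real k" and "n = real N"
    have x: "x \<ge> 1" "x + 1 \<le> n" using k assms by (auto simp: x_def n_def)
    have e1: "\<bar>Digamma ((x + 1) / 2) - (ln (x + 1) - ln 2) + 1 / (x + 1)\<bar> \<le> 4 / x^2"
      and e2: "\<bar>Digamma (n / 2) - (ln n - ln 2) + 1 / n\<bar> \<le> 4 / x^2"
      using x by (auto intro!: Digamma_half_asymp)
    \<comment> \<open>Increment of the closed form once the \<open>Digamma\<close> expansions are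
      inserted. The logarithmic difference is its trapezoidal value plus \<open>trapez x\<close>;
      the trapezoidal value times x - 1/2 cancels 1 - 1/(x + 1) up to 1/(4 x (x + 1)).\<close>
    have main: "\<bar>1 - 1 / (x + 1) - (x - 1/2) * (ln (x + 1) - ln x)\<bar> \<le> 1 / x^2"
    proof -
      have eq: "ln (x + 1) - ln x = trapez x + (1 / x + 1 / (x + 1)) / 2" by (simp add: trapez_def)
      have "(x - 1/2) * ((1 / x + 1 / (x + 1)) / 2) = 1 - 1/(x+1) - 1 / (4 * x * (x + 1))"
      proof -
        have "1 / (4 * x * (x + 1)) = (1 / x - 1 / (x + 1)) / 4"
          using inverse_diff_Suc[of x] x by simp
        moreover have "x * (1 / x) = 1" "x * (1 / (x + 1)) = 1 - 1 / (x + 1)"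
          using x by (simp_all add: divide_simps)
        moreover have "(x - 1/2) * ((u + v) / 2) = 1 - v - w"
          if "w = (u - v) / 4" "x * u = 1" "x * v = 1 - v" for u v w
        proof -
          have "(x - 1/2) * ((u + v) / 2) = (x * u + x * v) / 2 - (u + v) / 4"
            by (simp add: field_simps)
          then show ?thesis unfolding that by (simp add: field_simps)
        qed
        ultimately show ?thesis by blast
      qed
      then have 1: "1 - 1 / (x + 1) - (x - 1/2) * (ln (x + 1) - ln x) = 1 / (4 * x * (x + 1))
        + (x - 1/2) * (- trapez x)"
      proof -
        have "r - (b + a) = w + - b" if "a = r - w" for a b r w :: real
          using that by simp
        from this[OF \<open>(x - 1/2) * ((1 / x + 1 / (x + 1)) / 2) = 1 - 1/(x+1) - 1 / (4 * x * (x + 1))\<close>]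
        show ?thesis unfolding eq distrib_left mult_minus_right .
      qed
      have t: "0 \<le> - trapez x" "- trapez x \<le> (1/12) * (1/x^2 - 1/(x+1)^2)"
      proof -
        show "0 \<le> - trapez x" using trapez_nonpos[of x] x by simp
        have "- (1/12) * q \<le> r \<Longrightarrow> - r \<le> (1/12) * q" for q r :: real by simp
        from this[OF trapez_lower[of x]] x show "- trapez x \<le> (1/12) * (1/x^2 - 1/(x+1)^2)" by simp
      qed
      have "(x - 1/2) * (- trapez x) \<le> (x - 1/2) * ((1/12) * (1/x^2 - 1/(x+1)^2))"
        using t x by (intro mult_left_mono) auto
      also have "\<dots> = ((x - 1/2) * (2 * x + 1) / (x+1)^2) * (1 / (12 * x^2))"
      proof -
        have "1/x^2 - 1/(x+1)^2 = (2 * x + 1) / (x+1)^2 * (1 / x^2)"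
          using x by (simp add: divide_simps) (simp add: power2_eq_square algebra_simps)
        then show ?thesis by simp
      qed
      also have "\<dots> \<le> 2 * (1 / (12 * x^2))"
      proof (rule mult_right_mono)
        have "(x - 1/2) * (2 * x + 1) \<le> 2 * (x + 1)^2"
          using x by (simp add: power2_eq_square algebra_simps)
        then show "(x - 1/2) * (2 * x + 1) / (x+1)^2 \<le> 2"
          using x by (simp add: pos_divide_le_eq)
      qed simp
      finally have 2: "(x - 1/2) * (- trapez x) \<le> 1/6 * (1 / x^2)" by simp
      have 3: "0 \<le> (x - 1/2) * (- trapez x)" using t x by (intro mult_nonneg_nonneg) auto
      have "x * x \<le> 4 * x * (x + 1)" using x by (auto simp: algebra_simps intro: add_increasing2)
      then have 4: "1 / (4 * x * (x + 1)) \<le> 1/4 * (1 / x^2)"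
        using x by (simp add: divide_simps power2_eq_square)
      have 5: "0 \<le> 1 / (4 * x * (x + 1))" using x by simp
      have 6: "0 \<le> 1 / x^2" by simp
      show ?thesis unfolding 1 using 2 3 4 5 6 by linarith
    qed
    have m1: "mean_logdet N k - mean_logdet N (Suc k) = Digamma ((x + 1) / 2) - Digamma (n / 2)"
      unfolding mean_logdet_def by (subst sum_greaterThanAtMost_first[OF k(2)]) (simp add: x_def n_def
        add.commute)
    have m2: "mean_approx N k = (1/2 - x) * (ln x - ln n) - (n - x) + (n - x) / n"
       "mean_approx N (Suc k) = (1/2 - (x + 1)) * (ln (x + 1) - ln n) - (n - (x+1)) + (n - (x+1)) / n"
      using x k unfolding mean_approx_def
      by (simp_all add: x_def[symmetric] n_def[symmetric] ln_div add.commute) (simp_all add: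
        field_simps)
    have m3: "(n - (x + 1)) / n = (n - x) / n - 1 / n" by (simp add: diff_divide_distrib
      add_divide_distrib)
    have "mean_logdet N k - mean_approx N k - (mean_logdet N (Suc k) - mean_approx N (Suc k))
       = (Digamma ((x + 1) / 2) - (ln (x + 1) - ln 2) + 1 / (x + 1))
         - (Digamma (n / 2) - (ln n - ln 2) + 1 / n)
         + (1 - 1 / (x + 1) - (x - 1/2) * (ln (x + 1) - ln x))"
      using m1 unfolding m2 m3 by (simp add: algebra_simps diff_divide_distrib add_divide_distrib)
    \<comment> \<open>The constant 9 = 4 + 4 + 1 collects two \<open>Digamma\<close> expansions and
      the one-step error.\<close>
    also have "\<bar>\<dots>\<bar> \<le> 4 / x^2 + 4 / x^2 + 1 / x^2" using e1 e2 main by linarith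
    finally show "\<bar>mean_logdet N k - mean_approx N k - (mean_logdet N (Suc k) - mean_approx N (Suc k))\<bar>
      \<le> 9 / (real k)^2" by (simp add: x_def)
  qed (use assms in auto)
  then show ?thesis by simp
qed

lemma var_logdet_approx:
  assumes "1 \<le> m" "m \<le> N"
  shows "\<bar>var_logdet N m - var_approx N m\<bar> \<le> 20 / real m"
proof -
  have "\<bar>var_logdet N m - var_approx N m\<bar> \<le> 2 * 10 / real m"
  proof (rule telescoped_bound[where E = "\<lambda>m. var_logdet N m - var_approx N m" and N = N])
    show "var_logdet N N - var_approx N N = 0"
      using assms by (simp add: var_logdet_def var_approx_def)
  next
    fix k assume k: "m \<le> k" "k < N"
    define x n where "x = real k" and "n = real N"
    have x: "x \<ge> 1" "x + 1 \<le> n" using k assms by (auto simp: x_def n_def)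
    have e1: "\<bar>Polygamma 1 ((x + 1) / 2) - 2 / (x + 1)\<bar> \<le> 4 / x^2"
      and e2: "\<bar>Polygamma 1 (n / 2) - 2 / n\<bar> \<le> 4 / x^2"
      using Polygamma_1_half_asymp[of x "x + 1"] Polygamma_1_half_asymp[of x n] x by auto
    \<comment> \<open>At this order the bounds 1/(x + 1) \<le> ln (x + 1) - ln x \<le> 1/x
      suffice.\<close>
    have main: "\<bar>2 / (x + 1) - 2 * (ln (x + 1) - ln x)\<bar> \<le> 2 / x^2"
    proof -
      have "ln (x + 1) - ln x \<le> 1 / x" using ln_diff_le[of "x + 1" x] x by simp
      moreover have "1 / (x + 1) \<le> ln (x + 1) - ln x" using ln_diff_le[of x "x + 1"] x by simp
      moreover have "1 / x - 1 / (x + 1) \<le> 1 / x^2"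
      proof -
        have "1 / (x * (x + 1)) \<le> 1 / (x * x)" using x by (intro divide_left_mono mult_left_mono) auto
        then show ?thesis using inverse_diff_Suc[of x] x by (simp add: power2_eq_square)
      qed
      moreover have "0 \<le> 1 / x^2" by simp
      moreover have "2 / (x + 1) = 2 * (1 / (x + 1))" "2 / x^2 = 2 * (1 / x^2)" by simp_all
      moreover have "\<bar>2 * v - 2 * l\<bar> \<le> 2 * q" if "l \<le> u" "v \<le> l" "u - v \<le> q" "0 \<le> q" for u v l q :: real
        using that by arith
      ultimately show ?thesis by metis
    qed
    have m1: "var_logdet N k - var_logdet N (Suc k) = Polygamma 1 ((x + 1) / 2) - Polygamma 1 (n / 2)"
      unfolding var_logdet_def by (subst sum_greaterThanAtMost_first[OF k(2)]) (simp add: x_def n_def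
        add.commute)
    have m2: "var_approx N k = - 2 * ((n - x) / n + (ln x - ln n))"
       "var_approx N (Suc k) = - 2 * ((n - (x+1)) / n + (ln (x + 1) - ln n))"
      using x k unfolding var_approx_def
      by (simp_all add: x_def[symmetric] n_def[symmetric] ln_div add.commute)
    have m3: "(n - (x + 1)) / n = (n - x) / n - 1 / n" by (simp add: diff_divide_distrib
      add_divide_distrib)
    have "var_logdet N k - var_approx N k - (var_logdet N (Suc k) - var_approx N (Suc k))
       = (Polygamma 1 ((x + 1) / 2) - 2 / (x + 1)) - (Polygamma 1 (n / 2) - 2 / n)
         + (2 / (x + 1) - 2 * (ln (x + 1) - ln x))"
      using m1 unfolding m2 m3 by (simp add: algebra_simps)
    also have "\<bar>\<dots>\<bar> \<le> 4 / x^2 + 4 / x^2 + 2 / x^2" using e1 e2 main by linarith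
    finally show "\<bar>var_logdet N k - var_approx N k - (var_logdet N (Suc k) - var_approx N (Suc k))\<bar>
      \<le> 10 / (real k)^2" by (simp add: x_def)
  qed (use assms in auto)
  then show ?thesis by simp
qed

section \<open>Characteristic exponent of the log-determinant and its Gaussian limit\<close>

definition log_char_logdet :: "nat \<Rightarrow> nat \<Rightarrow> real \<Rightarrow> complex" where
  "log_char_logdet N m y = (\<Sum>j\<in>{m<..N}.
     (ln_Gamma (of_real (real j / 2) + \<i> * of_real y) - ln_Gamma (of_real (real j / 2)))
     - (ln_Gamma (of_real (real N / 2) + \<i> * of_real y) - ln_Gamma (of_real (real N / 2))))"

text \<open>The Taylor remainders at j/2 and N/2 are each at most 12 |y|^3 / j^2, and the sum of
  1/j^2 over j > m is at most 2/m, whence 48. Summing values of \<open>ln_Gamma\<close>, instead of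
  taking a logarithm of the product, leaves no branch to choose.\<close>

lemma log_char_logdet_approx:
  assumes "1 \<le> m" "m \<le> N"
  shows "norm (log_char_logdet N m y - (\<i> * of_real (y * mean_logdet N m) - of_real (y^2 / 2 *
    var_logdet N m)))
    \<le> 48 * \<bar>y\<bar>^3 / real m"
proof -
  define R where "R a = ln_Gamma (complex_of_real a + \<i> * of_real y) - ln_Gamma (of_real a)
           - \<i> * of_real y * of_real (Digamma a) + of_real (y^2 / 2 * Polygamma 1 a)" for a
  have R: "norm (R (real j / 2)) \<le> 12 * \<bar>y\<bar>^3 * (1 / (real j)^2)" if "j \<ge> 1" for j
  proof -
    have "norm (R (real j / 2)) \<le> 3 * \<bar>y\<bar>^3 / (real j / 2)^2"
      unfolding R_def using that by (intro ln_Gamma_Taylor) auto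
    then show ?thesis by (simp add: power_divide mult.commute)
  qed
  have eq: "log_char_logdet N m y - (\<i> * of_real (y * mean_logdet N m) - of_real (y^2 / 2 * var_logdet
    N m))
    = (\<Sum>j\<in>{m<..N}. R (real j / 2) - R (real N / 2))"
    unfolding log_char_logdet_def mean_logdet_def var_logdet_def R_def
    by (simp add: sum.distrib sum_subtractf sum_distrib_left algebra_simps)
  have "norm (\<Sum>j\<in>{m<..N}. R (real j / 2) - R (real N / 2))
    \<le> (\<Sum>j\<in>{m<..N}. 24 * \<bar>y\<bar>^3 * (1 / (real j)^2))"
  proof (rule sum_norm_le)
    fix j assume "j \<in> {m<..N}"
    then have j: "1 \<le> j" "j \<le> N" using assms by auto
    have "norm (R (real j / 2) - R (real N / 2)) \<le> norm (R (real j / 2)) + norm (R (real N / 2))"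
      by (rule norm_triangle_ineq4)
    also have "\<dots> \<le> 12 * \<bar>y\<bar>^3 * (1 / (real j)^2) + 12 * \<bar>y\<bar>^3 * (1 / (real N)^2)"
      using R[of j] R[of N] j by linarith
    also have "12 * \<bar>y\<bar>^3 * (1 / (real N)^2) \<le> 12 * \<bar>y\<bar>^3 * (1 / (real j)^2)"
      using inverse_square_mono[OF j] by (intro mult_left_mono) auto
    finally show "norm (R (real j / 2) - R (real N / 2)) \<le> 24 * \<bar>y\<bar>^3 * (1 / (real j)^2)" by simp
  qed
  also have "\<dots> = 24 * \<bar>y\<bar>^3 * (\<Sum>j\<in>{m<..N}. 1 / (real j)^2)" by (simp add: sum_distrib_left)
  also have "(\<Sum>j\<in>{m<..N}. 1 / (real j)^2) \<le> \<bar>\<Sum>j\<in>{m<..N}. 1 / (real j)^2\<bar>" by simp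
  also have "\<dots> \<le> 2 * 1 / real m"
  proof (rule telescoped_bound[where E = "\<lambda>m. \<Sum>j\<in>{m<..N}. 1 / (real j)^2" and N = N])
    fix k assume k: "m \<le> k" "k < N"
    have "\<bar>1 / (real (Suc k))\<^sup>2\<bar> \<le> 1 / (real k)^2"
      using inverse_square_mono[of k "Suc k"] k assms by simp
    then show "\<bar>(\<Sum>j\<in>{k<..N}. 1 / (real j)\<^sup>2) - (\<Sum>j\<in>{Suc k<..N}. 1 / (real j)\<^sup>2)\<bar> \<le> 1 / (real k)\<^sup>2"
      by (subst sum_greaterThanAtMost_first[OF k(2)]) simp
  qed (use assms in auto)
  finally have "norm (\<Sum>j\<in>{m<..N}. R (real j / 2) - R (real N / 2)) \<le> 24 * \<bar>y\<bar>^3 * (2 / real m)"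
    by (simp add: mult_left_mono)
  then show ?thesis unfolding eq by simp
qed

text \<open>The argument - t / \<sigma> carries a minus sign because the statistic is minus the
  log-determinant. Mean, variance and cubic errors are constants times e = 1/(m \<sigma>), further
  powers of 1/\<sigma> being absorbed by \<sigma> \<ge> s; so \<open>lim\<close> controls all
  three.\<close>

lemma log_char_logdet_normalised_limit:
  fixes N m :: "nat \<Rightarrow> nat" and \<sigma> :: "nat \<Rightarrow> real"
  assumes ev: "\<forall>\<^sub>F n in sequentially. 1 \<le> m n \<and> m n \<le> N n"
    and \<sigma>: "\<forall>\<^sub>F n in sequentially. \<sigma> n \<ge> s" "s > 0"
    and \<sigma>2: "\<forall>\<^sub>F n in sequentially. (\<sigma> n)^2 = var_approx (N n) (m n)"
    and lim: "(\<lambda>n. 1 / (real (m n) * \<sigma> n)) \<longlonglongrightarrow> 0"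
  shows "(\<lambda>n. exp (\<i> * of_real (t * mean_approx (N n) (m n) / \<sigma> n)
            + log_char_logdet (N n) (m n) (- t / \<sigma> n))) \<longlonglongrightarrow> exp (- of_real (t^2 / 2))"
proof (rule tendsto_exp)
  define e where "e n = 1 / (real (m n) * \<sigma> n)" for n
  define A where "A n = \<i> * of_real (t * mean_approx (N n) (m n) / \<sigma> n)
            + log_char_logdet (N n) (m n) (- t / \<sigma> n)" for n
  \<comment> \<open>The coefficients come from the mean error 18/m, half the variance error 20/m,
    and the remainder 48/m.\<close>
  define K where "K = 18 * \<bar>t\<bar> + 10 * t^2 / s + 48 * \<bar>t\<bar>^3 / s^2"
  have bound: "\<forall>\<^sub>F n in sequentially. norm (A n - (- of_real (t^2 / 2))) \<le> K * e n"
    using ev \<sigma>(1) \<sigma>2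
  proof eventually_elim
    case (elim n)
    define y where "y = - t / \<sigma> n"
    have \<sigma>n: "\<sigma> n > 0" using elim \<sigma>(2) by linarith
    have m: "real (m n) \<ge> 1" using elim by simp
    have e0: "e n \<ge> 0" using \<sigma>n by (simp add: e_def)
    have y: "\<bar>y\<bar> = \<bar>t\<bar> / \<sigma> n" "y^2 = t^2 / (\<sigma> n)^2" using \<sigma>n
      by (auto simp: y_def power_divide abs_divide)
    have inv: "1 / \<sigma> n \<le> 1 / s" using elim \<sigma>n \<sigma>(2) by (intro divide_left_mono) auto
    have i1: "1 / (real (m n)) * (1 / \<sigma> n) = e n" by (simp add: e_def)
    define L where "L = log_char_logdet (N n) (m n) y"
    define ml where "ml = mean_logdet (N n) (m n)"
    define ma where "ma = mean_approx (N n) (m n)"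
    define vl where "vl = var_logdet (N n) (m n)"
    have v1: "y^2 / 2 * (\<sigma> n)^2 = t^2 / 2" using \<sigma>n by (simp add: y)
    have "A n - (- of_real (t^2 / 2)) = (L - (\<i> * of_real (y * ml) - of_real (y^2 / 2 * vl)))
        + \<i> * of_real (y * (ml - ma)) - of_real (y^2 / 2 * (vl - (\<sigma> n)^2))"
    proof -
      have "t * ma / \<sigma> n = - (y * ma)" by (simp add: y_def)
      then have "A n - (- of_real (t^2 / 2)) = \<i> * of_real (- (y * ma)) + L
        + of_real (y^2 / 2 * (\<sigma> n)^2)"
        unfolding A_def v1 by (simp add: y_def L_def ma_def)
      then show ?thesis by (simp add: algebra_simps diff_divide_distrib add_divide_distrib)
    qed
    also have "norm \<dots> \<le> norm (L - (\<i> * of_real (y * ml) - of_real (y^2 / 2 * vl)))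
        + norm (\<i> * complex_of_real (y * (ml - ma))) + norm (complex_of_real (y^2 / 2 * (vl - (\<sigma>
          n)^2)))"
      by (intro order_trans[OF norm_triangle_ineq4] add_right_mono norm_triangle_ineq)
    also have "norm (\<i> * complex_of_real (y * (ml - ma))) = \<bar>y\<bar> * \<bar>ml - ma\<bar>"
      by (simp add: norm_mult flip: of_real_diff)
    also have "norm (complex_of_real (y^2 / 2 * (vl - (\<sigma> n)^2))) = y^2 / 2 * \<bar>vl - (\<sigma> n)^2\<bar>"
      unfolding norm_of_real abs_mult by simp
    also have "\<bar>y\<bar> * \<bar>ml - ma\<bar> \<le> (\<bar>t\<bar> / \<sigma> n) * (18 / real (m n))"
      unfolding y ml_def ma_def using mean_logdet_approx[of "m n" "N n"] elim \<sigma>n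
        by (intro mult_left_mono) auto
    also have "\<dots> = 18 * \<bar>t\<bar> * e n" by (simp add: e_def mult.commute)
    also have "y^2 / 2 * \<bar>vl - (\<sigma> n)^2\<bar> \<le> y^2 / 2 * (20 / real (m n))"
      unfolding vl_def elim(3) using var_logdet_approx[of "m n" "N n"] elim
        by (intro mult_left_mono) auto
    also have "\<dots> = 10 * t^2 * e n * (1 / \<sigma> n)" unfolding y by (simp add: e_def power2_eq_square)
    also have "\<dots> \<le> 10 * t^2 * e n * (1 / s)" using inv e0 by (intro mult_left_mono) auto
    also have "norm (L - (\<i> * of_real (y * ml) - of_real (y^2 / 2 * vl))) \<le> 48 * \<bar>y\<bar>^3 / real (m n)"
      unfolding L_def ml_def vl_def using elim by (intro log_char_logdet_approx) auto
    also have "48 * \<bar>y\<bar>^3 / real (m n) = 48 * \<bar>t\<bar>^3 * e n * (1 / \<sigma> n)^2"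
      unfolding y by (simp add: e_def power2_eq_square power3_eq_cube)
    also have "\<dots> \<le> 48 * \<bar>t\<bar>^3 * e n * (1 / s)^2"
      using inv e0 \<sigma>n by (intro mult_left_mono power_mono) auto
    finally show ?case by (simp add: K_def power_divide algebra_simps)
  qed
  have "(\<lambda>n. K * e n) \<longlonglongrightarrow> K * 0" unfolding e_def by (intro tendsto_intros lim)
  then have "(\<lambda>n. A n - (- of_real (t^2 / 2))) \<longlonglongrightarrow> 0"
    by (intro Lim_null_comparison[OF bound]) simp
  then show "(\<lambda>n. \<i> * of_real (t * mean_approx (N n) (m n) / \<sigma> n)
            + log_char_logdet (N n) (m n) (- t / \<sigma> n)) \<longlonglongrightarrow> - of_real (t^2 / 2)"
    unfolding A_def by (rule Lim_transform2[OF _ , rotated, THEN LIM_zero_cancel, rotated]) auto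
qed

section \<open>The two asymptotic regimes\<close>

lemma var_approx_pos:
  assumes "1 \<le> m" "m < N" shows "var_approx N m > 0"
proof -
  define x where "x = real m / real N"
  have x: "0 < x" "x < 1" using assms by (auto simp: x_def)
  have "ln x < x - 1"
    using ln_le_minus_one[of x] ln_eq_minus_one[of x] x by fastforce
  moreover have "(real N - real m) / real N = 1 - x" using assms
    by (simp add: x_def diff_divide_distrib)
  ultimately show ?thesis unfolding var_approx_def x_def[symmetric] by simp
qed

text \<open>If p/N tends to c, then m = N - p grows linearly and the variance tends to - 2 (c + ln
  (1 - c)) > 0. If m tends to d, the variance diverges logarithmically in N. Either way \<sigma>
  stays away from 0 and m \<sigma> tends to infinity.\<close>

lemma scaling_conditions:
  fixes N p :: "nat \<Rightarrow> nat"
  assumes N: "filterlim N at_top sequentially" and le: "\<And>n. p n \<le> N n"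
    and regime: "((\<lambda>n. real (p n) / real (N n)) \<longlonglongrightarrow> c \<and> 0 < c \<and> c < 1) \<or>
                 ((\<lambda>n. real (N n) - real (p n)) \<longlonglongrightarrow> d \<and> 4 \<le> d)"
  shows "\<forall>\<^sub>F n in sequentially. 1 \<le> N n - p n \<and> N n - p n < N n"
    and "\<exists>s>0. \<forall>\<^sub>F n in sequentially. sqrt (var_approx (N n) (N n - p n)) \<ge> s"
    and "(\<lambda>n. 1 / (real (N n - p n) * sqrt (var_approx (N n) (N n - p n)))) \<longlonglongrightarrow> 0"
proof -
  define m where "m n = N n - p n" for n
  define \<sigma> where "\<sigma> n = sqrt (var_approx (N n) (m n))" for n
  have mr: "real (m n) = real (N n) - real (p n)" for n using le[of n] by (simp add: m_def)
  have Nr: "filterlim (\<lambda>n. real (N n)) at_top sequentially"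
    by (rule filterlim_compose[OF filterlim_real_sequentially N])
  have N1: "\<forall>\<^sub>F n in sequentially. real (N n) \<ge> 1" using Nr unfolding filterlim_at_top by blast
  have "(\<forall>\<^sub>F n in sequentially. 1 \<le> m n \<and> m n < N n) \<and>
        (\<exists>s>0. \<forall>\<^sub>F n in sequentially. \<sigma> n \<ge> s) \<and> ((\<lambda>n. 1 / (real (m n) * \<sigma> n)) \<longlonglongrightarrow> 0)"
    using regime
  proof
    assume *: "(\<lambda>n. real (p n) / real (N n)) \<longlonglongrightarrow> c \<and> 0 < c \<and> c < 1"
    have r: "\<forall>\<^sub>F n in sequentially. real (m n) / real (N n) = 1 - real (p n) / real (N n)"
      using N1 by eventually_elim (simp add: mr diff_divide_distrib)
    have "(\<lambda>n. 1 - real (p n) / real (N n)) \<longlonglongrightarrow> 1 - c" using * by (intro tendsto_intros) auto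
    then have rl: "(\<lambda>n. real (m n) / real (N n)) \<longlonglongrightarrow> 1 - c"
      using r by (simp add: tendsto_cong)
    have "filterlim (\<lambda>n. real (m n) / real (N n) * real (N n)) at_top sequentially"
      using * by (intro filterlim_tendsto_pos_mult_at_top[OF rl _ Nr]) auto
    then have mt: "filterlim (\<lambda>n. real (m n)) at_top sequentially"
      using N1 by (elim filterlim_mono_eventually) (auto elim!: eventually_mono)
    have m1: "\<forall>\<^sub>F n in sequentially. real (m n) \<ge> 1" using mt unfolding filterlim_at_top by blast
    have p1: "\<forall>\<^sub>F n in sequentially. real (p n) / real (N n) > 0"
      using * order_tendstoD(1)[of _ c sequentially 0] by blast
    have A: "\<forall>\<^sub>F n in sequentially. 1 \<le> m n \<and> m n < N n"
      using m1 p1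
    proof eventually_elim
      case (elim n)
      then have "p n > 0" "m n \<ge> 1" by (auto simp: zero_less_divide_iff)
      then show ?case by (auto simp: m_def)
    qed
    define v where "v = - 2 * (c + ln (1 - c))"
    have "ln (1 - c) < (1 - c) - 1"
      using ln_le_minus_one[of "1 - c"] ln_eq_minus_one[of "1 - c"] * by fastforce
    then have v: "v > 0" by (simp add: v_def)
    have "(\<lambda>n. - 2 * ((1 - real (m n) / real (N n)) + ln (real (m n) / real (N n)))) \<longlonglongrightarrow> - 2 * ((1 - (1
      - c)) + ln (1 - c))"
      using * by (intro tendsto_intros rl) auto
    moreover have "\<forall>\<^sub>F n in sequentially. - 2 * ((1 - real (m n) / real (N n))
      + ln (real (m n) / real (N n))) = var_approx (N n) (m n)"
      using N1 by eventually_elim (simp add: var_approx_def diff_divide_distrib)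
    ultimately have "(\<lambda>n. var_approx (N n) (m n)) \<longlonglongrightarrow> v"
      by (simp add: v_def tendsto_cong)
    then have \<sigma>l: "\<sigma> \<longlonglongrightarrow> sqrt v" unfolding \<sigma>_def by (intro tendsto_intros)
    have "sqrt v / 2 < sqrt v" using v by simp
    then have B: "\<forall>\<^sub>F n in sequentially. \<sigma> n \<ge> sqrt v / 2"
      using order_tendstoD(1)[OF \<sigma>l, of "sqrt v / 2"] by (auto elim: eventually_mono)
    have "filterlim (\<lambda>n. \<sigma> n * real (m n)) at_top sequentially"
      using v by (intro filterlim_tendsto_pos_mult_at_top[OF \<sigma>l _ mt]) auto
    then have "(\<lambda>n. 1 / (real (m n) * \<sigma> n)) \<longlonglongrightarrow> 0"
      by (intro tendsto_divide_0[OF tendsto_const] filterlim_at_top_imp_at_infinity) (simp add: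
        mult.commute)
    then show ?thesis using A B v by (intro conjI exI[of _ "sqrt v / 2"]) auto
  next
    assume *: "(\<lambda>n. real (N n) - real (p n)) \<longlonglongrightarrow> d \<and> 4 \<le> d"
    then have ml: "(\<lambda>n. real (m n)) \<longlonglongrightarrow> d" by (simp add: mr)
    have m1: "\<forall>\<^sub>F n in sequentially. real (m n) > 3" using order_tendstoD(1)[OF ml, of 3] * by auto
    have m2: "\<forall>\<^sub>F n in sequentially. real (m n) < d + 1" using order_tendstoD(2)[OF ml, of "d+1"]
      by auto
    have Nd: "\<forall>\<^sub>F n in sequentially. real (N n) \<ge> d + 1" using Nr unfolding filterlim_at_top by blast
    have A: "\<forall>\<^sub>F n in sequentially. 1 \<le> m n \<and> m n < N n"
      using m1 m2 Nd by eventually_elim auto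
    \<comment> \<open>This minorises the variance, since (N - m)/N \<le> 1 and eventually m < d +
      1.\<close>
    have "filterlim (\<lambda>n. - 2 + 2 * ln (real (N n) / (d + 1))) at_top sequentially"
    proof -
      have "filterlim (\<lambda>x::real. - 2 + 2 * ln (x / (d + 1))) at_top at_top"
        using * by real_asymp
      from filterlim_compose[OF this Nr] show ?thesis .
    qed
    then have vt: "filterlim (\<lambda>n. var_approx (N n) (m n)) at_top sequentially"
    proof (rule filterlim_at_top_mono)
      show "\<forall>\<^sub>F n in sequentially. - 2 + 2 * ln (real (N n) / (d + 1)) \<le> var_approx (N n) (m n)"
        using m1 m2 Nd
      proof eventually_elim
        case (elim n)
        have "(real (N n) - real (m n)) / real (N n) \<le> 1" using elim by (simp add: divide_simps)
        moreover have "ln (real (m n) / real (N n)) \<le> - ln (real (N n) / (d + 1))"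
        proof -
          have "- ln (real (N n) / (d + 1)) = ln ((d + 1) / real (N n))"
            using elim * by (simp add: ln_div)
          moreover have "ln (real (m n) / real (N n)) \<le> ln ((d + 1) / real (N n))"
            using elim * by (subst ln_le_cancel_iff) (auto intro!: divide_right_mono)
          ultimately show ?thesis by simp
        qed
        moreover have "- 2 + 2 * l \<le> - 2 * (q + r)" if "q \<le> 1" "r \<le> - l" for q r l :: real
          using that by simp
        ultimately show ?case unfolding var_approx_def by blast
      qed
    qed
    have \<sigma>t: "filterlim \<sigma> at_top sequentially" unfolding \<sigma>_def
      by (rule filterlim_compose[OF sqrt_at_top vt])
    have B: "\<forall>\<^sub>F n in sequentially. \<sigma> n \<ge> 1" using \<sigma>t unfolding filterlim_at_top by blast
    have "filterlim (\<lambda>n. real (m n) * \<sigma> n) at_top sequentially"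
      using * by (intro filterlim_tendsto_pos_mult_at_top[OF ml _ \<sigma>t]) auto
    then have "(\<lambda>n. 1 / (real (m n) * \<sigma> n)) \<longlonglongrightarrow> 0"
      by (intro tendsto_divide_0[OF tendsto_const] filterlim_at_top_imp_at_infinity)
    then show ?thesis using A B by (intro conjI exI[of _ 1]) auto
  qed
  then show "\<forall>\<^sub>F n in sequentially. 1 \<le> N n - p n \<and> N n - p n < N n"
    and "\<exists>s>0. \<forall>\<^sub>F n in sequentially. sqrt (var_approx (N n) (N n - p n)) \<ge> s"
    and "(\<lambda>n. 1 / (real (N n - p n) * sqrt (var_approx (N n) (N n - p n)))) \<longlonglongrightarrow> 0"
    unfolding \<sigma>_def m_def by auto
qed

lemma exp_log_char_logdet:
  assumes "1 \<le> m"
  shows "exp (log_char_logdet N m y) = (\<Prod>j\<in>{m<..N}.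
     Gamma (of_real (real j / 2) + \<i> * of_real y) * Gamma (of_real (real N / 2)) /
     (Gamma (of_real (real j / 2)) * Gamma (of_real (real N / 2) + \<i> * of_real y)))"
  unfolding log_char_logdet_def exp_sum[OF finite_greaterThanAtMost]
proof (rule prod.cong[OF refl])
  fix j assume j: "j \<in> {m<..N}"
  have G: "exp (ln_Gamma (of_real (real k / 2) + \<i> * of_real x)) = Gamma (of_real (real k / 2)
    + \<i> * complex_of_real x)"
    if "k \<in> {m<..N}" for k x
  proof -
    have "complex_of_real (real k / 2) + \<i> * of_real x \<notin> \<real>\<^sub>\<le>\<^sub>0"
      using that assms by (auto simp: complex_nonpos_Reals_iff)
    then have "complex_of_real (real k / 2) + \<i> * of_real x \<notin> \<int>\<^sub>\<le>\<^sub>0"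
      using nonpos_Ints_subset_nonpos_Reals by blast
    then show ?thesis using Gamma_complex_altdef by simp
  qed
  have N: "N \<in> {m<..N}" using j by auto
  show "exp (ln_Gamma (of_real (real j / 2) + \<i> * of_real y) - ln_Gamma (of_real (real j / 2))
     - (ln_Gamma (of_real (real N / 2) + \<i> * of_real y) - ln_Gamma (of_real (real N / 2)))) =
     Gamma (of_real (real j / 2) + \<i> * of_real y) * Gamma (of_real (real N / 2)) /
     (Gamma (of_real (real j / 2)) * Gamma (of_real (real N / 2) + \<i> * of_real y))"
    using G[OF j, of y] G[OF j, of 0] G[OF N, of y] G[OF N, of 0] by (simp add: exp_diff)
qed

section \<open>Moments from Laplace transforms\<close>

text \<open>Meant for x > 0. Being an exponential, it is continuous in w at every base, so limits in
  the exponent can be taken pointwise without excluding a null set.\<close>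

definition cpow :: "real \<Rightarrow> complex \<Rightarrow> complex" where
  "cpow x w = exp (w * of_real (ln x))"

lemma cpow_measurable [measurable]:
  assumes [measurable]: "f \<in> borel_measurable M"
  shows "(\<lambda>x. cpow (f x) w) \<in> borel_measurable M"
  unfolding cpow_def by measurable

lemma cpow_add: "cpow x (v + w) = cpow x v * cpow x w"
  by (simp add: cpow_def distrib_right exp_add)

lemma cpow_mult: "x > 0 \<Longrightarrow> y > 0 \<Longrightarrow> cpow (x * y) w = cpow x w * cpow y w"
  by (simp add: cpow_def ln_mult distrib_left exp_add)

lemma norm_cpow: "x > 0 \<Longrightarrow> norm (cpow x w) = x powr Re w"
  by (simp add: cpow_def powr_def)

lemma cpow_of_real: "x > 0 \<Longrightarrow> cpow x (of_real r) = of_real (x powr r)"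
  by (simp add: cpow_def powr_def exp_of_real flip: of_real_mult)

lemma cpow_one: "x > 0 \<Longrightarrow> cpow x 1 = of_real x"
  using cpow_of_real[of x 1] by simp

lemma cpow_powr: "x > 0 \<Longrightarrow> cpow x w = of_real x powr w"
  by (simp add: cpow_def powr_def Ln_of_real)

text \<open>Integrand of Euler's integral, with integral Gamma z * x^(-z) for x > 0. The case x = 0
  also occurs: it is the mixing weight that remains after the factor exp (- x t) is split
  off.\<close>

definition gamma_kernel :: "complex \<Rightarrow> real \<Rightarrow> real \<Rightarrow> complex" where
  "gamma_kernel z x t = indicator {0<..} t *\<^sub>R (cpow t (z - 1) * of_real (exp (- (x * t))))"

lemma gamma_kernel_measurable [measurable]:
  assumes [measurable]: "f \<in> borel_measurable M" "g \<in> borel_measurable M"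
  shows "(\<lambda>x. gamma_kernel z (f x) (g x)) \<in> borel_measurable M"
  unfolding gamma_kernel_def by measurable

lemma has_bochner_integral_gamma_kernel:
  assumes "Re z > 0" "x > 0"
  shows "has_bochner_integral lborel (gamma_kernel z x) (Gamma z * cpow x (- z))"
proof -
  let ?f = "\<lambda>t. complex_of_real t powr (z - 1) / of_real (exp t)"
  have eq: "indicator {0<..} t *\<^sub>R ?f t = gamma_kernel z 1 t" for t
    by (auto simp: gamma_kernel_def cpow_powr indicator_def exp_minus divide_inverse)
  have "(\<lambda>t. indicator {0<..} t *\<^sub>R ?f t) absolutely_integrable_on UNIV"
    using absolutely_integrable_Gamma_integral'[OF assms(1)]
    by (simp add: set_integrable_def)
  then have "integrable lebesgue (gamma_kernel z 1)"
    unfolding eq by (simp add: set_integrable_def)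
  then have int: "integrable lborel (gamma_kernel z 1)"
    by (subst (asm) integrable_completion) auto
  then have sint: "set_integrable lborel {0<..} ?f"
    unfolding set_integrable_def eq by simp
  have "(LINT t:{0<..}|lborel. ?f t) = integral {0<..} ?f"
    by (rule set_borel_integral_eq_integral(2)[OF sint])
  also have "\<dots> = Gamma z" using Gamma_integral_complex'[OF assms(1)] by (rule integral_unique)
  finally have "integral\<^sup>L lborel (gamma_kernel z 1) = Gamma z"
    unfolding set_lebesgue_integral_def eq .
  with int have 1: "has_bochner_integral lborel (gamma_kernel z 1) (Gamma z)"
    by (simp add: has_bochner_integral_iff)
  then have "has_bochner_integral lborel (\<lambda>t. gamma_kernel z 1 (0 + x * t)) (Gamma z /\<^sub>R \<bar>x\<bar>)"
    using assms(2) by (subst (asm) lborel_has_bochner_integral_real_affine_iff[where c = x and t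
      = 0]) auto
  then have "has_bochner_integral lborel (\<lambda>t. cpow x (1 - z) * gamma_kernel z 1 (0 + x * t))
     (cpow x (1 - z) * (Gamma z /\<^sub>R \<bar>x\<bar>))"
    by (rule has_bochner_integral_mult_right)
  moreover have "cpow x (1 - z) * gamma_kernel z 1 (0 + x * t) = gamma_kernel z x t" for t
  proof (cases "t > 0")
    case True
    have "cpow x (1 - z) * cpow x (z - 1) = 1"
      by (simp add: cpow_def flip: exp_add distrib_right)
    then show ?thesis using True assms(2) by (simp add: gamma_kernel_def cpow_mult)
  next
    case False
    then show ?thesis using assms(2) by (simp add: gamma_kernel_def zero_less_mult_iff)
  qed
  moreover have "cpow x (1 - z) * (Gamma z /\<^sub>R \<bar>x\<bar>) = Gamma z * cpow x (- z)"
  proof -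
    have "cpow x (1 - z) = cpow x 1 * cpow x (- z)" by (simp flip: cpow_add)
    then show ?thesis using assms(2) by (simp add: cpow_one scaleR_conv_of_real field_simps)
  qed
  ultimately show ?thesis by simp
qed

lemma norm_gamma_kernel:
  "complex_of_real (norm (gamma_kernel z x t)) = gamma_kernel (of_real (Re z)) x t"
proof (cases "t > 0")
  case True
  have "gamma_kernel (of_real (Re z)) x t = of_real (t powr (Re z - 1) * exp (- (x * t)))"
    using True cpow_of_real[of t "Re z - 1"] by (simp add: gamma_kernel_def)
  with True show ?thesis by (simp add: gamma_kernel_def norm_mult norm_cpow)
qed (simp add: gamma_kernel_def)

lemma has_bochner_integral_norm_gamma_kernel:
  assumes "Re z > 0" "x > 0"
  shows "has_bochner_integral lborel (\<lambda>t. norm (gamma_kernel z x t)) (Gamma (Re z) * x powr (- Re z))"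
proof -
  have "has_bochner_integral lborel (\<lambda>t. complex_of_real (norm (gamma_kernel z x t)))
      (Gamma (of_real (Re z)) * cpow x (- of_real (Re z)))"
    unfolding norm_gamma_kernel using assms by (intro has_bochner_integral_gamma_kernel) auto
  moreover have "Gamma (of_real (Re z)) * cpow x (- of_real (Re z))
    = complex_of_real (Gamma (Re z) * x powr (- Re z))"
    using assms cpow_of_real[of x "- Re z"] by (simp add: Gamma_complex_of_real)
  ultimately have "has_bochner_integral lborel (\<lambda>t. complex_of_real (norm (gamma_kernel z x t)))
     (complex_of_real (Gamma (Re z) * x powr (- Re z)))" by simp
  from has_bochner_integral_bounded_linear[OF bounded_linear_Re this] show ?thesis by simp
qed

lemma nn_integral_gamma_kernel:
  assumes "r > 0" "x > 0"
  shows "(\<integral>\<^sup>+t. norm (gamma_kernel (of_real r) x t) \<partial>lborel) = ennreal (Gamma r * x powr (- r))"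
  using has_bochner_integral_norm_gamma_kernel[of "of_real r" x] assms
  by (subst nn_integral_eq_integral) (auto simp: has_bochner_integral_iff)

lemma gamma_kernel_exp:
  "gamma_kernel z (x + y) t = gamma_kernel z x t * of_real (exp (- (y * t)))"
  by (simp add: gamma_kernel_def algebra_simps exp_add exp_diff exp_minus divide_inverse)

text \<open>A negative power is a mixture of exponentials, so negative moments are determined by the
  Laplace transform.\<close>

lemma (in sigma_finite_measure) nn_integral_powr_Laplace:
  assumes [measurable]: "w \<in> borel_measurable M" "X \<in> borel_measurable M"
    and pos: "AE x in M. w x \<noteq> 0 \<longrightarrow> X x > 0" and r: "r > 0"
  shows "(\<integral>\<^sup>+x. ennreal (norm (w x :: complex)) * ennreal (X x powr (- r)) \<partial>M) * ennreal (Gamma r)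
       = (\<integral>\<^sup>+l. ennreal (norm (gamma_kernel (of_real r) 0 l)) * (\<integral>\<^sup>+x. ennreal (norm (w x) * exp (- (X
         x * l))) \<partial>M) \<partial>lborel)"
proof -
  interpret pair_sigma_finite M lborel ..
  have "(\<integral>\<^sup>+x. ennreal (norm (w x)) * ennreal (X x powr (- r)) \<partial>M) * ennreal (Gamma r)
     = (\<integral>\<^sup>+x. ennreal (norm (w x)) * ennreal (X x powr (- r)) * ennreal (Gamma r) \<partial>M)"
    by (rule nn_integral_multc[symmetric]) measurable
  also have "\<dots> = (\<integral>\<^sup>+x. (\<integral>\<^sup>+l. ennreal (norm (w x)) * ennreal (norm (gamma_kernel (of_real r) (X x)
    l)) \<partial>lborel) \<partial>M)"
  proof (rule nn_integral_cong_AE)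
    show "AE x in M. ennreal (norm (w x)) * ennreal (X x powr (- r)) * ennreal (Gamma r) =
       (\<integral>\<^sup>+l. ennreal (norm (w x)) * ennreal (norm (gamma_kernel (of_real r) (X x) l)) \<partial>lborel)"
      using pos
    proof eventually_elim
      case (elim x)
      show ?case
      proof (cases "w x = 0")
        case False
        with elim have "X x > 0" by simp
        then have "(\<integral>\<^sup>+l. norm (gamma_kernel (of_real r) (X x) l) \<partial>lborel)
          = ennreal (X x powr (- r)) * ennreal (Gamma r)"
          using nn_integral_gamma_kernel[OF r, of "X x"] Gamma_real_pos[OF r]
          by (simp add: mult.commute ennreal_mult)
        moreover have "(\<integral>\<^sup>+l. ennreal (norm (w x)) * ennreal (norm (gamma_kernel (of_real r) (X x) l))
          \<partial>lborel)
          = ennreal (norm (w x)) * (\<integral>\<^sup>+l. norm (gamma_kernel (of_real r) (X x) l) \<partial>lborel)"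
          by (rule nn_integral_cmult) measurable
        ultimately show ?thesis by (simp add: mult.assoc)
      qed simp
    qed
  qed
  also have "\<dots> = (\<integral>\<^sup>+l. (\<integral>\<^sup>+x. ennreal (norm (w x)) * ennreal (norm (gamma_kernel (of_real r) (X x)
    l)) \<partial>M) \<partial>lborel)"
    by (rule Fubini'[symmetric]) measurable
  also have "\<dots> = (\<integral>\<^sup>+l. ennreal (norm (gamma_kernel (of_real r) 0 l)) * (\<integral>\<^sup>+x. ennreal (norm (w x) *
    exp (- (X x * l))) \<partial>M) \<partial>lborel)"
  proof (rule nn_integral_cong)
    fix l :: real
    have "ennreal (norm (w x)) * ennreal (norm (gamma_kernel (of_real r) (X x) l))
       = ennreal (norm (gamma_kernel (of_real r) 0 l)) * ennreal (norm (w x) * exp (- (X x * l)))" for x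
      using gamma_kernel_exp[of "of_real r" 0 "X x" l]
      by (simp add: norm_mult mult_ac flip: ennreal_mult)
    then show "(\<integral>\<^sup>+x. ennreal (norm (w x)) * ennreal (norm (gamma_kernel (of_real r) (X x) l)) \<partial>M)
      = ennreal (norm (gamma_kernel (of_real r) 0 l)) * (\<integral>\<^sup>+x. ennreal (norm (w x) * exp (- (X x *
        l))) \<partial>M)"
      by (simp add: nn_integral_cmult)
  qed
  finally show ?thesis .
qed

text \<open>Counterpart for complex exponents and weights. Fubini now requires absolute
  integrability, which the hypothesis on the moment of order - Re u supplies.\<close>

lemma (in sigma_finite_measure) integral_cpow_Laplace:
  assumes [measurable]: "w \<in> borel_measurable M" "X \<in> borel_measurable M"
    and pos: "AE x in M. w x \<noteq> 0 \<longrightarrow> X x > 0" and u: "Re u > 0"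
    and int: "integrable M (\<lambda>x. norm (w x :: complex) * X x powr (- Re u))"
  shows "(\<integral>x. w x * cpow (X x) (- u) \<partial>M) * Gamma u
       = (\<integral>l. gamma_kernel u 0 l * (\<integral>x. w x * of_real (exp (- (X x * l))) \<partial>M) \<partial>lborel)"
proof -
  interpret pair_sigma_finite M lborel ..
  define F where "F x l = w x * gamma_kernel u (X x) l" for x l
  have [measurable]: "case_prod F \<in> borel_measurable (M \<Otimes>\<^sub>M lborel)" unfolding F_def by measurable
  have hb: "AE x in M. has_bochner_integral lborel (F x) (w x * cpow (X x) (- u) * Gamma u) \<and>
       has_bochner_integral lborel (\<lambda>l. norm (F x l)) (norm (w x) * X x powr (- Re u) * Gamma (Re u))"
    using pos
  proof eventually_elim
    case (elim x)
    show ?case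
    proof (cases "w x = 0")
      case True
      then have "F x = (\<lambda>l. 0)" by (simp add: F_def fun_eq_iff)
      then show ?thesis using True by (simp add: has_bochner_integral_zero)
    next
      case False
      with elim have "X x > 0" by simp
      then have "has_bochner_integral lborel (\<lambda>l. w x * gamma_kernel u (X x) l) (w x * (Gamma u * cpow
        (X x) (- u)))"
        "has_bochner_integral lborel (\<lambda>l. norm (w x) * norm (gamma_kernel u (X x) l))
           (norm (w x) * (Gamma (Re u) * X x powr (- Re u)))"
        by (auto intro!: has_bochner_integral_mult_right has_bochner_integral_gamma_kernel
            has_bochner_integral_norm_gamma_kernel u)
      then show ?thesis unfolding F_def norm_mult by (simp add: mult_ac)
    qed
  qed
  have intF: "integrable (M \<Otimes>\<^sub>M lborel) (case_prod F)"
  proof (rule Fubini_integrable)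
    have "integrable M (\<lambda>x. norm (w x) * X x powr (- Re u) * Gamma (Re u))"
      using int by simp
    then show "integrable M (\<lambda>x. \<integral>l. norm (case_prod F (x, l)) \<partial>lborel)"
    proof (rule integrable_cong_AE_imp)
      show "AE x in M. norm (w x) * X x powr (- Re u) * Gamma (Re u)
        = (\<integral>l. norm (case_prod F (x, l)) \<partial>lborel)"
        using hb by eventually_elim (simp add: has_bochner_integral_iff)
    qed measurable
    show "AE x in M. integrable lborel (\<lambda>l. case_prod F (x, l))"
      using hb by eventually_elim (auto simp: has_bochner_integral_iff)
  qed simp
  have "(\<integral>x. w x * cpow (X x) (- u) \<partial>M) * Gamma u = (\<integral>x. w x * cpow (X x) (- u) * Gamma u \<partial>M)"
    by (rule integral_mult_left_zero[symmetric])
  also have "\<dots> = (\<integral>x. (\<integral>l. F x l \<partial>lborel) \<partial>M)"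
  proof (rule integral_cong_AE)
    show "AE x in M. w x * cpow (X x) (- u) * Gamma u = (\<integral>l. F x l \<partial>lborel)"
      using hb by eventually_elim (simp add: has_bochner_integral_iff)
  qed measurable
  also have "\<dots> = (\<integral>l. (\<integral>x. F x l \<partial>M) \<partial>lborel)"
    by (rule Fubini_integral[symmetric]) (rule intF)
  also have "(\<lambda>l. \<integral>x. F x l \<partial>M) = (\<lambda>l. gamma_kernel u 0 l * (\<integral>x. w x * of_real (exp (- (X x * l))) \<partial>M))"
  proof
    fix l
    have "F x l = gamma_kernel u 0 l * (w x * of_real (exp (- (X x * l))))" for x
      using gamma_kernel_exp[of u 0 "X x" l] by (simp add: F_def)
    then show "(\<integral>x. F x l \<partial>M) = gamma_kernel u 0 l * (\<integral>x. w x * of_real (exp (- (X x * l))) \<partial>M)"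
      by simp
  qed
  finally show ?thesis .
qed

text \<open>Up to C, the transform is that of a gamma law of shape a and rate c. The mixture
  identity is applied both to that gamma kernel on the line and to the pair (w, X); the same
  integral \<open>?J\<close> results, and it is finite because the gamma kernel has moments of order
  - r for r < a.\<close>

lemma nn_moment_of_Laplace:
  assumes "sigma_finite_measure M"
    and [measurable]: "w \<in> borel_measurable M" "X \<in> borel_measurable M"
    and pos: "AE x in M. w x \<noteq> 0 \<longrightarrow> X x > 0" and r: "0 < r" "r < a" and c: "c > 0" and C: "C \<ge> 0"
    and L: "\<And>l. l > 0 \<Longrightarrow> (\<integral>\<^sup>+x. ennreal (norm (w x :: complex) * exp (- (X x * l))) \<partial>M)
      = ennreal (C * (c + l) powr (- a))"
  shows "(\<integral>\<^sup>+x. ennreal (norm (w x)) * ennreal (X x powr (- r)) \<partial>M) < \<infinity>"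
proof -
  have Gr: "Gamma r > 0" "Gamma a > 0" "Gamma (a - r) > 0" using r by (auto intro!: Gamma_real_pos)
  let ?J = "\<integral>\<^sup>+l. ennreal (norm (gamma_kernel (of_real r) 0 l)) * ennreal ((c + l) powr (- a)) \<partial>lborel"
  have "(\<integral>\<^sup>+x. ennreal (norm (gamma_kernel (of_real a) c x)) * ennreal (x powr (- r)) \<partial>lborel) *
    ennreal (Gamma r)
     = (\<integral>\<^sup>+l. ennreal (norm (gamma_kernel (of_real r) 0 l)) *
         (\<integral>\<^sup>+x. ennreal (norm (gamma_kernel (of_real a) c x) * exp (- (x * l))) \<partial>lborel) \<partial>lborel)"
    by (rule lborel.nn_integral_powr_Laplace[where X = "\<lambda>x. x"]) (use r in \<open>auto simp:
      gamma_kernel_def indicator_def intro!: AE_I2\<close>)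
  also have "\<dots> = (\<integral>\<^sup>+l. ennreal (Gamma a) * (ennreal (norm (gamma_kernel (of_real r) 0 l)) * ennreal
    ((c + l) powr (- a))) \<partial>lborel)"
  proof (rule nn_integral_cong)
    fix l :: real
    show "ennreal (norm (gamma_kernel (of_real r) 0 l)) * (\<integral>\<^sup>+x. ennreal (norm (gamma_kernel (of_real
      a) c x) * exp (- (x * l))) \<partial>lborel)
      = ennreal (Gamma a) * (ennreal (norm (gamma_kernel (of_real r) 0 l)) * ennreal ((c
        + l) powr (- a)))"
    proof (cases "l > 0")
      case True
      have "norm (gamma_kernel (of_real a) c x) * exp (- (x * l)) = norm (gamma_kernel (of_real a) (c
        + l) x)" for x
        using gamma_kernel_exp[of "of_real a" c l x] by (simp add: norm_mult mult.commute)
      then show ?thesis using nn_integral_gamma_kernel[of a "c + l"] True c r Gr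
        by (simp add: mult_ac ennreal_mult'')
    qed (simp add: gamma_kernel_def)
  qed
  also have "\<dots> = ennreal (Gamma a) * ?J" by (rule nn_integral_cmult) measurable
  finally have J1: "(\<integral>\<^sup>+x. ennreal (norm (gamma_kernel (of_real a) c x)) * ennreal (x powr (- r))
    \<partial>lborel) * ennreal (Gamma r)
      = ennreal (Gamma a) * ?J" .
  have "(\<integral>\<^sup>+x. ennreal (norm (gamma_kernel (of_real a) c x)) * ennreal (x powr (- r)) \<partial>lborel)
     = (\<integral>\<^sup>+x. ennreal (norm (gamma_kernel (of_real (a - r)) c x)) \<partial>lborel)"
  proof (rule nn_integral_cong)
    fix x :: real
    show "ennreal (norm (gamma_kernel (of_real a) c x)) * ennreal (x powr (- r))
      = ennreal (norm (gamma_kernel (of_real (a - r)) c x))"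
      by (cases "x > 0") (auto simp: gamma_kernel_def norm_mult norm_cpow powr_add[symmetric] mult_ac
        simp flip: ennreal_mult intro!: arg_cong[where f = ennreal] arg_cong2[where f = "(powr)"])
  qed
  also have "\<dots> < \<infinity>" using nn_integral_gamma_kernel[of "a - r" c] r c by simp
  finally have "ennreal (Gamma a) * ?J < \<infinity>"
    unfolding J1[symmetric] by (simp add: ennreal_mult_less_top)
  then have J: "?J < \<infinity>" using Gr by (auto simp: ennreal_mult_less_top)
  have "(\<integral>\<^sup>+x. ennreal (norm (w x)) * ennreal (X x powr (- r)) \<partial>M) * ennreal (Gamma r)
     = (\<integral>\<^sup>+l. ennreal (norm (gamma_kernel (of_real r) 0 l)) * (\<integral>\<^sup>+x. ennreal (norm (w x) * exp (- (X x
       * l))) \<partial>M) \<partial>lborel)"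
    by (rule sigma_finite_measure.nn_integral_powr_Laplace[OF assms(1)]) (use pos r in auto)
  also have "\<dots> = (\<integral>\<^sup>+l. ennreal C * (ennreal (norm (gamma_kernel (of_real r) 0 l)) * ennreal ((c
    + l) powr (- a))) \<partial>lborel)"
  proof (rule nn_integral_cong)
    fix l :: real
    show "ennreal (norm (gamma_kernel (of_real r) 0 l)) * (\<integral>\<^sup>+x. ennreal (norm (w x) * exp (- (X x *
      l))) \<partial>M)
      = ennreal C * (ennreal (norm (gamma_kernel (of_real r) 0 l)) * ennreal ((c + l) powr (- a)))"
    proof (cases "l > 0")
      case True
      then show ?thesis using L[OF True] C by (simp add: mult_ac ennreal_mult)
    qed (simp add: gamma_kernel_def)
  qed
  also have "\<dots> = ennreal C * ?J" by (rule nn_integral_cmult) measurable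
  also have "\<dots> < \<infinity>" using J by (simp add: ennreal_mult_less_top)
  finally show ?thesis using Gr by (auto simp: ennreal_mult_less_top)
qed

text \<open>The comparison with a gamma kernel now yields values: \<open>?J\<close> is a beta
  integral, read off from the gamma case rather than evaluated directly. The complex weight w
  permits a second use in which w is a negative power of another variable.\<close>

lemma moment_of_Laplace:
  assumes "sigma_finite_measure M"
    and [measurable]: "w \<in> borel_measurable M" "X \<in> borel_measurable M"
    and pos: "AE x in M. w x \<noteq> 0 \<longrightarrow> X x > 0" and u: "0 < Re u" "Re u < Re a" and c: "c > 0"
    and int: "integrable M (\<lambda>x. norm (w x :: complex) * X x powr (- Re u))"
    and L: "\<And>l. l > 0 \<Longrightarrow> (\<integral>x. w x * of_real (exp (- (X x * l))) \<partial>M) = C * cpow (c + l) (- a)"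
  shows "(\<integral>x. w x * cpow (X x) (- u) \<partial>M) = C * cpow c (u - a) * Gamma (a - u) / Gamma a"
proof -
  have np: "z \<notin> \<int>\<^sub>\<le>\<^sub>0" if "Re z > 0" for z :: complex
    using that nonpos_Ints_subset_nonpos_Reals by (auto simp: complex_nonpos_Reals_iff)
  have Gn: "Gamma u \<noteq> 0" "Gamma a \<noteq> 0" using u np by (auto simp: Gamma_eq_zero_iff)
  let ?J = "\<integral>l. gamma_kernel u 0 l * cpow (c + l) (- a) \<partial>lborel"
  have k: "gamma_kernel a c x * cpow x (- u) = gamma_kernel (a - u) c x" for x
    by (auto simp: gamma_kernel_def mult_ac simp flip: cpow_add) (simp add: algebra_simps)
  have "(\<integral>x. gamma_kernel a c x * cpow x (- u) \<partial>lborel) * Gamma u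
     = (\<integral>l. gamma_kernel u 0 l * (\<integral>x. gamma_kernel a c x * of_real (exp (- (x * l))) \<partial>lborel) \<partial>lborel)"
  proof (rule lborel.integral_cpow_Laplace[where X = "\<lambda>x. x"])
    have "norm (gamma_kernel a c x) * x powr (- Re u) = norm (gamma_kernel (a - u) c x)" for x
      by (cases "x > 0") (auto simp: norm_cpow norm_mult simp flip: k, auto simp: gamma_kernel_def)
    then show "integrable lborel (\<lambda>x. norm (gamma_kernel a c x) * x powr - Re u)"
      using has_bochner_integral_norm_gamma_kernel[of "a - u" c] u c
        by (simp add: has_bochner_integral_iff)
  qed (use u in \<open>auto simp: gamma_kernel_def indicator_def intro!: AE_I2\<close>)
  also have "\<dots> = (\<integral>l. Gamma a * (gamma_kernel u 0 l * cpow (c + l) (- a)) \<partial>lborel)"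
  proof (rule Bochner_Integration.integral_cong[OF refl])
    fix l :: real
    show "gamma_kernel u 0 l * (\<integral>x. gamma_kernel a c x * of_real (exp (- (x * l))) \<partial>lborel)
      = Gamma a * (gamma_kernel u 0 l * cpow (c + l) (- a))"
    proof (cases "l > 0")
      case True
      have "gamma_kernel a c x * of_real (exp (- (x * l))) = gamma_kernel a (c + l) x" for x
        using gamma_kernel_exp[of a c l x] by (simp add: mult.commute)
      then show ?thesis using has_bochner_integral_gamma_kernel[of a "c + l"] True c u
        by (simp add: has_bochner_integral_iff)
    qed (simp add: gamma_kernel_def)
  qed
  also have "\<dots> = Gamma a * ?J" by simp
  finally have "Gamma (a - u) * cpow c (u - a) * Gamma u = Gamma a * ?J"
    using has_bochner_integral_gamma_kernel[of "a - u" c] u c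
    unfolding k by (simp add: has_bochner_integral_iff)
  then have J: "?J = Gamma (a - u) * cpow c (u - a) * Gamma u / Gamma a"
    using Gn by (simp add: field_simps)
  have "(\<integral>x. w x * cpow (X x) (- u) \<partial>M) * Gamma u
       = (\<integral>l. gamma_kernel u 0 l * (\<integral>x. w x * of_real (exp (- (X x * l))) \<partial>M) \<partial>lborel)"
    by (rule sigma_finite_measure.integral_cpow_Laplace[OF assms(1)]) (use pos u int in auto)
  also have "\<dots> = (\<integral>l. C * (gamma_kernel u 0 l * cpow (c + l) (- a)) \<partial>lborel)"
  proof (rule Bochner_Integration.integral_cong[OF refl])
    fix l :: real
    show "gamma_kernel u 0 l * (\<integral>x. w x * of_real (exp (- (X x * l))) \<partial>M)
      = C * (gamma_kernel u 0 l * cpow (c + l) (- a))"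
      using L[of l] by (cases "l > 0") (auto simp: gamma_kernel_def)
  qed
  also have "\<dots> = C * ?J" by simp
  finally show ?thesis unfolding J using Gn by (simp add: field_simps)
qed

section \<open>Log-ratio of nested chi-square variables\<close>

lemma Gamma_ne_zero_Re: "Re z > 0 \<Longrightarrow> Gamma z \<noteq> 0"
  using nonpos_Ints_subset_nonpos_Reals[where ?'a = complex]
  by (auto simp: complex_nonpos_Reals_iff Gamma_eq_zero_iff)

text \<open>The Laplace transform is that of two nested chi-square variables, scaled by s, with
  2 a and 2 (a + b) degrees of freedom.\<close>

locale nested_chi_square = prob_space G for G :: "'b measure" +
  fixes A S :: "'b \<Rightarrow> real" and a b s :: real
  assumes A_meas [measurable]: "A \<in> borel_measurable G"
    and S_meas [measurable]: "S \<in> borel_measurable G"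
    and A_nonneg: "\<And>x. x \<in> space G \<Longrightarrow> 0 \<le> A x"
    and A_le_S: "\<And>x. x \<in> space G \<Longrightarrow> A x \<le> S x"
    and apos: "a > 0" and bnonneg: "b \<ge> 0" and spos: "s > 0"
    and Laplace: "\<And>\<alpha> \<mu>. \<alpha> \<ge> 0 \<Longrightarrow> \<mu> \<ge> 0 \<Longrightarrow>
      (\<integral>x. exp (- (A x * \<alpha> + S x * \<mu>)) \<partial>G) = (1 + 2 * s * (\<alpha> + \<mu>)) powr (- a) * (1
        + 2 * s * \<mu>) powr (- b)"
begin

lemma S_nonneg: "x \<in> space G \<Longrightarrow> 0 \<le> S x"
  using A_nonneg A_le_S by (meson order_trans)

lemma integrable_exp_minus:
  assumes "\<alpha> \<ge> 0" "\<mu> \<ge> 0"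
  shows "integrable G (\<lambda>x. exp (- (A x * \<alpha> + S x * \<mu>)))"
proof (rule integrable_const_bound[where B = 1])
  have "0 \<le> A x * \<alpha> + S x * \<mu>" if "x \<in> space G" for x
    using assms A_nonneg[OF that] S_nonneg[OF that] by simp
  then show "AE x in G. norm (exp (- (A x * \<alpha> + S x * \<mu>))) \<le> 1"
    by (intro AE_I2) (simp only: real_norm_def abs_exp_cancel exp_le_one_iff neg_le_0_iff_le)
qed measurable

text \<open>Chernoff bound: the probability of A \<le> 0 is at most the Laplace transform at every l
  \<ge> 0, which tends to 0 because a > 0.\<close>

lemma AE_A_pos: "AE x in G. 0 < A x"
proof -
  have "prob {x \<in> space G. A x \<le> 0} \<le> (1 + 2 * s * l) powr (- a)" if l: "l \<ge> 0" for l
  proof -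
    have "prob {x \<in> space G. A x \<le> 0} = (\<integral>x. indicator {x \<in> space G. A x \<le> 0} x \<partial>G)" by simp
    also have "\<dots> \<le> (\<integral>x. exp (- (A x * l + S x * 0)) \<partial>G)"
      using l A_nonneg
      by (intro integral_mono integrable_exp_minus integrable_const_bound[where B = 1])
         (auto simp: indicator_def intro!: mult_nonpos_nonneg)
    also have "\<dots> = (1 + 2 * s * l) powr (- a)" using Laplace[of l 0] l by simp
    finally show ?thesis .
  qed
  moreover have "((\<lambda>l. (1 + 2 * s * l) powr (- a)) \<longlongrightarrow> 0) at_top" using apos spos by real_asymp
  ultimately have "prob {x \<in> space G. A x \<le> 0} \<le> 0"
    by (intro tendsto_lowerbound[of "\<lambda>l. (1 + 2 * s * l) powr (- a)" 0 at_top])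
       (auto intro: eventually_mono[OF eventually_ge_at_top[of 0]])
  then have "prob {x \<in> space G. A x \<le> 0} = 0" using measure_nonneg[of G] by (simp add: antisym)
  then show ?thesis by (subst (asm) prob_eq_0) (auto simp: not_le)
qed

text \<open>The rate for which 1 + 2 s l = (c0 + l) / c0, giving the transform the form expected by
  \<open>moment_of_Laplace\<close>.\<close>

definition "c0 = 1 / (2 * s)"

lemma c0: "c0 > 0" using spos by (simp add: c0_def)

lemma Laplace_c0:
  assumes "\<alpha> \<ge> 0" "\<mu> \<ge> 0"
  shows "(\<integral>x. exp (- (A x * \<alpha> + S x * \<mu>)) \<partial>G) = c0 powr (a + b) * (c0 + \<mu> + \<alpha>) powr (- a) * (c0
    + \<mu>) powr (- b)"
proof -
  have "1 + 2 * s * (\<alpha> + \<mu>) = (c0 + \<mu> + \<alpha>) / c0" "1 + 2 * s * \<mu> = (c0 + \<mu>) / c0"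
    using spos by (auto simp: c0_def field_simps)
  then have "(1 + 2 * s * (\<alpha> + \<mu>)) powr (- a) * (1 + 2 * s * \<mu>) powr (- b)
    = ((c0 + \<mu> + \<alpha>) powr (- a) / c0 powr (- a)) * ((c0 + \<mu>) powr (- b) / c0 powr (- b))"
    using c0 assms by (simp add: powr_divide)
  also have "\<dots> = c0 powr (a + b) * (c0 + \<mu> + \<alpha>) powr (- a) * (c0 + \<mu>) powr (- b)"
    using c0 by (simp add: powr_minus powr_add field_simps)
  finally show ?thesis using Laplace[OF assms] by simp
qed

lemma integrable_A_powr:
  assumes "0 < r" "r < a"
  shows "integrable G (\<lambda>x. A x powr (- r))"
proof -
  have "(\<integral>\<^sup>+x. ennreal (norm (1::complex)) * ennreal (A x powr (- r)) \<partial>G) < \<infinity>"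
  proof (rule nn_moment_of_Laplace[where C = "c0 powr (a + b) * c0 powr (- b)" and c = c0 and a = a])
    fix l :: real assume "l > 0"
    then show "(\<integral>\<^sup>+x. ennreal (norm (1::complex) * exp (- (A x * l))) \<partial>G) = ennreal (c0 powr (a
      + b) * c0 powr (- b) * (c0 + l) powr (- a))"
      using Laplace_c0[of l 0] integrable_exp_minus[of l 0]
      by (subst nn_integral_eq_integral) (auto simp: mult_ac)
  qed (use AE_A_pos assms c0 in \<open>auto intro!: sigma_finite_measure_axioms\<close>)
  then show ?thesis by (intro integrableI_bounded) auto
qed

text \<open>For fixed \<mu> the joint transform is a multiple of (c0 + \<mu> + \<alpha>)^(-a), so
  the moment formula applies in \<alpha> with weight exp (- S \<mu>). As a function of \<mu> the
  result is again a power of c0 + \<mu>, hence a transform to which the formula applies once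
  more.\<close>

lemma moment_A:
  assumes u: "0 < Re u" "Re u < a" and m: "\<mu> \<ge> 0"
  shows "(\<integral>x. of_real (exp (- (S x * \<mu>))) * cpow (A x) (- u) \<partial>G)
       = cpow c0 (of_real (a + b)) * cpow (c0 + \<mu>) (u - of_real (a
         + b)) * Gamma (of_real a - u) / Gamma (of_real a)"
proof -
  have c: "c0 + \<mu> > 0" using c0 m by simp
  have "(\<integral>x. of_real (exp (- (S x * \<mu>))) * cpow (A x) (- u) \<partial>G)
    = (cpow c0 (of_real (a + b)) * cpow (c0 + \<mu>) (- of_real b)) * cpow (c0
      + \<mu>) (u - of_real a) * Gamma (of_real a - u) / Gamma (of_real a)"
  proof (rule moment_of_Laplace)
    show "integrable G (\<lambda>x. norm (complex_of_real (exp (- (S x * \<mu>)))) * A x powr (- Re u))"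
    proof (rule Bochner_Integration.integrable_bound[OF integrable_A_powr[OF u]])
      show "AE x in G. norm (norm (complex_of_real (exp (- (S x * \<mu>)))) * A x powr (- Re u))
        \<le> norm (A x powr (- Re u))"
        using m S_nonneg by (intro AE_I2) (auto intro!: mult_left_le_one_le)
    qed simp
    fix l :: real assume l: "l > 0"
    have "(\<integral>x. complex_of_real (exp (- (S x * \<mu>))) * of_real (exp (- (A x * l))) \<partial>G)
       = (\<integral>x. complex_of_real (exp (- (A x * l + S x * \<mu>))) \<partial>G)"
      by (simp add: exp_add[symmetric] exp_of_real[symmetric] algebra_simps del:
        integral_complex_of_real)
    also have "\<dots> = of_real (c0 powr (a + b) * (c0 + \<mu> + l) powr (- a) * (c0 + \<mu>) powr (- b))"
      using Laplace_c0[of l \<mu>] l m by simp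
    also have "\<dots> = cpow c0 (of_real (a + b)) * cpow (c0 + \<mu>) (- of_real b) * cpow (c0 + \<mu>
      + l) (- of_real a)"
      using cpow_of_real[OF c0, of "a + b"] cpow_of_real[of "c0 + \<mu>
        + l" "- a"] cpow_of_real[OF c, of "- b"] c l
      by simp
    finally show "(\<integral>x. complex_of_real (exp (- (S x * \<mu>))) * of_real (exp (- (A x * l))) \<partial>G)
      = cpow c0 (of_real (a + b)) * cpow (c0 + \<mu>) (- of_real b) * cpow (c0 + \<mu> + l) (- of_real a)" .
  qed (use AE_A_pos u c in \<open>auto intro!: sigma_finite_measure_axioms\<close>)
  also have "cpow (c0 + \<mu>) (u - of_real (a + b)) = cpow (c0 + \<mu>) (- of_real b) * cpow (c0
    + \<mu>) (u - of_real a)"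
    by (simp add: algebra_simps flip: cpow_add)
  then show ?thesis using calculation by (simp add: mult_ac)
qed

text \<open>S \<ge> A turns the mixed moment into one of A alone, and the summand 1 covers A \<ge>
  1. The bound is uniform in e \<le> r, so it also dominates the limit e -> 0.\<close>

lemma powr_AS_le:
  assumes "x \<in> space G" "A x > 0" "0 < e" "e \<le> r"
  shows "A x powr (- e) * S x powr (- e) \<le> 1 + A x powr (- (2 * r))"
proof -
  have S: "S x > 0" using assms A_le_S[of x] by simp
  have "S x powr (- e) \<le> A x powr (- e)"
    using assms A_le_S[of x] by (intro powr_mono2') auto
  then have "A x powr (- e) * S x powr (- e) \<le> A x powr (- e) * A x powr (- e)"
    by (intro mult_left_mono) auto
  also have "\<dots> = A x powr (- (2 * e))" by (simp flip: powr_add)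
  also have "\<dots> \<le> 1 + A x powr (- (2 * r))"
  proof (cases "A x \<ge> 1")
    case True
    then have "A x powr (- (2 * e)) \<le> 1 powr (- (2 * e))" using assms by (intro powr_mono2') auto
    also have "\<dots> \<le> 1 + A x powr (- (2 * r))" by simp
    finally show ?thesis .
  next
    case False
    then have "A x powr (- (2 * e)) \<le> A x powr (- (2 * r))" using assms by (intro powr_mono') auto
    then show ?thesis by simp
  qed
  finally show ?thesis .
qed

text \<open>Second use of \<open>moment_of_Laplace\<close>, in the variable S with weight
  \<open>cpow (A x) (- u)\<close>. The condition 2 * e < a makes the dominating power of A
  integrable.\<close>

lemma moment_AS:
  assumes u: "Re u = e" and v: "Re v = e" and e: "0 < e" "2 * e < a"
  shows "(\<integral>x. cpow (A x) (- u) * cpow (S x) (- v) \<partial>G)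
    = cpow c0 (u + v) * Gamma (of_real a - u) * Gamma (of_real (a + b) - (u + v))
       / (Gamma (of_real a) * Gamma (of_real (a + b) - u))"
proof -
  let ?a = "of_real (a + b) - u"
  have "(\<integral>x. cpow (A x) (- u) * cpow (S x) (- v) \<partial>G)
    = (cpow c0 (of_real (a + b)) * Gamma (of_real a - u) / Gamma (of_real a)) * cpow c0 (v - ?a) *
      Gamma (?a - v) / Gamma ?a"
  proof (rule moment_of_Laplace)
    show "AE x in G. cpow (A x) (- u) \<noteq> 0 \<longrightarrow> 0 < S x"
      using AE_A_pos AE_space by eventually_elim (use A_le_S in force)
    show "0 < Re v" "Re v < Re ?a" using assms bnonneg by auto
    show "integrable G (\<lambda>x. norm (cpow (A x) (- u)) * S x powr (- Re v))"
    proof (rule Bochner_Integration.integrable_bound)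
      show "integrable G (\<lambda>x. 1 + A x powr (- (2 * e)))" using integrable_A_powr[of "2 * e"] e by simp
      show "AE x in G. norm (norm (cpow (A x) (- u)) * S x powr (- Re v)) \<le> norm (1
        + A x powr (- (2 * e)))"
        using AE_A_pos AE_space
        by eventually_elim (use powr_AS_le[of _ e e] e in \<open>auto simp: norm_cpow u v\<close>)
    qed measurable
    fix l :: real assume "l > 0"
    then show "(\<integral>x. cpow (A x) (- u) * of_real (exp (- (S x * l))) \<partial>G) =
      cpow c0 (of_real (a + b)) * Gamma (of_real a - u) / Gamma (of_real a) * cpow (c0 + l) (- ?a)"
      using moment_A[of u l] assms apos by (simp add: mult_ac)
  qed (auto intro!: sigma_finite_measure_axioms c0)
  also have "cpow c0 (of_real (a + b)) * cpow c0 (v - ?a) = cpow c0 (u + v)"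
    by (simp add: add.commute flip: cpow_add)
  then have "(cpow c0 (of_real (a + b)) * Gamma (of_real a - u) / Gamma (of_real a)) * cpow c0 (v -
    ?a) * Gamma (?a - v) / Gamma ?a
     = cpow c0 (u + v) * Gamma (of_real a - u) * Gamma (of_real (a + b) - (u + v))
       / (Gamma (of_real a) * Gamma (of_real (a + b) - u))"
    by (simp add: algebra_simps)
  finally show ?thesis .
qed

text \<open>The log-ratio calls for purely imaginary exponents, whereas the moment formula holds for
  positive real part. They are reached as limits of e - i \<tau> and e + i \<tau>; since these add
  up to 2 e, the scale factor \<open>cpow c0 (u + v)\<close> tends to 1 and s disappears.\<close>

theorem char_ln_ratio:
  "(\<integral>x. exp (\<i> * of_real (\<tau> * (ln (A x) - ln (S x)))) \<partial>G)
    = Gamma (of_real a + \<i> * of_real \<tau>) * Gamma (of_real (a + b))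
       / (Gamma (of_real a) * Gamma (of_real (a + b) + \<i> * of_real \<tau>))" (is "?lhs = ?rhs")
proof -
  \<comment> \<open>Starting at a/3 keeps 2 * e k below a.\<close>
  define e where "e k = (a / 3) / real (Suc k)" for k
  have e0: "e \<longlonglongrightarrow> 0" unfolding e_def by real_asymp
  have e: "0 < e k" "e k \<le> a / 3" for k
    using apos by (auto simp: e_def field_simps)
  define u v where "u k = of_real (e k) - \<i> * of_real \<tau>" and "v k = of_real (e k) + \<i> * of_real \<tau>" for k
  have ul: "u \<longlonglongrightarrow> - (\<i> * of_real \<tau>)" and vl: "v \<longlonglongrightarrow> \<i> * of_real \<tau>"
    unfolding u_def v_def
    using tendsto_diff[OF tendsto_of_real[OF e0, where 'a = complex] tendsto_const[of "\<i> * of_real \<tau>"]]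
      tendsto_add[OF tendsto_of_real[OF e0, where 'a = complex] tendsto_const[of "\<i> * of_real \<tau>"]]
        by auto
  have pw: "(\<lambda>k. cpow (A x) (- u k) * cpow (S x) (- v k)) \<longlonglongrightarrow> exp (\<i> * of_real (\<tau> * (ln (A x) - ln (S
    x))))" for x
  proof -
    have "(\<lambda>k. cpow (A x) (- u k) * cpow (S x) (- v k)) \<longlonglongrightarrow>
        exp (- (- (\<i> * of_real \<tau>)) * of_real (ln (A x))) * exp (- (\<i> * of_real \<tau>) * of_real (ln (S x)))"
      unfolding cpow_def by (intro tendsto_intros ul vl)
    also have "exp (- (- (\<i> * of_real \<tau>)) * of_real (ln (A x))) * exp (- (\<i> * of_real \<tau>) * of_real (ln
      (S x)))
       = exp (\<i> * of_real (\<tau> * (ln (A x) - ln (S x))))"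
      by (simp add: algebra_simps flip: exp_add)
    finally show ?thesis .
  qed
  have "(\<lambda>k. \<integral>x. cpow (A x) (- u k) * cpow (S x) (- v k) \<partial>G) \<longlonglongrightarrow> ?lhs"
  proof (rule integral_dominated_convergence)
    show "integrable G (\<lambda>x. 1 + A x powr (- (2 * (a / 3))))"
      using integrable_A_powr[of "2 * (a/3)"] apos by simp
    show "AE x in G. norm (cpow (A x) (- u k) * cpow (S x) (- v k)) \<le> 1 + A x powr (- (2 * (a / 3)))"
      for k
      using AE_A_pos AE_space
    proof eventually_elim
      case (elim x)
      then have "0 < S x" using A_le_S[of x] by simp
      with elim powr_AS_le[of x "e k" "a / 3"] e show ?case
        by (simp add: norm_mult norm_cpow u_def v_def)
    qed
    show "AE x in G. (\<lambda>k. cpow (A x) (- u k) * cpow (S x) (- v k)) \<longlonglongrightarrow> exp (\<i> * of_real (\<tau> * (ln (A x) -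
      ln (S x))))"
      by (intro AE_I2 pw)
  qed measurable
  moreover have "(\<lambda>k. \<integral>x. cpow (A x) (- u k) * cpow (S x) (- v k) \<partial>G) \<longlonglongrightarrow> ?rhs"
  proof -
    have eq: "(\<integral>x. cpow (A x) (- u k) * cpow (S x) (- v k) \<partial>G)
       = cpow c0 (u k + v k) * Gamma (of_real a - u k) * Gamma (of_real (a + b) - (u k + v k))
       / (Gamma (of_real a) * Gamma (of_real (a + b) - u k))" for k
      using e[of k] apos by (intro moment_AS[of _ "e k"]) (auto simp: u_def v_def)
    have np: "Gamma z \<noteq> 0" "z \<notin> \<int>\<^sub>\<le>\<^sub>0" if "Re z > 0" for z :: complex
      using that Gamma_ne_zero_Re[of z] by (auto simp: Gamma_eq_zero_iff)
    have "(\<lambda>k. cpow c0 (u k + v k) * Gamma (of_real a - u k) * Gamma (of_real (a + b) - (u k + v k))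
       / (Gamma (of_real a) * Gamma (of_real (a + b) - u k)))
      \<longlonglongrightarrow> cpow c0 (- (\<i> * of_real \<tau>) + \<i> * of_real \<tau>) * Gamma (of_real a - (- (\<i> * of_real \<tau>)))
         * Gamma (of_real (a + b) - (- (\<i> * of_real \<tau>) + \<i> * of_real \<tau>))
       / (Gamma (of_real a) * Gamma (of_real (a + b) - (- (\<i> * of_real \<tau>))))"
      unfolding cpow_def using apos bnonneg
      by (intro tendsto_intros ul vl) (auto intro!: np)
    then show ?thesis unfolding eq by (simp add: cpow_def)
  qed
  ultimately show ?thesis by (rule LIMSEQ_unique)
qed

end

section \<open>Orthonormal systems\<close>

definition ip :: "'i set \<Rightarrow> ('i \<Rightarrow> real) \<Rightarrow> ('i \<Rightarrow> real) \<Rightarrow> real" where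
  "ip I a b = (\<Sum>t\<in>I. a t * b t)"

lemma ip_commute: "ip I a b = ip I b a"
  by (simp add: ip_def mult.commute)

lemma ip_add_left: "ip I (\<lambda>t. a t + b t) c = ip I a c + ip I b c"
  by (simp add: ip_def distrib_right sum.distrib)

lemma ip_diff_left: "ip I (\<lambda>t. a t - b t) c = ip I a c - ip I b c"
  by (simp add: ip_def left_diff_distrib sum_subtractf)

lemma ip_scale_left: "ip I (\<lambda>t. r * a t) c = r * ip I a c"
  by (simp add: ip_def sum_distrib_left mult.assoc)

lemma ip_sum_left: "ip I (\<lambda>t. \<Sum>l\<in>L. a l t) c = (\<Sum>l\<in>L. ip I (a l) c)"
  unfolding ip_def sum_distrib_right by (rule sum.swap)

lemma ip_add_right: "ip I c (\<lambda>t. a t + b t) = ip I c a + ip I c b"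
  by (simp add: ip_def distrib_left sum.distrib)

lemma ip_diff_right: "ip I c (\<lambda>t. a t - b t) = ip I c a - ip I c b"
  by (simp add: ip_def right_diff_distrib sum_subtractf)

lemma ip_scale_right: "ip I c (\<lambda>t. r * a t) = r * ip I c a"
  by (simp add: ip_def sum_distrib_left mult_ac)

lemma ip_sum_right: "ip I c (\<lambda>t. \<Sum>l\<in>L. a l t) = (\<Sum>l\<in>L. ip I c (a l))"
  unfolding ip_def sum_distrib_left by (rule sum.swap)

lemmas ip_simps = ip_add_left ip_diff_left ip_scale_left ip_sum_left
  ip_add_right ip_diff_right ip_scale_right ip_sum_right

lemma ip_nonneg: "0 \<le> ip I a a"
  by (simp add: ip_def sum_nonneg)

lemma ip_eq_0_iff: "finite I \<Longrightarrow> ip I a a = 0 \<longleftrightarrow> (\<forall>t\<in>I. a t = 0)"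
  by (simp add: ip_def sum_nonneg_eq_0_iff)

definition orthonormal :: "'i set \<Rightarrow> (nat \<Rightarrow> 'i \<Rightarrow> real) \<Rightarrow> nat \<Rightarrow> bool" where
  "orthonormal I e r \<longleftrightarrow> (\<forall>l<r. \<forall>m<r. ip I (e l) (e m) = of_bool (l = m))"

definition residual :: "'i set \<Rightarrow> (nat \<Rightarrow> 'i \<Rightarrow> real) \<Rightarrow> nat \<Rightarrow> ('i \<Rightarrow> real) \<Rightarrow> 'i \<Rightarrow> real" where
  "residual I e r z = (\<lambda>t. z t - (\<Sum>l<r. ip I (e l) z * e l t))"

lemma sum_of_bool_eq: "finite A \<Longrightarrow> m \<in> A \<Longrightarrow> (\<Sum>l\<in>A. c l * of_bool (l = m)) = (c m :: real)"
  by (simp add: of_bool_def if_distrib sum.delta' cong: if_cong)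

lemma residual_orthogonal:
  assumes "orthonormal I e r" "m < r"
  shows "ip I (e m) (residual I e r z) = 0"
proof -
  have "(\<Sum>l<r. ip I (e l) z * ip I (e m) (e l)) = (\<Sum>l<r. ip I (e l) z * of_bool (l = m))"
    using assms by (intro sum.cong) (auto simp: orthonormal_def)
  then show ?thesis using assms by (simp add: residual_def ip_simps sum_of_bool_eq)
qed

lemma ip_residual:
  assumes "orthonormal I e r"
  shows "ip I (residual I e r z) (residual I e r z) = ip I z z - (\<Sum>l<r. (ip I (e l) z)\<^sup>2)"
proof -
  have "ip I (residual I e r z) (residual I e r z)
    = ip I (residual I e r z) z - (\<Sum>l<r. ip I (e l) z * ip I (residual I e r z) (e l))"
    by (subst (2) residual_def) (simp add: ip_simps)
  also have "(\<Sum>l<r. ip I (e l) z * ip I (residual I e r z) (e l)) = 0"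
    using residual_orthogonal[OF assms] by (intro sum.neutral) (simp add: ip_commute)
  also have "ip I (residual I e r z) z = ip I z z - (\<Sum>l<r. (ip I (e l) z)\<^sup>2)"
    by (simp add: residual_def ip_simps power2_eq_square)
  finally show ?thesis by simp
qed

abbreviation unit_fun :: "'i \<Rightarrow> 'i \<Rightarrow> real" where "unit_fun t \<equiv> (\<lambda>x. of_bool (x = t))"

lemma ip_unit: "finite I \<Longrightarrow> t \<in> I \<Longrightarrow> ip I e (unit_fun t) = e t"
  by (simp add: ip_def sum_of_bool_eq)

text \<open>Trace of the projection onto the orthogonal complement. This one count yields all
  dimension arguments: its nonnegativity bounds r, a positive value allows an extension of the
  system, and the value 0 makes it complete.\<close>

lemma residual_trace:
  assumes "finite I" "orthonormal I e r"
  shows "(\<Sum>t\<in>I. ip I (residual I e r (unit_fun t)) (residual I e r (unit_fun t)))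
    = real (card I) - real r"
proof -
  have "(\<Sum>t\<in>I. ip I (residual I e r (unit_fun t)) (residual I e r (unit_fun t)))
     = (\<Sum>t\<in>I. 1 - (\<Sum>l<r. (e l t)\<^sup>2))"
    using assms by (intro sum.cong) (simp_all add: ip_residual ip_unit)
  also have "\<dots> = real (card I) - (\<Sum>l<r. \<Sum>t\<in>I. (e l t)\<^sup>2)"
    by (simp add: sum_subtractf) (rule sum.swap)
  also have "(\<Sum>l<r. \<Sum>t\<in>I. (e l t)\<^sup>2) = (\<Sum>l<r. ip I (e l) (e l))"
    by (simp add: ip_def power2_eq_square)
  also have "\<dots> = real r" using assms(2) by (simp add: orthonormal_def)
  finally show ?thesis .
qed

lemma orthonormal_le_card:
  assumes "finite I" "orthonormal I e r" shows "r \<le> card I"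
proof -
  have "0 \<le> (\<Sum>t\<in>I. ip I (residual I e r (unit_fun t)) (residual I e r (unit_fun t)))"
    by (intro sum_nonneg ip_nonneg)
  then show ?thesis using residual_trace[OF assms] by simp
qed

lemma residual_eq_sum_unit:
  assumes "finite I" "x \<in> I"
  shows "residual I e r z x = (\<Sum>t\<in>I. z t * residual I e r (unit_fun t) x)"
proof -
  have "(\<Sum>t\<in>I. z t * residual I e r (unit_fun t) x)
     = (\<Sum>t\<in>I. z t * of_bool (x = t)) - (\<Sum>t\<in>I. \<Sum>l<r. (e l t * z t) * e l x)"
    using assms by (simp add: residual_def right_diff_distrib sum_subtractf sum_distrib_left ip_unit
      mult_ac)
  also have "(\<Sum>t\<in>I. z t * of_bool (x = t)) = z x"
    using sum_of_bool_eq[OF assms, of z] by (simp add: eq_commute)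
  also have "(\<Sum>t\<in>I. \<Sum>l<r. (e l t * z t) * e l x) = (\<Sum>l<r. ip I (e l) z * e l x)"
    by (subst sum.swap) (simp add: ip_def sum_distrib_right)
  finally show ?thesis by (simp add: residual_def)
qed

text \<open>At r = card I nonnegative squares have trace 0, so every unit vector, and hence every
  vector, has zero residual.\<close>

lemma Parseval:
  assumes "finite I" "orthonormal I e (card I)"
  shows "ip I z z = (\<Sum>l<card I. (ip I (e l) z)\<^sup>2)"
proof -
  let ?R = "residual I e (card I)"
  have "(\<Sum>t\<in>I. ip I (?R (unit_fun t)) (?R (unit_fun t))) = 0" using residual_trace[OF assms] by simp
  then have "ip I (?R (unit_fun t)) (?R (unit_fun t)) = 0" if "t \<in> I" for t
    using that assms(1) by (subst (asm) sum_nonneg_eq_0_iff) (auto intro: ip_nonneg)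
  then have "?R (unit_fun t) x = 0" if "t \<in> I" "x \<in> I" for t x
    using that assms(1) by (auto simp: ip_eq_0_iff)
  then have "?R z x = 0" if "x \<in> I" for x
    using that assms(1) by (subst residual_eq_sum_unit) auto
  then have "ip I (?R z) (?R z) = 0" using assms(1) by (simp add: ip_eq_0_iff)
  then show ?thesis using ip_residual[OF assms(2), of z] by simp
qed

lemma orthonormal_extend1:
  assumes "finite I" "orthonormal I e r" "r < card I"
  shows "\<exists>v. orthonormal I (e(r := v)) (Suc r)"
proof -
  let ?R = "residual I e r"
  have "(\<Sum>t\<in>I. ip I (?R (unit_fun t)) (?R (unit_fun t))) \<noteq> 0"
    using residual_trace[OF assms(1,2)] assms(3) by simp
  then obtain t where t: "ip I (?R (unit_fun t)) (?R (unit_fun t)) \<noteq> 0"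
    by (meson sum.neutral)
  define w n where "w = ?R (unit_fun t)" and "n = sqrt (ip I w w)"
  have n: "n > 0" "n * n = ip I w w" using t ip_nonneg[of I w] by (auto simp: w_def n_def)
  define v where "v = (\<lambda>x. (1 / n) * w x)"
  have vv: "ip I v v = 1" unfolding v_def ip_scale_left ip_scale_right n(2)[symmetric] using n(1)
    by simp
  have ev: "ip I (e m) v = 0" "ip I v (e m) = 0" if "m < r" for m
    using residual_orthogonal[OF assms(2) that, of "unit_fun t"]
    unfolding v_def ip_scale_left ip_scale_right w_def by (simp_all add: ip_commute)
  show ?thesis
    using assms(2) vv ev by (intro exI[of _ v]) (auto simp: orthonormal_def less_Suc_eq)
qed

lemma orthonormal_extend:
  assumes "finite I" "orthonormal I e r"
  shows "\<exists>e'. (\<forall>l<r. e' l = e l) \<and> orthonormal I e' (card I)"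
proof -
  have "r \<le> n \<Longrightarrow> n \<le> card I \<Longrightarrow> \<exists>e'. (\<forall>l<r. e' l = e l) \<and> orthonormal I e' n" for n
  proof (induction n rule: dec_induct)
    case base then show ?case using assms by auto
  next
    case (step n)
    then obtain e' where e': "\<forall>l<r. e' l = e l" "orthonormal I e' n" by auto
    obtain v where "orthonormal I (e'(n := v)) (Suc n)"
      using orthonormal_extend1[OF assms(1) e'(2)] step by auto
    moreover have "\<forall>l<r. (e'(n := v)) l = e l" using e' step by auto
    ultimately show ?case by blast
  qed
  from this[OF orthonormal_le_card[OF assms]] show ?thesis by auto
qed

section \<open>Gaussian product measures\<close>

definition centred_normal :: "real \<Rightarrow> real measure" where
  "centred_normal s = density lborel (normal_density 0 s)"

lemma sets_centred_normal [simp, measurable_cong]: "sets (centred_normal s) = sets borel"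
  by (simp add: centred_normal_def)

lemma space_centred_normal [simp]: "space (centred_normal s) = UNIV"
  by (simp add: centred_normal_def)

lemma prob_space_centred_normal: "s > 0 \<Longrightarrow> prob_space (centred_normal s)"
  unfolding centred_normal_def by (rule prob_space_normal_density)

lemma centred_normal_eq_distr:
  assumes "s > 0"
  shows "centred_normal s = distr std_normal_distribution borel (\<lambda>x. s * x)"
proof -
  interpret prob_space std_normal_distribution by (rule prob_space_normal_density) simp
  have "distributed std_normal_distribution lborel (\<lambda>x. x) (\<lambda>x. ennreal (normal_density 0 1 x))"
    by (simp add: distributed_def distr_id2)
  from normal_density_affine[OF this, of s 0] assms
  have "distributed std_normal_distribution lborel (\<lambda>x. s * x) (\<lambda>x. ennreal (normal_density 0 s x))"
    by simp
  then have "distr std_normal_distribution lborel (\<lambda>x. s * x) = centred_normal s"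
    unfolding centred_normal_def by (simp add: distributed_def)
  moreover have "distr std_normal_distribution lborel (\<lambda>x. s * x)
    = distr std_normal_distribution borel (\<lambda>x. s * x)"
    by (rule distr_cong) auto
  ultimately show ?thesis by simp
qed

lemma char_centred_normal:
  assumes "s > 0"
  shows "(\<integral>x. exp (\<i> * of_real (\<theta> * x)) \<partial>centred_normal s) = of_real (exp (- (s\<^sup>2 * \<theta>\<^sup>2) / 2))"
proof -
  have "(\<integral>x. exp (\<i> * of_real (\<theta> * x)) \<partial>centred_normal s) = char std_normal_distribution (s * \<theta>)"
    unfolding centred_normal_eq_distr[OF assms] char_def
    by (subst integral_distr) (auto simp: mult_ac)
  then show ?thesis by (simp add: char_std_normal_distribution power_mult_distrib)
qed

lemma integral_exp_square_std_normal:
  assumes "\<kappa> \<ge> 0"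
  shows "(\<integral>x. exp (- (\<kappa> * x\<^sup>2) / 2) \<partial>centred_normal 1) = (1 + \<kappa>) powr (- 1 / 2)"
proof -
  \<comment> \<open>Completing the square leads to a normal density of variance 1/(1 + \<kappa>); q,
    its standard deviation, is also the ratio of the normalising constants.\<close>
  define q where "q = 1 / sqrt (1 + \<kappa>)"
  have q: "q > 0" "q\<^sup>2 = 1 / (1 + \<kappa>)" using assms by (auto simp: q_def power_divide)
  have eq: "normal_density 0 1 x * exp (- (\<kappa> * x\<^sup>2) / 2) = q * normal_density 0 q x" for x
  proof -
    have "x\<^sup>2 / (2 * q\<^sup>2) = x\<^sup>2 / 2 + \<kappa> * x\<^sup>2 / 2" unfolding q(2) using assms by (simp add: field_simps)
    moreover have "sqrt (2 * pi * q\<^sup>2) = sqrt (2 * pi) * q" using q(1) by (simp add: real_sqrt_mult)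
    ultimately have "q * normal_density 0 q x = exp (- (x\<^sup>2 / 2 + \<kappa> * x\<^sup>2 / 2)) / sqrt (2 * pi)"
      using q(1) by (simp add: normal_density_def)
    also have "exp (- (x\<^sup>2 / 2 + \<kappa> * x\<^sup>2 / 2)) = exp (- x\<^sup>2 / 2) * exp (- (\<kappa> * x\<^sup>2) / 2)"
      by (simp flip: exp_add)
    finally show ?thesis by (simp add: normal_density_def)
  qed
  have "(\<integral>x. exp (- (\<kappa> * x\<^sup>2) / 2) \<partial>centred_normal 1)
      = (\<integral>x. normal_density 0 1 x *\<^sub>R exp (- (\<kappa> * x\<^sup>2) / 2) \<partial>lborel)"
    unfolding centred_normal_def by (rule integral_density; (rule AE_I2, rule normal_density_nonneg |
      measurable))
  also have "\<dots> = (\<integral>x. q * normal_density 0 q x \<partial>lborel)" unfolding real_scaleR_def eq ..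
  also have "\<dots> = q" using integral_normal_density[OF q(1), of 0] by simp
  also have "q = (1 + \<kappa>) powr (- 1 / 2)"
    using assms powr_minus_divide[of "1 + \<kappa>" "1 / 2"] by (simp add: q_def powr_half_sqrt)
  finally show ?thesis .
qed

lemma product_sigma_finite_normal: "s > 0 \<Longrightarrow> product_sigma_finite (\<lambda>_. centred_normal s)"
  by (intro product_sigma_finite.intro prob_space_imp_sigma_finite prob_space_centred_normal)

lemma char_normal_product:
  assumes s: "s > 0" and I: "finite (I :: 'i set)"
  shows "(\<integral>z. exp (\<i> * of_real (\<Sum>t\<in>I. \<theta> t * z t)) \<partial>PiM I (\<lambda>_. centred_normal s))
    = of_real (exp (- (s\<^sup>2 * (\<Sum>t\<in>I. (\<theta> t)\<^sup>2)) / 2))"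
proof -
  interpret product_sigma_finite "\<lambda>_::'i. centred_normal s" by (rule product_sigma_finite_normal[OF s])
  interpret N: prob_space "centred_normal s" by (rule prob_space_centred_normal[OF s])
  have "(\<integral>z. exp (\<i> * of_real (\<Sum>t\<in>I. \<theta> t * z t)) \<partial>PiM I (\<lambda>_. centred_normal s))
    = (\<integral>z. (\<Prod>t\<in>I. exp (\<i> * of_real (\<theta> t * z t))) \<partial>PiM I (\<lambda>_. centred_normal s))"
    using I by (simp add: exp_sum[symmetric] sum_distrib_left)
  also have "\<dots> = (\<Prod>t\<in>I. \<integral>x. exp (\<i> * of_real (\<theta> t * x)) \<partial>centred_normal s)"
    by (rule product_integral_prod[OF I]) (rule N.integrable_const_bound[where B = 1], auto)
  also have "\<dots> = (\<Prod>t\<in>I. of_real (exp (- (s\<^sup>2 * (\<theta> t)\<^sup>2) / 2)))"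
    using char_centred_normal[OF s] by simp
  also have "\<dots> = of_real (exp (\<Sum>t\<in>I. - (s\<^sup>2 * (\<theta> t)\<^sup>2) / 2))" using I by (simp add: exp_sum)
  also have "(\<Sum>t\<in>I. - (s\<^sup>2 * (\<theta> t)\<^sup>2) / 2) = - (s\<^sup>2 * (\<Sum>t\<in>I. (\<theta> t)\<^sup>2)) / 2"
    by (simp add: sum_distrib_left sum_negf sum_divide_distrib)
  finally show ?thesis .
qed

text \<open>Writing \<open>exp (- y\<^sup>2 / 2)\<close> as a Gaussian average of characters linearises the quadratic form,
  so no rotation invariance of the Gaussian measure is needed.\<close>

lemma Laplace_orthonormal_squares:
  assumes s: "s > 0" and I: "finite (I :: 'i set)" and on: "orthonormal I e n" and pos: "\<And>l. l < n
    \<Longrightarrow> \<kappa> l \<ge> 0"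
  shows "(\<integral>z. exp (- (\<Sum>l<n. \<kappa> l * (ip I (e l) z)\<^sup>2) / 2) \<partial>PiM I (\<lambda>_. centred_normal s))
    = (\<Prod>l<n. (1 + s\<^sup>2 * \<kappa> l) powr (- 1 / 2))"
proof -
  let ?G = "PiM I (\<lambda>_. centred_normal s)" and ?H = "PiM {..<n} (\<lambda>_. centred_normal 1)"
  interpret G: product_sigma_finite "\<lambda>_::'i. centred_normal s"
    by (rule product_sigma_finite_normal[OF s])
  interpret H: product_sigma_finite "\<lambda>_::nat. centred_normal 1"
    by (rule product_sigma_finite_normal) simp
  interpret N: prob_space "centred_normal 1" by (rule prob_space_centred_normal) simp
  interpret GI: prob_space ?G by (rule prob_space_PiM) (rule prob_space_centred_normal[OF s])
  interpret HI: prob_space ?H by (rule prob_space_PiM) (rule prob_space_centred_normal, simp)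
  interpret GH: pair_prob_space ?G ?H ..
  define Q where "Q z = (\<Sum>l<n. \<kappa> l * (ip I (e l) z)\<^sup>2)" for z
  \<comment> \<open>One auxiliary standard normal \<open>g l\<close> per direction: averaging exp (i
    \<phi>) over g gives exp (- Q / 2).\<close>
  define \<phi> where "\<phi> z g = (\<Sum>l<n. (sqrt (\<kappa> l) * ip I (e l) z) * g l)" for z and g :: "nat \<Rightarrow> real"
  have comp: "(\<lambda>z. z t) \<in> borel_measurable ?G" if "t \<in> I" for t
    using measurable_component_singleton[OF that, of "\<lambda>_. centred_normal s"]
      by (simp cong: measurable_cong_sets)
  have comp2: "(\<lambda>z. z l) \<in> borel_measurable ?H" if "l \<in> {..<n}" for l
    using measurable_component_singleton[OF that, of "\<lambda>_. centred_normal 1"]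
      by (simp cong: measurable_cong_sets)
  have [measurable]: "(\<lambda>z. ip I (e l) z) \<in> borel_measurable ?G" for l
    unfolding ip_def by (intro borel_measurable_sum borel_measurable_times borel_measurable_const comp)
  have [measurable]: "(\<lambda>(z, g). \<phi> z g) \<in> borel_measurable (?G \<Otimes>\<^sub>M ?H)"
    unfolding \<phi>_def case_prod_beta
    by (intro borel_measurable_sum borel_measurable_times borel_measurable_const
        measurable_compose[OF measurable_snd comp2]) (auto intro!: measurable_compose[OF
          measurable_fst])
  have \<phi>': "\<phi> z g = (\<Sum>t\<in>I. (\<Sum>l<n. g l * sqrt (\<kappa> l) * e l t) * z t)" for z g
    unfolding \<phi>_def ip_def sum_distrib_left sum_distrib_right
    by (subst sum.swap) (simp add: mult_ac)
  \<comment> \<open>After the exchange of integrals, z is paired with the vector of coordinates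
    \<open>g l * sqrt (\<kappa> l)\<close> in the system e. By orthonormality its squared length has
    no cross terms, so the integral over g factorises.\<close>
  have sq: "(\<Sum>t\<in>I. (\<Sum>l<n. g l * sqrt (\<kappa> l) * e l t)\<^sup>2) = (\<Sum>l<n. \<kappa> l * (g l)\<^sup>2)" for g
  proof -
    let ?c = "\<lambda>l. g l * sqrt (\<kappa> l)"
    have "(\<Sum>t\<in>I. (\<Sum>l<n. ?c l * e l t)\<^sup>2) = ip I (\<lambda>t. \<Sum>l<n. ?c l * e l t) (\<lambda>t. \<Sum>l<n. ?c l * e l t)"
      by (simp add: ip_def power2_eq_square)
    also have "\<dots> = (\<Sum>l<n. \<Sum>m<n. ?c l * (?c m * ip I (e l) (e m)))"
      by (simp add: ip_sum_left ip_sum_right ip_scale_left ip_scale_right sum_distrib_left mult_ac)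
    also have "\<dots> = (\<Sum>l<n. \<Sum>m<n. (?c m * ?c l) * of_bool (m = l))"
      using on by (intro sum.cong) (auto simp: orthonormal_def)
    also have "\<dots> = (\<Sum>l<n. ?c l * ?c l)" by (intro sum.cong sum_of_bool_eq) auto
    also have "\<dots> = (\<Sum>l<n. \<kappa> l * (g l)\<^sup>2)"
      using pos by (intro sum.cong) (auto simp: power2_eq_square)
    finally show ?thesis .
  qed
  have "complex_of_real (\<integral>z. exp (- Q z / 2) \<partial>?G) = (\<integral>z. of_real (exp (- Q z / 2)) \<partial>?G)" by simp
  also have "\<dots> = (\<integral>z. (\<integral>g. exp (\<i> * of_real (\<phi> z g)) \<partial>?H) \<partial>?G)"
  proof (rule Bochner_Integration.integral_cong[OF refl])
    fix z
    have "(\<Sum>l<n. (sqrt (\<kappa> l) * ip I (e l) z)\<^sup>2) = Q z"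
      unfolding Q_def using pos by (intro sum.cong) (auto simp: power_mult_distrib)
    then show "of_real (exp (- Q z / 2)) = (\<integral>g. exp (\<i> * of_real (\<phi> z g)) \<partial>?H)"
      unfolding \<phi>_def by (subst char_normal_product) auto
  qed
  also have "\<dots> = (\<integral>g. (\<integral>z. exp (\<i> * of_real (\<phi> z g)) \<partial>?G) \<partial>?H)"
    by (rule GH.Fubini_integral[symmetric], rule GH.integrable_const_bound[where B = 1])
       (auto simp: case_prod_beta split: prod.splits)
  also have "\<dots> = (\<integral>g. of_real (exp (- (s\<^sup>2 * (\<Sum>l<n. \<kappa> l * (g l)\<^sup>2)) / 2)) \<partial>?H)"
    unfolding \<phi>' char_normal_product[OF s I] sq ..
  also have "\<dots> = of_real (\<integral>g. (\<Prod>l<n. exp (- ((s\<^sup>2 * \<kappa> l) * (g l)\<^sup>2) / 2)) \<partial>?H)"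
    by (simp add: exp_sum[symmetric] sum_distrib_left sum_negf sum_divide_distrib mult_ac)
  also have "(\<integral>g. (\<Prod>l<n. exp (- ((s\<^sup>2 * \<kappa> l) * (g l)\<^sup>2) / 2)) \<partial>?H)
     = (\<Prod>l<n. \<integral>x. exp (- ((s\<^sup>2 * \<kappa> l) * x\<^sup>2) / 2) \<partial>centred_normal 1)"
    using pos by (intro H.product_integral_prod N.integrable_const_bound[where B = 1]) auto
  also have "\<dots> = (\<Prod>l<n. (1 + s\<^sup>2 * \<kappa> l) powr (- 1 / 2))"
    using pos by (intro prod.cong integral_exp_square_std_normal) auto
  finally show ?thesis unfolding Q_def of_real_eq_iff .
qed

text \<open>Completing e to an orthonormal basis, without changing its first r members, turns both
  residual sums of squares into tails of one sum of squared coordinates, whose weighted Laplace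
  transform is known.\<close>

lemma nested_chi_square_residuals:
  assumes s: "s > 0" and I: "finite (I :: 'i set)" and on: "orthonormal I e r" and q: "q
    \<le> r" "r < card I"
  shows "nested_chi_square (PiM I (\<lambda>_. centred_normal s))
     (\<lambda>z. ip I z z - (\<Sum>l<r. (ip I (e l) z)\<^sup>2)) (\<lambda>z. ip I z z - (\<Sum>l<q. (ip I (e l) z)\<^sup>2))
     (real (card I - r) / 2) (real (r - q) / 2) (s\<^sup>2)"
proof -
  let ?G = "PiM I (\<lambda>_. centred_normal s)"
  let ?A = "\<lambda>z. ip I z z - (\<Sum>l<r. (ip I (e l) z)\<^sup>2)" and ?S = "\<lambda>z. ip I z z - (\<Sum>l<q. (ip I (e l) z)\<^sup>2)"
  interpret GI: prob_space ?G by (rule prob_space_PiM) (rule prob_space_centred_normal[OF s])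
  have comp: "(\<lambda>z. z t) \<in> borel_measurable ?G" if "t \<in> I" for t
    using measurable_component_singleton[OF that, of "\<lambda>_. centred_normal s"]
      by (simp cong: measurable_cong_sets)
  have [measurable]: "(\<lambda>z. ip I (e l) z) \<in> borel_measurable ?G" for l
    unfolding ip_def by (intro borel_measurable_sum borel_measurable_times borel_measurable_const comp)
  have [measurable]: "(\<lambda>z. ip I z z) \<in> borel_measurable ?G"
    unfolding ip_def by (rule borel_measurable_sum, rule borel_measurable_times) (erule comp)+
  obtain e' where e': "\<And>l. l < r \<Longrightarrow> e' l = e l" "orthonormal I e' (card I)"
    using orthonormal_extend[OF I on] by blast
  have tail: "ip I z z - (\<Sum>l<m. (ip I (e l) z)\<^sup>2) = (\<Sum>l\<in>{m..<card I}. (ip I (e' l) z)\<^sup>2)" if "m \<le> r"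
    for m z
  proof -
    have "{..<card I} = {..<m} \<union> {m..<card I}" using that q by auto
    then have "ip I z z = (\<Sum>l<m. (ip I (e' l) z)\<^sup>2) + (\<Sum>l\<in>{m..<card I}. (ip I (e' l) z)\<^sup>2)"
      unfolding Parseval[OF I e'(2)] by (simp add: sum.union_disjoint ivl_disj_int)
    moreover have "(\<Sum>l<m. (ip I (e' l) z)\<^sup>2) = (\<Sum>l<m. (ip I (e l) z)\<^sup>2)" using e'(1) that by simp
    ultimately show ?thesis by simp
  qed
  show ?thesis
  proof unfold_locales
    show "0 \<le> ?A z" for z unfolding tail[OF order_refl] by (simp add: sum_nonneg)
    show "?A z \<le> ?S z" for z using q by (simp add: sum_mono2)
    show "0 < real (card I - r) / 2" using q by simp
    show "0 < s\<^sup>2" using s by simp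
    fix \<alpha> \<mu> :: real assume am: "0 \<le> \<alpha>" "0 \<le> \<mu>"
    \<comment> \<open>The factor 2 offsets the 1/2 in the Gaussian exponent. The weights are 0 below
      q, 2 \<mu> from q to r - 1, and 2 (\<alpha> + \<mu>) from r on.\<close>
    define \<kappa> where "\<kappa> l = (if r \<le> l then 2 * \<alpha> else 0) + (if q \<le> l then 2 * \<mu> else 0)" for l
    have pw: "(x powr - (1 / 2)) ^ n = x powr (- (real n / 2))" if "x > 0" for x :: real and n
      using powr_realpow[of "x powr - (1 / 2)" n] that by (simp add: powr_powr)
    have S2: "(\<Sum>l\<in>{m..<card I}. f l) = (\<Sum>l<card I. if m \<le> l then f l else 0)" for m
      and f :: "nat \<Rightarrow> real"
      by (subst sum.inter_filter[symmetric]) (auto intro!: sum.cong)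
    have eq: "?A z * \<alpha> + ?S z * \<mu> = (\<Sum>l<card I. \<kappa> l * (ip I (e' l) z)\<^sup>2) / 2" for z
      unfolding tail[OF order_refl] tail[OF q(1)] S2 sum_distrib_right sum.distrib[symmetric]
        sum_divide_distrib
      by (intro sum.cong) (auto simp: \<kappa>_def algebra_simps)
    have "(\<integral>z. exp (- (?A z * \<alpha> + ?S z * \<mu>)) \<partial>?G)
      = (\<integral>z. exp (- (\<Sum>l<card I. \<kappa> l * (ip I (e' l) z)\<^sup>2) / 2) \<partial>?G)"
      by (simp only: eq minus_divide_left)
    also have "\<dots> = (\<Prod>l<card I. (1 + s\<^sup>2 * \<kappa> l) powr (- 1 / 2))"
      using am by (intro Laplace_orthonormal_squares s I e'(2)) (auto simp: \<kappa>_def)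
    also have "{..<card I} = {..<q} \<union> ({q..<r} \<union> {r..<card I})" using q by auto
    also have "(\<Prod>l\<in>\<dots>. (1 + s\<^sup>2 * \<kappa> l) powr (- 1 / 2)) =
      (\<Prod>l<q. (1 + s\<^sup>2 * \<kappa> l) powr (- 1 / 2)) * ((\<Prod>l\<in>{q..<r}. (1
        + s\<^sup>2 * \<kappa> l) powr (- 1 / 2)) * (\<Prod>l\<in>{r..<card I}. (1 + s\<^sup>2 * \<kappa> l) powr (- 1 / 2)))"
      using q by (subst prod.union_disjoint, simp, simp, force) (subst prod.union_disjoint, auto)
    also have "(\<Prod>l<q. (1 + s\<^sup>2 * \<kappa> l) powr (- 1 / 2)) = 1" using q
      by (intro prod.neutral) (auto simp: \<kappa>_def)
    also have "(\<Prod>l\<in>{q..<r}. (1 + s\<^sup>2 * \<kappa> l) powr (- 1 / 2)) = (\<Prod>l\<in>{q..<r}. (1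
      + 2 * s\<^sup>2 * \<mu>) powr (- 1 / 2))"
      by (intro prod.cong) (auto simp: \<kappa>_def mult_ac)
    also have "\<dots> = (1 + 2 * s\<^sup>2 * \<mu>) powr (- (real (r - q) / 2))"
      using am s by (simp add: pw add_pos_nonneg)
    also have "(\<Prod>l\<in>{r..<card I}. (1 + s\<^sup>2 * \<kappa> l) powr (- 1 / 2)) = (\<Prod>l\<in>{r..<card I}. (1 + 2 * s\<^sup>2 * (\<alpha>
      + \<mu>)) powr (- 1 / 2))"
      using q by (intro prod.cong) (auto simp: \<kappa>_def algebra_simps)
    also have "\<dots> = (1 + 2 * s\<^sup>2 * (\<alpha> + \<mu>)) powr (- (real (card I - r) / 2))"
      using am s by (simp add: pw add_pos_nonneg)
    finally show "(\<integral>z. exp (- (?A z * \<alpha> + ?S z * \<mu>)) \<partial>?G) =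
       (1 + 2 * s\<^sup>2 * (\<alpha> + \<mu>)) powr (- (real (card I - r) / 2)) * (1
         + 2 * s\<^sup>2 * \<mu>) powr (- (real (r - q) / 2))"
      by simp
  qed auto
qed

section \<open>Gram-Schmidt on independent Gaussian rows\<close>

text \<open>Without normalisation, and with \<open>x / 0 = 0\<close>, the recursion produces orthogonal vectors even
  when some of them vanish.\<close>

function gs :: "'i set \<Rightarrow> (nat \<Rightarrow> 'i \<Rightarrow> real) \<Rightarrow> nat \<Rightarrow> 'i \<Rightarrow> real" where
  "gs I h k = (\<lambda>t. h k t - (\<Sum>l<k. ip I (gs I h l) (h k) / ip I (gs I h l) (gs I h l) * gs I h l t))"
  by pat_completeness auto
termination by (relation "Wellfounded.measure (\<lambda>(I, h, k). k)") auto

declare gs.simps [simp del]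

lemma ip_cong: "(\<And>t. t \<in> I \<Longrightarrow> a t = a' t) \<Longrightarrow> (\<And>t. t \<in> I \<Longrightarrow> b t = b' t) \<Longrightarrow> ip I a b = ip I a' b'"
  by (simp add: ip_def)

lemma gs_cong:
  assumes "\<And>l t. l \<le> k \<Longrightarrow> t \<in> I \<Longrightarrow> h l t = h' l t" "t \<in> I"
  shows "gs I h k t = gs I h' k t"
  using assms
proof (induction k arbitrary: t rule: less_induct)
  case (less k)
  have IH: "gs I h l x = gs I h' l x" if "l < k" "x \<in> I" for l x
    using that less.prems by (intro less.IH) auto
  have c1: "ip I (gs I h l) (h k) = ip I (gs I h' l) (h' k)" if "l < k" for l
    using IH[OF that] less.prems(1)[of k] by (intro ip_cong) auto
  have c2: "ip I (gs I h l) (gs I h l) = ip I (gs I h' l) (gs I h' l)" if "l < k" for l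
    using IH[OF that] by (intro ip_cong) auto
  show ?case
    unfolding gs.simps[of I h k] gs.simps[of I h' k]
    using less.prems IH c1 c2 by (auto intro!: sum.cong)
qed

text \<open>Residual sum of squares after regression on the first q rows: the squared distance of z
  from their span when those rows are nondegenerate.\<close>

definition rss :: "'i set \<Rightarrow> (nat \<Rightarrow> 'i \<Rightarrow> real) \<Rightarrow> nat \<Rightarrow> ('i \<Rightarrow> real) \<Rightarrow> real" where
  "rss I h q z = ip I z z - (\<Sum>l<q. (ip I (gs I h l) z)\<^sup>2 / ip I (gs I h l) (gs I h l))"

lemma rss_cong:
  assumes "\<And>l t. l < q \<Longrightarrow> t \<in> I \<Longrightarrow> h l t = h' l t" "\<And>t. t \<in> I \<Longrightarrow> z t = z' t"
  shows "rss I h q z = rss I h' q z'"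
proof -
  have g: "gs I h l t = gs I h' l t" if "l < q" "t \<in> I" for l t
    using that assms(1) by (intro gs_cong) auto
  show ?thesis unfolding rss_def
    using g assms(2) by (intro arg_cong2[where f = minus] sum.cong arg_cong2[where f = divide]
      arg_cong[where f = "\<lambda>x. x\<^sup>2"] ip_cong) auto
qed

text \<open>Linear independence of the first r rows, phrased through successive distances so that it
  can be checked row by row and is visibly measurable.\<close>

definition nondegenerate :: "'i set \<Rightarrow> (nat \<Rightarrow> 'i \<Rightarrow> real) \<Rightarrow> nat \<Rightarrow> bool" where
  "nondegenerate I h r \<longleftrightarrow> (\<forall>k<r. rss I h k (h k) > 0)"

lemma nondegenerate_cong:
  assumes "\<And>l t. l < r \<Longrightarrow> t \<in> I \<Longrightarrow> h l t = h' l t"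
  shows "nondegenerate I h r \<longleftrightarrow> nondegenerate I h' r"
proof -
  have "rss I h k (h k) = rss I h' k (h' k)" if "k < r" for k
    using assms that by (intro rss_cong) auto
  then show ?thesis by (simp add: nondegenerate_def)
qed

text \<open>A vanishing vector stays 0, as 1 / 0 = 0; hence \<open>gs_residual\<close> and
  \<open>rss_eq\<close> hold without any nondegeneracy.\<close>

definition gsn :: "'i set \<Rightarrow> (nat \<Rightarrow> 'i \<Rightarrow> real) \<Rightarrow> nat \<Rightarrow> 'i \<Rightarrow> real" where
  "gsn I h l = (\<lambda>t. 1 / sqrt (ip I (gs I h l) (gs I h l)) * gs I h l t)"

lemma ip_gsn_left: "ip I (gsn I h l) z = ip I (gs I h l) z / sqrt (ip I (gs I h l) (gs I h l))"
  unfolding gsn_def ip_scale_left by simp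

lemma ip_gsn_square: "(ip I (gsn I h l) z)\<^sup>2 = (ip I (gs I h l) z)\<^sup>2 / ip I (gs I h l) (gs I h l)"
  unfolding ip_gsn_left by (simp add: power_divide ip_nonneg)

lemma gs_residual: "gs I h k = residual I (gsn I h) k (h k)"
proof
  fix t
  have "ip I (gsn I h l) (h k) * gsn I h l t = ip I (gs I h l) (h k) / ip I (gs I h l) (gs I h l) * gs
    I h l t" for l
  proof -
    have "sqrt (ip I (gs I h l) (gs I h l)) * sqrt (ip I (gs I h l) (gs I h l))
      = ip I (gs I h l) (gs I h l)"
      by (simp add: ip_nonneg)
    then show ?thesis unfolding ip_gsn_left by (simp add: gsn_def flip: times_divide_times_eq)
  qed
  then show "gs I h k t = residual I (gsn I h) k (h k) t"
    unfolding gs.simps[of I h k] residual_def by simp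
qed

lemma rss_eq: "rss I h q z = ip I z z - (\<Sum>l<q. (ip I (gsn I h l) z)\<^sup>2)"
  by (simp add: rss_def ip_gsn_square)

lemma gs_orthonormal:
  assumes "nondegenerate I h r"
  shows "orthonormal I (gsn I h) r" and "\<And>k. k < r \<Longrightarrow> ip I (gs I h k) (gs I h k) = rss I h k (h k)"
proof -
  have "orthonormal I (gsn I h) r \<and> (\<forall>k<r. ip I (gs I h k) (gs I h k) = rss I h k (h k))"
    using assms
  proof (induction r)
    case 0 then show ?case by (simp add: orthonormal_def)
  next
    case (Suc r)
    then have "nondegenerate I h r" by (simp add: nondegenerate_def)
    then have on: "orthonormal I (gsn I h) r" and eq: "\<forall>k<r. ip I (gs I h k) (gs I h k)
      = rss I h k (h k)"
      using Suc.IH by auto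
    have gr: "ip I (gs I h r) (gs I h r) = rss I h r (h r)"
      unfolding gs_residual[of I h r] rss_eq by (rule ip_residual[OF on])
    have pos: "ip I (gs I h r) (gs I h r) > 0" unfolding gr using Suc.prems
      by (simp add: nondegenerate_def)
    have 1: "ip I (gsn I h r) (gsn I h r) = 1"
      unfolding ip_gsn_left unfolding gsn_def ip_scale_right using pos by (simp flip: power2_eq_square)
    have 2: "ip I (gsn I h l) (gsn I h r) = 0" if "l < r" for l
      using residual_orthogonal[OF on that, of "h r"] unfolding gs_residual[of I h r, symmetric]
      unfolding gsn_def[of I h r] ip_scale_right by simp
    have 3: "ip I (gsn I h r) (gsn I h l) = 0" if "l < r" for l
      using 2[OF that] by (simp add: ip_commute)
    show ?case using on eq gr 1 2 3 by (auto simp: orthonormal_def less_Suc_eq)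
  qed
  then show "orthonormal I (gsn I h) r" "\<And>k. k < r \<Longrightarrow> ip I (gs I h k) (gs I h k) = rss I h k (h k)"
    by auto
qed

lemma measurable_ip:
  assumes "\<And>t. t \<in> I \<Longrightarrow> (\<lambda>\<omega>. f \<omega> t) \<in> borel_measurable M" "\<And>t. t \<in> I \<Longrightarrow> (\<lambda>\<omega>. g \<omega> t) \<in> borel_measurable M"
  shows "(\<lambda>\<omega>. ip I (f \<omega>) (g \<omega>)) \<in> borel_measurable M"
  unfolding ip_def using assms by (intro borel_measurable_sum borel_measurable_times) auto

lemma measurable_gs:
  assumes "\<And>l t. l \<le> k \<Longrightarrow> t \<in> I \<Longrightarrow> (\<lambda>\<omega>. h \<omega> l t) \<in> borel_measurable M" "t \<in> I"
  shows "(\<lambda>\<omega>. gs I (h \<omega>) k t) \<in> borel_measurable M"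
  using assms
proof (induction k arbitrary: t rule: less_induct)
  case (less k)
  have IH: "(\<lambda>\<omega>. gs I (h \<omega>) l x) \<in> borel_measurable M" if "l < k" "x \<in> I" for l x
    using that less.prems by (intro less.IH) auto
  show ?case
    unfolding gs.simps[of I _ k] using less.prems IH
    by (intro borel_measurable_diff borel_measurable_sum borel_measurable_times
      borel_measurable_divide measurable_ip) auto
qed

lemma measurable_rss:
  assumes "\<And>l t. l < q \<Longrightarrow> t \<in> I \<Longrightarrow> (\<lambda>\<omega>. h \<omega> l t) \<in> borel_measurable M"
    "\<And>t. t \<in> I \<Longrightarrow> (\<lambda>\<omega>. z \<omega> t) \<in> borel_measurable M"
  shows "(\<lambda>\<omega>. rss I (h \<omega>) q (z \<omega>)) \<in> borel_measurable M"
  unfolding rss_def using assms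
  by (intro borel_measurable_diff borel_measurable_sum borel_measurable_divide borel_measurable_power
    measurable_ip measurable_gs) auto

text \<open>Character of the log-ratio of row k, set to 0 on degenerate configurations. A product of
  such factors vanishes exactly when one of its rows is degenerate, and at \<tau> = 0 it is an
  indicator, so one integral formula serves for the law and for almost sure nondegeneracy.\<close>

definition row_factor :: "'i set \<Rightarrow> nat \<Rightarrow> real \<Rightarrow> (nat \<Rightarrow> 'i \<Rightarrow> real) \<Rightarrow> nat \<Rightarrow> complex" where
  "row_factor I q \<tau> h k = (if rss I h k (h k) > 0
     then exp (\<i> * of_real (\<tau> * (ln (rss I h k (h k)) - ln (rss I h q (h k))))) else 0)"

lemma norm_row_factor: "norm (row_factor I q \<tau> h k) \<le> 1"
  by (simp add: row_factor_def)

lemma row_factor_cong: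
  assumes "\<And>l t. l \<le> max q k \<Longrightarrow> t \<in> I \<Longrightarrow> h l t = h' l t"
  shows "row_factor I q \<tau> h k = row_factor I q \<tau> h' k"
proof -
  have "rss I h k (h k) = rss I h' k (h' k)" "rss I h q (h k) = rss I h' q (h' k)"
    using assms by (auto intro!: rss_cong)
  then show ?thesis by (simp add: row_factor_def)
qed

lemma measurable_row_factor:
  assumes "\<And>l t. l \<le> max q k \<Longrightarrow> t \<in> I \<Longrightarrow> (\<lambda>\<omega>. h \<omega> l t) \<in> borel_measurable M"
  shows "(\<lambda>\<omega>. row_factor I q \<tau> (h \<omega>) k) \<in> borel_measurable M"
proof -
  have [measurable]: "(\<lambda>\<omega>. rss I (h \<omega>) k (h \<omega> k)) \<in> borel_measurable M" "(\<lambda>\<omega>. rss I (h \<omega>) q (h \<omega> k))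
    \<in> borel_measurable M"
    using assms by (auto intro!: measurable_rss)
  show ?thesis unfolding row_factor_def by measurable
qed

definition row_product :: "'i set \<Rightarrow> nat \<Rightarrow> nat \<Rightarrow> real \<Rightarrow> (nat \<Rightarrow> 'i \<Rightarrow> real) \<Rightarrow> complex" where
  "row_product I q p \<tau> h = (\<Prod>k<p. row_factor I q \<tau> h (q + k))"

lemma norm_row_product: "norm (row_product I q p \<tau> h) \<le> 1"
  unfolding row_product_def prod_norm[symmetric] by (intro prod_le_1) (auto simp: norm_row_factor)

lemma row_product_cong:
  "(\<And>l t. l < q + p \<Longrightarrow> t \<in> I \<Longrightarrow> h l t = h' l t) \<Longrightarrow> row_product I q p \<tau> h = row_product I q p \<tau> h'"
  unfolding row_product_def by (intro prod.cong refl row_factor_cong) auto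

lemma measurable_row_product:
  assumes "\<And>l t. l < q + p \<Longrightarrow> t \<in> I \<Longrightarrow> (\<lambda>\<omega>. h \<omega> l t) \<in> borel_measurable M"
  shows "(\<lambda>\<omega>. row_product I q p \<tau> (h \<omega>)) \<in> borel_measurable M"
  unfolding row_product_def using assms by (intro borel_measurable_prod measurable_row_factor) auto

lemma row_product_nonzero_iff:
  assumes "nondegenerate I h q"
  shows "row_product I q p \<tau> h \<noteq> 0 \<longleftrightarrow> nondegenerate I h (q + p)"
proof -
  have "row_product I q p \<tau> h \<noteq> 0 \<longleftrightarrow> (\<forall>k<p. rss I h (q + k) (h (q + k)) > 0)"
    by (auto simp: row_product_def row_factor_def)
  also have "\<dots> \<longleftrightarrow> nondegenerate I h (q + p)"
  proof
    assume *: "\<forall>k<p. rss I h (q + k) (h (q + k)) > 0"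
    have "rss I h k (h k) > 0" if "k < q + p" for k
    proof (cases "k < q")
      case False
      then have "k - q < p" "q + (k - q) = k" using that by auto
      then show ?thesis using * by metis
    qed (use assms in \<open>auto simp: nondegenerate_def\<close>)
    then show "nondegenerate I h (q + p)" by (simp add: nondegenerate_def)
  qed (simp add: nondegenerate_def)
  finally show ?thesis .
qed

lemma row_product_0:
  assumes "nondegenerate I h q"
  shows "row_product I q p 0 h = of_bool (nondegenerate I h (q + p))"
proof (cases "nondegenerate I h (q + p)")
  case True
  then show ?thesis by (auto simp: row_product_def row_factor_def nondegenerate_def)
qed (use row_product_nonzero_iff[OF assms] in auto)

text \<open>Characteristic function of the logarithm of a Beta(a, c - a) variable; for a = c > 0 and
  \<tau> real it is 1.\<close>

definition beta_char :: "real \<Rightarrow> real \<Rightarrow> real \<Rightarrow> complex" where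
  "beta_char a c \<tau> = Gamma (of_real a + \<i> * of_real \<tau>) * Gamma (of_real c)
       / (Gamma (of_real a) * Gamma (of_real c + \<i> * of_real \<tau>))"

text \<open>With the earlier rows fixed, the two residual sums of squares of a fresh Gaussian row
  are a nested chi-square pair. Neither those rows nor the scale s enter the value, so the row can
  be integrated out as a constant.\<close>

lemma integral_row_factor:
  assumes s: "s > 0" and I: "finite (I :: 'i set)" and q: "q \<le> r" "r < card I"
    and pos: "nondegenerate I h r"
  shows "(\<integral>z. row_factor I q \<tau> (h(r := z)) r \<partial>PiM I (\<lambda>_. centred_normal s))
    = beta_char (real (card I - r) / 2) (real (card I - q) / 2) \<tau>"
proof -
  interpret nested_chi_square "PiM I (\<lambda>_. centred_normal s)" "rss I h r" "rss I h q"
     "real (card I - r) / 2" "real (r - q) / 2" "s\<^sup>2"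
    using nested_chi_square_residuals[OF s I gs_orthonormal(1)[OF pos] q] by (simp add: rss_eq[abs_def])
  have eq: "row_factor I q \<tau> (h(r := z)) r = (if rss I h r z > 0 then exp (\<i> * of_real (\<tau> * (ln (rss I
    h r z) - ln (rss I h q z)))) else 0)" for z
  proof -
    have "rss I (h(r := z)) m z = rss I h m z" if "m \<le> r" for m
      using that by (intro rss_cong) auto
    then show ?thesis using q by (simp add: row_factor_def)
  qed
  have "(\<integral>z. row_factor I q \<tau> (h(r := z)) r \<partial>PiM I (\<lambda>_. centred_normal s))
    = (\<integral>z. exp (\<i> * of_real (\<tau> * (ln (rss I h r z) - ln (rss I h q z)))) \<partial>PiM I (\<lambda>_. centred_normal s))"
    unfolding eq
  proof (rule integral_cong_AE)
    show "AE z in PiM I (\<lambda>_. centred_normal s). (if rss I h r z > 0 then exp (\<i> * of_real (\<tau> * (ln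
      (rss I h r z) - ln (rss I h q z)))) else 0)
        = exp (\<i> * of_real (\<tau> * (ln (rss I h r z) - ln (rss I h q z))))"
      using AE_A_pos by eventually_elim simp
  qed measurable
  also have "\<dots> = beta_char (real (card I - r) / 2) (real (card I - q) / 2) \<tau>"
  proof -
    have "real (card I - r) / 2 + real (r - q) / 2 = real (card I - q) / 2"
      using q by (simp add: of_nat_diff flip: add_divide_distrib)
    then show ?thesis unfolding char_ln_ratio beta_char_def by (simp only:)
  qed
  finally show ?thesis .
qed

section \<open>Integrating out the rows of a Gaussian array\<close>

definition stack_rows :: "nat \<Rightarrow> (nat \<Rightarrow> 'i \<Rightarrow> real) \<Rightarrow> ('i \<times> nat \<Rightarrow> real) \<Rightarrow> nat \<Rightarrow> 'i \<Rightarrow> real" where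
  "stack_rows q F x k = (if k < q then F k else (\<lambda>t. x (t, k - q)))"

abbreviation normal_array :: "'i set \<Rightarrow> nat \<Rightarrow> (nat \<Rightarrow> real) \<Rightarrow> ('i \<times> nat \<Rightarrow> real) measure" where
  "normal_array I p \<sigma> \<equiv> PiM (I \<times> {..<p}) (\<lambda>(t, k). centred_normal (\<sigma> k))"

lemma measurable_array_component:
  assumes "t \<in> I" "k \<in> J"
  shows "(\<lambda>x. x (t, k)) \<in> borel_measurable (PiM (I \<times> J) (\<lambda>(t, k). centred_normal (\<sigma> k)))"
  using measurable_component_singleton[of "(t, k)" "I \<times> J" "\<lambda>(t, k). centred_normal (\<sigma> k)"] assms
  by (simp cong: measurable_cong_sets)

lemma measurable_stack_rows:
  assumes "l < q + m" "t \<in> I"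
  shows "(\<lambda>x. stack_rows q F x l t) \<in> borel_measurable (PiM (I \<times> {..<m}) (\<lambda>(t, k). centred_normal (\<sigma>
    k)))"
  using assms measurable_array_component[of t I "l - q" "{..<m}" \<sigma>]
  by (cases "l < q") (auto simp: stack_rows_def)

definition char_product :: "nat \<Rightarrow> nat \<Rightarrow> real \<Rightarrow> complex" where
  "char_product N p \<tau> = (\<Prod>k<p. beta_char (real (N - k) / 2) (real N / 2) \<tau>)"

text \<open>Fubini peels off the last error row: the factors of the earlier rows do not see it, and
  its own factor integrates to a constant.\<close>

lemma integral_row_product:
  assumes \<sigma>: "\<And>k. k < p \<Longrightarrow> \<sigma> k > 0" and I: "finite (I :: 'i set)" and q: "q + p \<le> card I"
    and pos: "nondegenerate I F q"
  shows "(\<integral>x. row_product I q p \<tau> (stack_rows q F x) \<partial>normal_array I p \<sigma>)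
    = char_product (card I - q) p \<tau>"
proof -
  \<comment> \<open>Positive scales beyond p as well, so that every component measure is a
    probability measure.\<close>
  define \<sigma>' where "\<sigma>' k = (if k < p then \<sigma> k else 1)" for k
  have \<sigma>': "\<sigma>' k > 0" for k using \<sigma> by (simp add: \<sigma>'_def)
  let ?M = "\<lambda>(t::'i, k). centred_normal (\<sigma>' k)" and ?h = "stack_rows q F"
  have Mi: "prob_space (?M i)" for i using \<sigma>' by (auto simp: split_beta intro:
    prob_space_centred_normal)
  interpret product_sigma_finite ?M
    by (rule product_sigma_finite.intro) (rule prob_space_imp_sigma_finite[OF Mi])
  have main: "n \<le> p \<Longrightarrow> (\<integral>x. row_product I q n \<tau> (?h x) \<partial>PiM (I \<times> {..<n}) ?M)
    = char_product (card I - q) n \<tau>" for n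
  proof (induction n)
    case 0
    interpret prob_space "PiM (I \<times> {..<0}) ?M" by (rule prob_space_PiM) (rule Mi)
    show ?case using prob_space by (simp add: row_product_def char_product_def)
  next
    case (Suc n)
    let ?P = "PiM (I \<times> {..<n}) ?M" and ?R = "PiM (I \<times> {n}) ?M"
    let ?m = "\<lambda>x y. merge (I \<times> {..<n}) (I \<times> {n}) (x, y)"
    let ?b = "beta_char (real (card I - (q + n)) / 2) (real (card I - q) / 2) \<tau>"
    interpret PS: prob_space "PiM (I \<times> {..<Suc n}) ?M" by (rule prob_space_PiM) (rule Mi)
    have un: "I \<times> {..<Suc n} = I \<times> {..<n} \<union> I \<times> {n}" by auto
    have step: "row_product I q (Suc n) \<tau> h = row_product I q n \<tau> h * row_factor I q \<tau> h (q + n)" for h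
      by (simp add: row_product_def)
    have "(\<integral>x. row_product I q (Suc n) \<tau> (?h x) \<partial>PiM (I \<times> {..<Suc n}) ?M)
      = (\<integral>x. (\<integral>y. row_product I q (Suc n) \<tau> (?h (?m x y)) \<partial>?R) \<partial>?P)"
      unfolding un
    proof (rule product_integral_fold)
      show "integrable (PiM (I \<times> {..<n} \<union> I \<times> {n}) ?M) (\<lambda>x. row_product I q (Suc n) \<tau> (?h x))"
        unfolding un[symmetric]
        by (intro PS.integrable_const_bound[where B = 1] AE_I2 norm_row_product measurable_row_product
          measurable_stack_rows)
    qed (use I in auto)
    also have "\<dots> = (\<integral>x. row_product I q n \<tau> (?h x) * ?b \<partial>?P)"
    proof (rule Bochner_Integration.integral_cong[OF refl])
      fix x :: "'i \<times> nat \<Rightarrow> real"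
      have old: "row_product I q n \<tau> (?h (?m x y)) = row_product I q n \<tau> (?h x)" for y
        by (intro row_product_cong) (auto simp: stack_rows_def merge_def)
      have new: "row_factor I q \<tau> (?h (?m x y)) (q + n) = row_factor I q \<tau> ((?h x)(q
        + n := (\<lambda>t\<in>I. y (t, n)))) (q + n)" for y
        by (intro row_factor_cong) (auto simp: stack_rows_def merge_def)
      let ?g = "\<lambda>z. row_factor I q \<tau> ((?h x)(q + n := z)) (q + n)"
      have "row_product I q n \<tau> (?h x) * (\<integral>y. ?g (\<lambda>t\<in>I. y (t, n)) \<partial>?R)
        = row_product I q n \<tau> (?h x) * ?b"
      proof (cases "row_product I q n \<tau> (?h x) = 0")
        case False
        have "nondegenerate I (?h x) q"
          using pos by (subst nondegenerate_cong[where h' = F]) (auto simp: stack_rows_def)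
        with False have nd: "nondegenerate I (?h x) (q + n)" by (simp add: row_product_nonzero_iff)
        have d: "distr ?R (PiM I (\<lambda>t. ?M (t, n))) (\<lambda>y. \<lambda>t\<in>I. y (t, n)) = PiM I (\<lambda>t. ?M (t, n))"
          by (rule distr_PiM_reindex) (use Mi in \<open>auto simp: inj_on_def\<close>)
        have mg: "?g \<in> borel_measurable (PiM I (\<lambda>t. ?M (t, n)))"
        proof (rule measurable_row_factor)
          fix l t assume "t \<in> I"
          then show "(\<lambda>z. ((?h x)(q + n := z)) l t) \<in> borel_measurable (PiM I (\<lambda>t. ?M (t, n)))"
            using measurable_component_singleton[of t I "\<lambda>_. centred_normal (\<sigma>' n)"]
            by (cases "l = q + n") (simp_all cong: measurable_cong_sets)
        qed
        have mr: "(\<lambda>y. \<lambda>t\<in>I. y (t, n)) \<in> measurable ?R (PiM I (\<lambda>t. ?M (t, n)))"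
          by (intro measurable_restrict measurable_component_singleton) auto
        have "(\<integral>y. ?g (\<lambda>t\<in>I. y (t, n)) \<partial>?R) = (\<integral>z. ?g z \<partial>distr ?R (PiM I (\<lambda>t. ?M (t, n))) (\<lambda>y. \<lambda>t\<in>I. y
          (t, n)))"
          by (rule integral_distr[symmetric, OF mr mg])
        also have "\<dots> = (\<integral>z. ?g z \<partial>PiM I (\<lambda>_. centred_normal (\<sigma>' n)))" unfolding d by simp
        also have "\<dots> = ?b"
          using q Suc.prems by (intro integral_row_factor \<sigma>' I nd) auto
        finally show ?thesis by simp
      qed simp
      then show "(\<integral>y. row_product I q (Suc n) \<tau> (?h (?m x y)) \<partial>?R) = row_product I q n \<tau> (?h x) * ?b"
        by (simp add: step old new)
    qed
    also have "\<dots> = char_product (card I - q) (Suc n) \<tau>"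
      using Suc by (simp add: char_product_def)
    finally show ?case .
  qed
  have "PiM (I \<times> {..<p}) ?M = normal_array I p \<sigma>"
    by (intro PiM_cong refl) (auto simp: \<sigma>'_def)
  with main[of p] show ?thesis by simp
qed

lemma beta_char_0: "a > 0 \<Longrightarrow> c > 0 \<Longrightarrow> beta_char a c 0 = 1"
  using Gamma_ne_zero_Re[of "of_real a"] Gamma_ne_zero_Re[of "of_real c"] by (simp add: beta_char_def)

text \<open>At \<tau> = 0 the integrand is the indicator of nondegeneracy and all the constants
  \<open>beta_char _ _ 0\<close> are 1, so the event has probability 1.\<close>

lemma AE_stack_rows_nondegenerate:
  assumes \<sigma>: "\<And>k. k < p \<Longrightarrow> \<sigma> k > 0" and I: "finite (I :: 'i set)" and q: "q + p \<le> card I"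
    and pos: "nondegenerate I F q"
  shows "AE x in normal_array I p \<sigma>. nondegenerate I (stack_rows q F x) (q + p)"
proof -
  interpret prob_space "normal_array I p \<sigma>"
    by (rule prob_space_PiM) (use \<sigma> in \<open>auto intro: prob_space_centred_normal\<close>)
  let ?h = "stack_rows q F"
  let ?D = "{x \<in> space (normal_array I p \<sigma>). row_product I q p 0 (?h x) \<noteq> 0}"
  have [measurable]: "(\<lambda>x. row_product I q p 0 (?h x)) \<in> borel_measurable (normal_array I p \<sigma>)"
    by (intro measurable_row_product measurable_stack_rows)
  have nd: "nondegenerate I (?h x) q" for x
    using pos by (subst nondegenerate_cong[where h' = F]) (auto simp: stack_rows_def)
  have "complex_of_real (prob ?D) = (\<integral>x. complex_of_real (indicator ?D x) \<partial>normal_array I p \<sigma>)" by simp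
  also have "\<dots> = (\<integral>x. row_product I q p 0 (?h x) \<partial>normal_array I p \<sigma>)"
    by (intro Bochner_Integration.integral_cong refl) (simp add: row_product_0[OF nd])
  also have "\<dots> = char_product (card I - q) p 0"
    by (rule integral_row_product[OF \<sigma> I q pos])
  also have "\<dots> = 1" unfolding char_product_def using q by (intro prod.neutral ballI beta_char_0) auto
  finally have "AE x in normal_array I p \<sigma>. x \<in> ?D" by (intro AE_prob_1) simp
  then show ?thesis by eventually_elim (simp add: row_product_nonzero_iff[OF nd])
qed

section \<open>Laws of Gaussian arrays\<close>

lemma measurable_nested_component:
  assumes "t \<in> I" "k \<in> J"
  shows "(\<lambda>x. x t k) \<in> measurable (PiM I (\<lambda>t. PiM J (N t))) (N t k)"
proof -
  have 1: "(\<lambda>x. x t) \<in> measurable (PiM I (\<lambda>t. PiM J (N t))) (PiM J (N t))"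
    using measurable_component_singleton[OF assms(1), of "\<lambda>t. PiM J (N t)"] .
  have 2: "(\<lambda>y. y k) \<in> measurable (PiM J (N t)) (N t k)"
    using measurable_component_singleton[OF assms(2), of "N t"] .
  show ?thesis using measurable_compose[OF 1 2] .
qed

text \<open>The model gives independent columns, each a product over coordinates, while integration
  by rows needs a single product over entries. Both measures agree on rectangles.\<close>

lemma distr_PiM_flatten:
  fixes \<rho> :: "'i \<Rightarrow> 'j \<Rightarrow> real measure"
  assumes I: "finite I" and J: "finite J" and p: "\<And>t k. prob_space (\<rho> t k)" and s: "\<And>t k. sets (\<rho> t k)
    = sets borel"
  shows "distr (PiM I (\<lambda>t. PiM J (\<rho> t))) (PiM (I \<times> J) (\<lambda>(t, k). \<rho> t k)) (\<lambda>x. \<lambda>(t, k)\<in>I \<times> J. x t k)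
    = PiM (I \<times> J) (\<lambda>(t, k). \<rho> t k)"
proof -
  let ?M = "\<lambda>(t, k). \<rho> t k" and ?N = "PiM I (\<lambda>t. PiM J (\<rho> t))" and ?f = "\<lambda>x. \<lambda>(t, k)\<in>I \<times> J. x t k"
  interpret M: product_sigma_finite ?M
    by (rule product_sigma_finite.intro) (auto intro: prob_space_imp_sigma_finite p simp: split_beta)
  interpret R: product_sigma_finite "\<rho> t" for t
    by (rule product_sigma_finite.intro) (auto intro: prob_space_imp_sigma_finite p)
  interpret N: product_sigma_finite "\<lambda>t. PiM J (\<rho> t)"
    by (rule product_sigma_finite.intro) (auto intro!: prob_space_imp_sigma_finite prob_space_PiM p)
  have comp: "(\<lambda>x. x t k) \<in> measurable ?N (\<rho> t k)" if "t \<in> I" "k \<in> J" for t k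
    using measurable_nested_component[OF that, of \<rho>] .
  have f: "?f \<in> measurable ?N (PiM (I \<times> J) ?M)"
    by (rule measurable_restrict) (auto intro: comp)
  show ?thesis
  proof (rule M.PiM_eqI)
    show "finite (I \<times> J)" using I J by simp
    show "sets (distr ?N (PiM (I \<times> J) ?M) ?f) = sets (PiM (I \<times> J) ?M)" by simp
    fix A assume A: "\<And>i. i \<in> I \<times> J \<Longrightarrow> A i \<in> sets (?M i)"
    have A': "A (t, k) \<in> sets (\<rho> t k)" if "t \<in> I" "k \<in> J" for t k using A[of "(t, k)"] that by simp
    have sp: "space (\<rho> t k) = UNIV" for t k using sets_eq_imp_space_eq[OF s] by simp
    have eq: "?f -` Pi\<^sub>E (I \<times> J) A \<inter> space ?N = Pi\<^sub>E I (\<lambda>t. Pi\<^sub>E J (\<lambda>k. A (t, k)))"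
      by (auto simp: space_PiM sp PiE_iff extensional_def split: prod.splits)
    have "emeasure (distr ?N (PiM (I \<times> J) ?M) ?f) (Pi\<^sub>E (I \<times> J) A)
      = emeasure ?N (Pi\<^sub>E I (\<lambda>t. Pi\<^sub>E J (\<lambda>k. A (t, k))))"
      unfolding eq[symmetric] using I J A by (intro emeasure_distr f sets_PiM_I_finite) auto
    also have "\<dots> = (\<Prod>t\<in>I. emeasure (PiM J (\<rho> t)) (Pi\<^sub>E J (\<lambda>k. A (t, k))))"
      using I J A' by (intro N.emeasure_PiM sets_PiM_I_finite) auto
    also have "\<dots> = (\<Prod>t\<in>I. \<Prod>k\<in>J. emeasure (\<rho> t k) (A (t, k)))"
      using J A' by (intro prod.cong refl R.emeasure_PiM) auto
    also have "\<dots> = (\<Prod>i\<in>I \<times> J. emeasure (?M i) (A i))"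
      by (simp add: prod.cartesian_product split_beta)
    finally show "emeasure (distr ?N (PiM (I \<times> J) ?M) ?f) (Pi\<^sub>E (I \<times> J) A)
      = (\<Prod>i\<in>I \<times> J. emeasure (?M i) (A i))" .
  qed
qed

lemma PiM_density:
  assumes I: "finite I" and M: "product_sigma_finite M"
    and g: "\<And>i. g i \<in> borel_measurable (M i)" and p: "product_sigma_finite (\<lambda>i. density (M i) (g i))"
  shows "PiM I (\<lambda>i. density (M i) (g i)) = density (PiM I M) (\<lambda>x. \<Prod>i\<in>I. g i (x i))"
proof -
  interpret M: product_sigma_finite M by fact
  interpret D: product_sigma_finite "\<lambda>i. density (M i) (g i)" by fact
  have gm: "(\<lambda>x. \<Prod>i\<in>I. g i (x i)) \<in> borel_measurable (PiM I M)"
  proof (rule borel_measurable_prod_ennreal)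
    fix i assume "i \<in> I"
    from measurable_compose[OF measurable_component_singleton[OF this, of M] g]
    show "(\<lambda>x. g i (x i)) \<in> borel_measurable (PiM I M)" .
  qed
  show ?thesis
  proof (rule D.PiM_eqI[symmetric, OF I])
    show "sets (density (PiM I M) (\<lambda>x. \<Prod>i\<in>I. g i (x i))) = sets (PiM I (\<lambda>i. density (M i) (g i)))"
      by (simp cong: sets_PiM_cong)
    fix A assume "\<And>i. i \<in> I \<Longrightarrow> A i \<in> sets (density (M i) (g i))"
    then have A: "\<And>i. i \<in> I \<Longrightarrow> A i \<in> sets (M i)" by simp
    have "emeasure (density (PiM I M) (\<lambda>x. \<Prod>i\<in>I. g i (x i))) (Pi\<^sub>E I A)
      = (\<integral>\<^sup>+x. (\<Prod>i\<in>I. g i (x i)) * indicator (Pi\<^sub>E I A) x \<partial>PiM I M)"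
      using A I by (intro emeasure_density gm sets_PiM_I_finite) auto
    also have "\<dots> = (\<integral>\<^sup>+x. (\<Prod>i\<in>I. g i (x i) * indicator (A i) (x i)) \<partial>PiM I M)"
    proof (rule nn_integral_cong)
      fix x assume x: "x \<in> space (PiM I M)"
      have "indicator (Pi\<^sub>E I A) x = (\<Prod>i\<in>I. indicator (A i) (x i) :: ennreal)"
      proof (cases "x \<in> Pi\<^sub>E I A")
        case False
        then obtain i where "i \<in> I" "x i \<notin> A i" using x by (auto simp: space_PiM PiE_iff)
        then have "(\<Prod>i\<in>I. indicator (A i) (x i) :: ennreal) = 0" using I
          by (intro prod_zero bexI[of _ i]) auto
        then show ?thesis using False by simp
      qed (auto simp: PiE_iff intro!: prod.neutral[symmetric])
      then show "(\<Prod>i\<in>I. g i (x i)) * indicator (Pi\<^sub>E I A) x = (\<Prod>i\<in>I. g i (x i) * indicator (A i) (x i))"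
        by (simp add: prod.distrib)
    qed
    also have "\<dots> = (\<Prod>i\<in>I. \<integral>\<^sup>+x. g i x * indicator (A i) x \<partial>M i)"
      using A g by (intro M.product_nn_integral_prod I borel_measurable_times_ennreal
        borel_measurable_indicator) auto
    also have "\<dots> = (\<Prod>i\<in>I. emeasure (density (M i) (g i)) (A i))"
      using A g by (intro prod.cong refl emeasure_density[symmetric]) auto
    finally show "emeasure (density (PiM I M) (\<lambda>x. \<Prod>i\<in>I. g i (x i))) (Pi\<^sub>E I A)
      = (\<Prod>i\<in>I. emeasure (density (M i) (g i)) (A i))" .
  qed
qed

lemma product_sigma_finite_lborel: "product_sigma_finite (\<lambda>_. lborel :: real measure)"
  by (rule product_sigma_finite.intro) (rule lborel.sigma_finite_measure_axioms)

lemma PiM_centred_normal_eq_density: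
  assumes "finite J" "\<And>k. \<sigma> k > 0"
  shows "PiM J (\<lambda>k. centred_normal (\<sigma> k)) = density (PiM J (\<lambda>_. lborel)) (\<lambda>x. \<Prod>k\<in>J. ennreal
    (normal_density 0 (\<sigma> k) (x k)))"
proof -
  have "product_sigma_finite (\<lambda>k. density lborel (\<lambda>x. ennreal (normal_density 0 (\<sigma> k) x)))"
    using assms(2) by (intro product_sigma_finite.intro prob_space_imp_sigma_finite
      prob_space_normal_density)
  then show ?thesis unfolding centred_normal_def
    by (intro PiM_density[OF assms(1) product_sigma_finite_lborel]) auto
qed

lemma flatten_measurable:
  "(\<lambda>x. \<lambda>(t, k)\<in>I \<times> J. x t k) \<in> measurable (PiM I (\<lambda>_. PiM J N)) (PiM (I \<times> J) (\<lambda>(t, k). N k))"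
proof (rule measurable_restrict)
  fix i assume "i \<in> I \<times> J"
  then show "(\<lambda>x. case i of (t, k) \<Rightarrow> x t k) \<in> measurable (PiM I (\<lambda>_. PiM J N)) (case i of (t, k) \<Rightarrow> N k)"
    using measurable_nested_component[of "fst i" I "snd i" J "\<lambda>_. N"] by (auto simp: split_beta)
qed

text \<open>F and U are indexed by time first, as in the model, and rows by coordinate first.
  Factors precede errors, so that the first K Gram-Schmidt vectors belong to the factor
  rows.\<close>

definition joint_rows :: "nat \<Rightarrow> (nat \<Rightarrow> nat \<Rightarrow> real) \<Rightarrow> (nat \<Rightarrow> nat \<Rightarrow> real) \<Rightarrow> nat \<Rightarrow> nat \<Rightarrow> real" where
  "joint_rows K F U k t = (if k < K then F t k else U t (k - K))"

lemma integral_joint_rows_nested: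
  assumes \<sigma>: "\<And>k. \<sigma> k > 0" and KT: "K + p \<le> T"
    and pos: "nondegenerate {..<T} (\<lambda>k t. F t k) K"
  defines "P \<equiv> PiM {..<T} (\<lambda>_. PiM {..<p} (\<lambda>k. centred_normal (\<sigma> k)))"
  shows "(\<integral>U. row_product {..<T} K p \<tau> (joint_rows K F U) \<partial>P) = char_product (T - K) p \<tau>"
    and "AE U in P. nondegenerate {..<T} (joint_rows K F U) (K + p)"
proof -
  let ?A = "normal_array {..<T} p \<sigma>" and ?h = "stack_rows K (\<lambda>k t. F t k)"
  let ?f = "\<lambda>x. \<lambda>(t, k)\<in>{..<T} \<times> {..<p}. x t k"
  have d: "distr P ?A ?f = ?A"
    unfolding P_def by (rule distr_PiM_flatten) (auto intro: prob_space_centred_normal \<sigma>)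
  have f: "?f \<in> measurable P ?A" unfolding P_def by (rule flatten_measurable)
  have eq: "joint_rows K F U l t = ?h (?f U) l t" if "l < K + p" "t < T" for U l t
    using that by (auto simp: joint_rows_def stack_rows_def)
  have "(\<integral>U. row_product {..<T} K p \<tau> (joint_rows K F U) \<partial>P)
    = (\<integral>U. row_product {..<T} K p \<tau> (?h (?f U)) \<partial>P)"
    by (intro Bochner_Integration.integral_cong refl row_product_cong) (simp only: eq lessThan_iff)
  also have "\<dots> = (\<integral>x. row_product {..<T} K p \<tau> (?h x) \<partial>distr P ?A ?f)"
    by (rule integral_distr[OF f, symmetric]) (intro measurable_row_product measurable_stack_rows)
  also have "\<dots> = char_product (T - K) p \<tau>"
    unfolding d using integral_row_product[of p \<sigma> "{..<T}" K "\<lambda>k t. F t k" \<tau>] \<sigma> KT pos by simp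
  finally show "(\<integral>U. row_product {..<T} K p \<tau> (joint_rows K F U) \<partial>P) = char_product (T - K) p \<tau>" .
  have "AE x in ?A. nondegenerate {..<T} (?h x) (K + p)"
    using \<sigma> KT pos by (intro AE_stack_rows_nondegenerate) auto
  then have "AE U in P. nondegenerate {..<T} (?h (?f U)) (K + p)"
    by (subst (asm) d[symmetric]) (rule AE_distrD[OF f])
  moreover have "nondegenerate {..<T} (?h (?f U)) (K + p) = nondegenerate {..<T} (joint_rows K F U) (K
    + p)" for U
    by (intro nondegenerate_cong) (simp only: eq lessThan_iff)
  ultimately show "AE U in P. nondegenerate {..<T} (joint_rows K F U) (K + p)" by (simp only:)
qed

text \<open>Nondegeneracy only depends on the null sets of the column law, so it may be checked for
  standard normal columns.\<close>

lemma AE_nondegenerate_of_densities: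
  assumes KT: "K \<le> T" and \<phi>: "\<phi> \<in> borel_measurable (PiM {..<K} (\<lambda>_. lborel))"
    and pr: "prob_space (density (PiM {..<K} (\<lambda>_. lborel)) \<phi>)"
  shows "AE x in PiM {..<T} (\<lambda>_. density (PiM {..<K} (\<lambda>_. lborel)) \<phi>). nondegenerate {..<T} (\<lambda>k t. x t
    k) K"
proof -
  let ?L = "PiM {..<K} (\<lambda>_. lborel :: real measure)" and ?G = "PiM {..<K} (\<lambda>_. centred_normal 1)"
  \<comment> \<open>The standard normal density is positive and finite everywhere, so the column law
    has density \<phi> / \<psi> with respect to it and inherits its null sets.\<close>
  define \<psi> where "\<psi> x = (\<Prod>k<K. ennreal (normal_density 0 1 (x k)))" for x
  have [measurable]: "\<phi> \<in> borel_measurable ?L" by (rule \<phi>)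
  have comp [measurable]: "(\<lambda>x. x k) \<in> borel_measurable ?L" if "k \<in> {..<K}" for k
    using measurable_component_singleton[OF that, of "\<lambda>_. lborel"] by simp
  have [measurable]: "\<psi> \<in> borel_measurable ?L" unfolding \<psi>_def
    by (intro borel_measurable_prod_ennreal) measurable
  have G: "?G = density ?L \<psi>" unfolding \<psi>_def by (intro PiM_centred_normal_eq_density) auto
  have \<psi>0: "\<psi> x \<noteq> 0" "\<psi> x \<noteq> \<top>" for x
  proof -
    have "0 < (\<Prod>k<K. normal_density 0 1 (x k))" by (intro prod_pos ballI normal_density_pos) auto
    moreover have "\<psi> x = ennreal (\<Prod>k<K. normal_density 0 1 (x k))"
      unfolding \<psi>_def by (intro prod_ennreal) auto
    ultimately show "\<psi> x \<noteq> 0" "\<psi> x \<noteq> \<top>"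
      by (simp_all only: ennreal_eq_0_iff not_le ennreal_neq_top not_False_eq_True)
  qed
  have "density ?G (\<lambda>x. \<phi> x / \<psi> x) = density ?L (\<lambda>x. \<psi> x * (\<phi> x / \<psi> x))"
    unfolding G by (subst density_density_eq) auto
  also have "\<dots> = density ?L \<phi>"
    using \<psi>0 by (intro arg_cong[where f = "density ?L"] ext) (simp add: ennreal_mult_divide_eq
      ennreal_times_divide mult.commute)
  finally have eq: "density ?L \<phi> = density ?G (\<lambda>x. \<phi> x / \<psi> x)" ..
  have sG: "sets ?G = sets ?L" by (simp add: G)
  have m: "(\<lambda>x. \<phi> x / \<psi> x) \<in> borel_measurable ?G"
    by (subst measurable_cong_sets[OF sG refl]) measurable
  have prG: "prob_space ?G" by (rule prob_space_PiM) (rule prob_space_centred_normal, simp)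
  have "PiM {..<T} (\<lambda>_. density ?L \<phi>) = density (PiM {..<T} (\<lambda>_. ?G)) (\<lambda>x. \<Prod>t<T. \<phi> (x t) / \<psi> (x t))"
    unfolding eq using pr[unfolded eq] prG m
    by (intro PiM_density) (auto intro!: product_sigma_finite.intro prob_space_imp_sigma_finite)
  moreover have "AE x in PiM {..<T} (\<lambda>_. ?G). nondegenerate {..<T} (\<lambda>k t. x t k) K"
  proof -
    \<comment> \<open>The K standard normal rows are regarded as error rows above zero factor rows;
      \<open>joint_rows 0\<close> never reads its factor argument.\<close>
    have "AE x in PiM {..<T} (\<lambda>_. ?G). nondegenerate {..<T} (joint_rows 0 undefined x) (0 + K)"
      using KT by (intro integral_joint_rows_nested) (auto simp: nondegenerate_def)
    moreover have "joint_rows 0 undefined x = (\<lambda>k t. x t k)" for x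
      by (simp add: joint_rows_def fun_eq_iff)
    ultimately show ?thesis by simp
  qed
  moreover have "(\<lambda>x. \<Prod>t<T. \<phi> (x t) / \<psi> (x t)) \<in> borel_measurable (PiM {..<T} (\<lambda>_. ?G))"
  proof (rule borel_measurable_prod_ennreal)
    fix t assume "t \<in> {..<T}"
    from measurable_compose[OF measurable_component_singleton[OF this, of "\<lambda>_. ?G"] m]
    show "(\<lambda>x. \<phi> (x t) / \<psi> (x t)) \<in> borel_measurable (PiM {..<T} (\<lambda>_. ?G))" .
  qed
  ultimately show ?thesis by (simp only: AE_density) (auto elim: eventually_mono)
qed

lemma measurable_joint_rows:
  assumes "k < K + p" "t < T"
  shows "(\<lambda>z. joint_rows K (fst z) (snd z) k t)
    \<in> borel_measurable (PiM {..<T} (\<lambda>_. PiM {..<K} (\<lambda>_. borel)) \<Otimes>\<^sub>M PiM {..<T} (\<lambda>_. PiM {..<p} (\<lambda>_.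
      borel)))"
proof (cases "k < K")
  case True
  then show ?thesis
    using measurable_compose[OF measurable_fst measurable_nested_component[of t "{..<T}" k "{..<K}"
      "\<lambda>_ _. borel"]] assms
    by (simp add: joint_rows_def)
next
  case False
  then have "k - K < p" using assms by simp
  with False show ?thesis
    using measurable_compose[OF measurable_snd measurable_nested_component[of t "{..<T}" "k - K"
      "{..<p}" "\<lambda>_ _. borel"]] assms
    by (simp add: joint_rows_def)
qed

lemma measurable_nondegenerate:
  assumes "\<And>l t. l < r \<Longrightarrow> t \<in> I \<Longrightarrow> (\<lambda>\<omega>. h \<omega> l t) \<in> borel_measurable M"
  shows "{\<omega> \<in> space M. nondegenerate I (h \<omega>) r} \<in> sets M"
proof -
  have "{\<omega> \<in> space M. \<forall>k\<in>{..<r}. rss I (h \<omega>) k (h \<omega> k) > 0} \<in> sets M"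
    using assms
    by (intro sets.sets_Collect_finite_All borel_measurable_less[OF borel_measurable_const]
      measurable_rss) auto
  then show ?thesis by (simp only: nondegenerate_def Ball_def lessThan_iff)
qed

text \<open>Conditioning on the factors by Fubini: for almost every factor array the integral over
  the errors is the same constant, whatever the factor law is.\<close>

lemma integral_joint_rows:
  assumes \<sigma>: "\<And>k. \<sigma> k > 0" and KT: "K + p \<le> T"
    and PF: "prob_space PF" "sets PF = sets (PiM {..<T} (\<lambda>_. PiM {..<K} (\<lambda>_. borel :: real measure)))"
    and pos: "AE F in PF. nondegenerate {..<T} (\<lambda>k t. F t k) K"
    and PU: "PU = PiM {..<T} (\<lambda>_. PiM {..<p} (\<lambda>k. centred_normal (\<sigma> k)))"
  shows "(\<integral>z. row_product {..<T} K p \<tau> (joint_rows K (fst z) (snd z)) \<partial>(PF \<Otimes>\<^sub>M PU))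
    = char_product (T - K) p \<tau>"
    and "AE z in PF \<Otimes>\<^sub>M PU. nondegenerate {..<T} (joint_rows K (fst z) (snd z)) (K + p)"
proof -
  have prU: "prob_space PU" unfolding PU by (intro prob_space_PiM prob_space_centred_normal \<sigma>)
  interpret F: prob_space PF by fact
  interpret U: prob_space PU by fact
  interpret FU: pair_prob_space PF PU ..
  have "sets PU = sets (PiM {..<T} (\<lambda>_. PiM {..<p} (\<lambda>_. borel :: real measure)))"
    unfolding PU by (intro sets_PiM_cong refl) simp
  note cong = measurable_cong_sets[OF sets_pair_measure_cong[OF PF(2) this] refl]
  have m: "(\<lambda>z. joint_rows K (fst z) (snd z) k t) \<in> borel_measurable (PF \<Otimes>\<^sub>M PU)" if "k < K + p" "t
    \<in> {..<T}" for k t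
    unfolding cong using that by (intro measurable_joint_rows) auto
  let ?g = "\<lambda>z. row_product {..<T} K p \<tau> (joint_rows K (fst z) (snd z))"
  have mg: "?g \<in> borel_measurable (PF \<Otimes>\<^sub>M PU)" by (intro measurable_row_product m)
  have "integrable (PF \<Otimes>\<^sub>M PU) ?g"
    by (intro FU.integrable_const_bound[where B = 1] AE_I2 norm_row_product mg)
  from FU.integral_fst'[OF this]
  have "(\<integral>z. ?g z \<partial>(PF \<Otimes>\<^sub>M PU)) = (\<integral>F. (\<integral>U. ?g (F, U) \<partial>PU) \<partial>PF)" by simp
  also have "\<dots> = (\<integral>F. char_product (T - K) p \<tau> \<partial>PF)"
  proof (rule integral_cong_AE)
    show "AE F in PF. (\<integral>U. ?g (F, U) \<partial>PU) = char_product (T - K) p \<tau>"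
      using pos unfolding PU fst_conv snd_conv
      by eventually_elim (rule integral_joint_rows_nested(1)[OF \<sigma> KT])
    show "(\<lambda>F. \<integral>U. ?g (F, U) \<partial>PU) \<in> borel_measurable PF"
      using mg by (intro U.borel_measurable_lebesgue_integral) simp
  qed simp
  also have "\<dots> = char_product (T - K) p \<tau>" by (simp add: F.prob_space)
  finally show "(\<integral>z. ?g z \<partial>(PF \<Otimes>\<^sub>M PU)) = char_product (T - K) p \<tau>" .
  show "AE z in PF \<Otimes>\<^sub>M PU. nondegenerate {..<T} (joint_rows K (fst z) (snd z)) (K + p)"
  proof (rule FU.AE_pair_measure)
    show "{z \<in> space (PF \<Otimes>\<^sub>M PU). nondegenerate {..<T} (joint_rows K (fst z) (snd z)) (K + p)}
      \<in> sets (PF \<Otimes>\<^sub>M PU)"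
      by (intro measurable_nondegenerate m)
    show "AE F in PF. AE U in PU. nondegenerate {..<T} (joint_rows K (fst (F, U)) (snd (F, U))) (K + p)"
      using pos unfolding PU fst_conv snd_conv
      by eventually_elim (rule integral_joint_rows_nested(2)[OF \<sigma> KT])
  qed
qed

section \<open>Matrix identities\<close>

lemma mat_inv_eqI:
  assumes A: "A \<in> carrier_mat n n" and B: "B \<in> carrier_mat n n" and AB: "A * B = 1\<^sub>m n"
  shows "mat_inv A = B"
proof -
  have "det A * det B = 1" using det_mult[OF A B] AB by simp
  then have "det A \<noteq> 0" by auto
  then have "A \<in> Units (ring_mat TYPE(real) n ())" by (rule det_non_zero_imp_unit[OF A])
  then obtain C where C: "mat_inverse A = Some C" using mat_inverse(1)[OF A, of "()"]
    by (cases "mat_inverse A") auto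
  from mat_inverse(2)[OF A C] have CA: "C * A = 1\<^sub>m n" and Cc: "C \<in> carrier_mat n n" by auto
  have "C = C * (A * B)" using Cc by (simp add: AB)
  also have "\<dots> = C * A * B" by (rule assoc_mult_mat[symmetric, OF Cc A B])
  also have "\<dots> = B" using B by (simp add: CA)
  finally show ?thesis using C by (simp add: mat_inv_def)
qed

lemma gram_inverse:
  assumes N: "N \<in> carrier_mat n n" and Ni: "Ni \<in> carrier_mat n n" and i: "Ni * N = 1\<^sub>m n"
  shows "(N * transpose_mat N) * (transpose_mat Ni * Ni) = 1\<^sub>m n"
    and "mat_inv (N * transpose_mat N) = transpose_mat Ni * Ni"
proof -
  let ?Nt = "transpose_mat N" and ?Nit = "transpose_mat Ni"
  have c: "?Nt \<in> carrier_mat n n" "?Nit \<in> carrier_mat n n" using N Ni by auto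
  have i': "N * Ni = 1\<^sub>m n" by (rule mat_mult_left_right_inverse[OF Ni N i])
  have "?Nt * ?Nit = 1\<^sub>m n" using transpose_mult[OF Ni N] i by simp
  then have "?Nt * (?Nit * Ni) = Ni" using assoc_mult_mat[OF c(1) c(2) Ni] Ni by simp
  then show 1: "(N * ?Nt) * (?Nit * Ni) = 1\<^sub>m n"
    using assoc_mult_mat[OF N c(1) mult_carrier_mat[OF c(2) Ni]] i' by simp
  show "mat_inv (N * ?Nt) = ?Nit * Ni"
    by (rule mat_inv_eqI[OF _ _ 1]) (use N Ni c in \<open>auto intro!: mult_carrier_mat\<close>)
qed

lemma upper_left_block_four_block:
  assumes "A \<in> carrier_mat p p" "D \<in> carrier_mat k k"
  shows "upper_left_block p (four_block_mat A B C D) = A"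
  using assms by (intro eq_matI) (auto simp: upper_left_block_def)

lemma block_triangular_inverse:
  fixes L :: "real Matrix.mat"
  assumes L: "L \<in> carrier_mat p p" "Li \<in> carrier_mat p p" "Li * L = 1\<^sub>m p"
    and G: "G \<in> carrier_mat k k" "Gi \<in> carrier_mat k k" "Gi * G = 1\<^sub>m k"
    and M: "M \<in> carrier_mat p k"
  shows "four_block_mat Li (- (Li * M * Gi)) (0\<^sub>m k p) Gi * four_block_mat L M (0\<^sub>m k p) G = 1\<^sub>m (p
    + k)"
proof -
  let ?Q = "Li * M * Gi"
  have LM: "Li * M \<in> carrier_mat p k" by (rule mult_carrier_mat[OF L(2) M])
  have Q: "?Q \<in> carrier_mat p k" "- ?Q \<in> carrier_mat p k" using mult_carrier_mat[OF LM G(2)] by auto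
  have "?Q * G = Li * M" using assoc_mult_mat[OF LM G(2) G(1)] G(3) right_mult_one_mat[OF LM] by simp
  then have "(- ?Q) * G = - (Li * M)" using uminus_mult_left_mat[of ?Q G] Q G by simp
  then have "Li * M + (- ?Q) * G = 0\<^sub>m p k" using LM by (simp add: add_uminus_minus_mat minus_r_inv_mat)
  then show ?thesis
    using mult_four_block_mat[OF L(2) Q(2) zero_carrier_mat G(2) L(1) M zero_carrier_mat G(1)] L G Q M
      by simp
qed

text \<open>The inverse of N is block upper triangular too, so the upper-left block of the inverse
  Gram matrix is the transpose of Li times Li. Inverting again gives L times its transpose, free of
  M and G: the Schur complement, without forming it.\<close>

lemma mat_inv_upper_left_block_gram:
  assumes L: "L \<in> carrier_mat p p" "Li \<in> carrier_mat p p" "Li * L = 1\<^sub>m p"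
    and G: "G \<in> carrier_mat k k" "Gi \<in> carrier_mat k k" "Gi * G = 1\<^sub>m k"
    and M: "M \<in> carrier_mat p k"
    and N: "N = four_block_mat L M (0\<^sub>m k p) G"
  shows "mat_inv (upper_left_block p (mat_inv (N * transpose_mat N))) = L * transpose_mat L"
proof -
  let ?Q = "- (Li * M * Gi)"
  let ?Ni = "four_block_mat Li ?Q (0\<^sub>m k p) Gi"
  have Q: "?Q \<in> carrier_mat p k" using mult_carrier_mat[OF mult_carrier_mat[OF L(2) M] G(2)] by auto
  have Nc: "N \<in> carrier_mat (p + k) (p + k)" "?Ni \<in> carrier_mat (p + k) (p + k)" unfolding N using L G
    by auto
  have "mat_inv (N * transpose_mat N) = transpose_mat ?Ni * ?Ni"
    by (rule gram_inverse(2)[OF Nc]) (unfold N, rule block_triangular_inverse[OF L G M])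
  also have "transpose_mat ?Ni = four_block_mat (transpose_mat Li) (0\<^sub>m p k) (transpose_mat ?Q)
    (transpose_mat Gi)"
    using transpose_four_block_mat[OF L(2) Q zero_carrier_mat G(2)] by simp
  also have "\<dots> * ?Ni = four_block_mat (transpose_mat Li * Li) (transpose_mat Li * ?Q)
      (transpose_mat ?Q * Li) (transpose_mat ?Q * ?Q + transpose_mat Gi * Gi)"
    using mult_four_block_mat[of "transpose_mat Li" p p "0\<^sub>m p k" k "transpose_mat ?Q" k
      "transpose_mat Gi" Li p ?Q k "0\<^sub>m k p" Gi]
      L G Q by simp
  finally have "upper_left_block p (mat_inv (N * transpose_mat N)) = transpose_mat Li * Li"
    using L G Q by (simp add: upper_left_block_four_block[where k = k])
  moreover have "mat_inv (transpose_mat Li * transpose_mat (transpose_mat Li))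
    = transpose_mat (transpose_mat L) * transpose_mat L"
    by (rule gram_inverse(2)) (use L in \<open>auto simp: transpose_mult[symmetric]\<close>)
  ultimately show ?thesis by simp
qed

lemma prod_list_upt: "prod_list (map f [0..<n]) = (\<Prod>i<n. f i :: real)"
  by (induction n) (simp_all add: mult.commute)

lemma det_lower_triangular_prod:
  assumes "\<And>i j. i < j \<Longrightarrow> j < n \<Longrightarrow> A $$ (i, j) = 0" "A \<in> carrier_mat n n"
  shows "det A = (\<Prod>i<n. A $$ (i, i) :: real)"
  using assms(2) by (subst det_lower_triangular[OF assms]) (auto simp: diag_mat_def prod_list_upt)

lemma inverse_of_det_nonzero:
  assumes A: "A \<in> carrier_mat n n" and d: "det A \<noteq> (0 :: real)"
  obtains Ai where "Ai \<in> carrier_mat n n" "Ai * A = 1\<^sub>m n" "A * Ai = 1\<^sub>m n"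
proof -
  obtain C where C: "mat_inverse A = Some C"
    using mat_inverse(1)[OF A, of "()"] det_non_zero_imp_unit[OF A d, of "()"]
      by (cases "mat_inverse A") auto
  with mat_inverse(2)[OF A C] show ?thesis using that by blast
qed

section \<open>The statistic in terms of Gram-Schmidt residuals\<close>

locale nondegenerate_rows =
  fixes T R :: nat and h :: "nat \<Rightarrow> nat \<Rightarrow> real"
  assumes nondegenerate: "nondegenerate {..<T} h R"
begin

lemma rss_pos: "k < R \<Longrightarrow> rss {..<T} h k (h k) > 0"
  using nondegenerate by (simp add: nondegenerate_def)

abbreviation "e \<equiv> gsn {..<T} h"
text \<open>Coordinates of row k in the orthonormalised rows, i.e. the triangular factor of a QR
  decomposition; \<open>c_eq\<close> gives its diagonal and the zeros beyond it.\<close>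

definition "c k l = ip {..<T} (e l) (h k)"

lemma e_orthonormal: "orthonormal {..<T} e R"
  by (rule gs_orthonormal(1)) (rule nondegenerate)

lemma ip_e: "l < R \<Longrightarrow> m < R \<Longrightarrow> ip {..<T} (e l) (e m) = of_bool (l = m)"
  using e_orthonormal by (simp add: orthonormal_def)

lemma row_expansion0:
  assumes "k < R"
  shows "h k t = (\<Sum>m<k. c k m * e m t) + sqrt (rss {..<T} h k (h k)) * e k t"
proof -
  have g: "ip {..<T} (gs {..<T} h k) (gs {..<T} h k) = rss {..<T} h k (h k)"
    by (rule gs_orthonormal(2)[OF nondegenerate assms])
  have "gs {..<T} h k t = sqrt (rss {..<T} h k (h k)) * e k t"
    using rss_pos[OF assms] by (simp add: gsn_def g)
  moreover have "gs {..<T} h k t = h k t - (\<Sum>m<k. c k m * e m t)"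
    by (subst gs_residual) (simp add: residual_def c_def)
  ultimately show ?thesis by simp
qed

lemma c_eq:
  assumes "k < R" "l < R" "k \<le> l"
  shows "c k l = (if l = k then sqrt (rss {..<T} h k (h k)) else 0)"
proof -
  have "c k l = (\<Sum>m<k. c k m * ip {..<T} (e l) (e m)) + sqrt (rss {..<T} h k (h k)) * ip {..<T} (e l)
    (e k)"
    by (subst c_def, subst row_expansion0[OF assms(1), abs_def]) (simp add: ip_simps)
  also have "(\<Sum>m<k. c k m * ip {..<T} (e l) (e m)) = 0"
    using assms by (intro sum.neutral) (auto simp: ip_e)
  finally show ?thesis using assms by (auto simp: ip_e)
qed

lemma row_expansion:
  assumes "k < R"
  shows "h k t = (\<Sum>l<R. c k l * e l t)"
proof -
  have "{..<R} = insert k ({..<k} \<union> {k<..<R})" "{..<k} \<inter> {k<..<R} = {}" using assms by auto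
  then have "(\<Sum>l<R. c k l * e l t) = (\<Sum>l<k. c k l * e l t) + c k k * e k t
    + (\<Sum>l\<in>{k<..<R}. c k l * e l t)"
    by (simp add: sum.union_disjoint ivl_disj_int)
  also have "(\<Sum>l\<in>{k<..<R}. c k l * e l t) = 0" using assms c_eq by (intro sum.neutral) auto
  finally show ?thesis using row_expansion0[OF assms, of t] c_eq[OF assms assms] by simp
qed

lemma rss_eq_tail:
  assumes "k < R" "q \<le> R"
  shows "rss {..<T} h q (h k) = (\<Sum>l\<in>{q..<R}. (c k l)\<^sup>2)"
proof -
  have "ip {..<T} (h k) (h k) = (\<Sum>l<R. c k l * c k l)"
    by (subst (1) row_expansion[OF assms(1), abs_def]) (simp add: ip_simps c_def)
  also have "\<dots> = (\<Sum>l<q. (c k l)\<^sup>2) + (\<Sum>l\<in>{q..<R}. (c k l)\<^sup>2)"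
  proof -
    have "{..<R} = {..<q} \<union> {q..<R}" using assms by auto
    then show ?thesis by (simp add: sum.union_disjoint ivl_disj_int power2_eq_square)
  qed
  finally show ?thesis unfolding rss_eq by (simp add: c_def)
qed

end

text \<open>The data list X before f, whereas Gram-Schmidt takes factors before errors. In this
  swapped order the data matrix is N E, where E has orthonormal rows and N is block upper
  triangular: L holds the error coordinates along the error directions, G those of the factors, and
  B occurs only in M. Thus E cancels in the Gram matrix, and M and G disappear with the block
  inversion.\<close>

lemma V11_inv_residuals:
  assumes nd: "nondegenerate {..<T} h (K + p)"
    and h: "\<And>k t. h k t = (if k < K then f t \<omega> $ k else u t \<omega> $ (k - K))"
    and B: "B \<in> carrier_mat p K"
    and f: "\<And>t. t < T \<Longrightarrow> f t \<omega> \<in> carrier_vec K" and u: "\<And>t. t < T \<Longrightarrow> u t \<omega> \<in> carrier_vec p"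
    and X: "\<And>t. t < T \<Longrightarrow> X t \<omega> = B *\<^sub>v f t \<omega> + u t \<omega>"
  defines "W \<equiv> V11_inv p K T (joint_vec X f) \<omega>"
  shows "W \<in> carrier_mat p p" "\<And>i. i < p \<Longrightarrow> W $$ (i, i) = rss {..<T} h K (h (K + i))"
    and "det W = (\<Prod>i<p. rss {..<T} h (K + i) (h (K + i)))"
proof -
  interpret nondegenerate_rows T "K + p" h by unfold_locales (rule nd)
  define L where "L = Matrix.mat p p (\<lambda>(i, j). c (K + i) (K + j))"
  define G where "G = Matrix.mat K K (\<lambda>(i, j). c i j)"
  define M where "M = Matrix.mat p K (\<lambda>(i, j). (\<Sum>k<K. B $$ (i, k) * c k j) + c (K + i) j)"
  define E where "E = Matrix.mat (p + K) T (\<lambda>(r, t). if r < p then e (K + r) t else e (r - p) t)"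
  define N where "N = four_block_mat L M (0\<^sub>m K p) G"
  let ?Y = "data_mat (p + K) T (joint_vec X f) \<omega>"
  have Lc: "L \<in> carrier_mat p p" and Gc: "G \<in> carrier_mat K K" and Mc: "M \<in> carrier_mat p K"
    and Ec: "E \<in> carrier_mat (p + K) T" by (auto simp: L_def G_def M_def E_def)
  have Nc: "N \<in> carrier_mat (p + K) (p + K)" unfolding N_def using Lc Gc by auto
  have Yc: "?Y \<in> carrier_mat (p + K) T" by (auto simp: data_mat_def mat_of_cols_def)
  have split: "(\<Sum>r<p + K. g r) = (\<Sum>r<p. g r) + (\<Sum>l<K. g (p + l))" for g :: "nat \<Rightarrow> real"
    by (induction K) auto
  have split2: "(\<Sum>r<K + p. g r) = (\<Sum>l<K. g l) + (\<Sum>r<p. g (K + r))" for g :: "nat \<Rightarrow> real"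
    by (induction p) auto
  have hU: "h (K + i) t = u t \<omega> $ i" "h (i + K) t = u t \<omega> $ i" for i t by (simp_all add: h)
  have hF: "h k t = f t \<omega> $ k" if "k < K" for k t using that by (simp add: h)
  have Y: "?Y = N * E"
  proof (rule eq_matI)
    fix i t assume "i < dim_row (N * E)" "t < dim_col (N * E)"
    then have i: "i < p + K" and t: "t < T" using Nc Ec by auto
    have "(N * E) $$ (i, t) = (\<Sum>r<p + K. N $$ (i, r) * E $$ (r, t))"
      using i t Nc Ec by (simp add: scalar_prod_def atLeast0LessThan)
    also have "\<dots> = (\<Sum>r<p. N $$ (i, r) * e (K + r) t) + (\<Sum>l<K. N $$ (i, p + l) * e l t)"
      unfolding split using t by (simp add: E_def)
    also have "\<dots> = ?Y $$ (i, t)"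
    proof (cases "i < p")
      case True
      have "(\<Sum>r<p. N $$ (i, r) * e (K + r) t) + (\<Sum>l<K. N $$ (i, p + l) * e l t)
        = (\<Sum>r<p. c (K + i) (K + r) * e (K + r) t)
          + (\<Sum>l<K. ((\<Sum>k<K. B $$ (i, k) * c k l) + c (K + i) l) * e l t)"
        using True by (simp add: N_def L_def M_def G_def)
      also have "\<dots> = (\<Sum>l<K + p. c (K + i) l * e l t) + (\<Sum>l<K. \<Sum>k<K. B $$ (i, k) * (c k l * e l t))"
        unfolding split2 by (simp add: distrib_right sum.distrib sum_distrib_right mult.assoc)
      also have "(\<Sum>l<K + p. c (K + i) l * e l t) = h (K + i) t"
        using True by (intro row_expansion[symmetric]) auto
      also have "(\<Sum>l<K. \<Sum>k<K. B $$ (i, k) * (c k l * e l t)) = (\<Sum>k<K. B $$ (i, k) * h k t)"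
      proof (subst sum.swap, intro sum.cong refl)
        fix k assume k: "k \<in> {..<K}"
        then have "h k t = (\<Sum>l<K. c k l * e l t) + (\<Sum>r<p. c k (K + r) * e (K + r) t)"
          by (subst row_expansion) (auto simp: split2)
        also have "(\<Sum>r<p. c k (K + r) * e (K + r) t) = 0"
          using k c_eq by (intro sum.neutral) auto
        finally show "(\<Sum>l<K. B $$ (i, k) * (c k l * e l t)) = B $$ (i, k) * h k t"
          by (simp add: sum_distrib_left)
      qed
      finally show ?thesis
        using True t B f[OF t] u[OF t]
        by (simp add: data_mat_def joint_vec_def X mat_of_cols_def hU hF scalar_prod_def
          atLeast0LessThan add.commute)
    next
      case False
      then obtain k where k: "i = p + k" "k < K" using i
        by (metis add_less_cancel_left le_Suc_ex not_less)
      have "(\<Sum>r<p. N $$ (i, r) * e (K + r) t) + (\<Sum>l<K. N $$ (i, p + l) * e l t) = (\<Sum>l<K. c k l * e l t)"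
        using k by (simp add: N_def L_def M_def G_def)
      also have "\<dots> = h k t"
      proof -
        have "h k t = (\<Sum>l<K. c k l * e l t) + (\<Sum>r<p. c k (K + r) * e (K + r) t)"
          using k by (subst row_expansion) (auto simp: split2)
        also have "(\<Sum>r<p. c k (K + r) * e (K + r) t) = 0"
          using k c_eq by (intro sum.neutral) auto
        finally show ?thesis by simp
      qed
      finally show ?thesis
        using k t B f[OF t] u[OF t]
        by (simp add: data_mat_def joint_vec_def X mat_of_cols_def hF)
    qed
    finally show "?Y $$ (i, t) = (N * E) $$ (i, t)" ..
  qed (use Nc Ec Yc in auto)
  have EE: "E * transpose_mat E = 1\<^sub>m (p + K)"
  proof (rule eq_matI)
    fix r s assume "r < dim_row (1\<^sub>m (p + K) :: real mat)" "s < dim_col (1\<^sub>m (p + K) :: real mat)"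
    then have rs: "r < p + K" "s < p + K" by auto
    define a where "a r = (if r < p then K + r else r - p)" for r
    have a: "a r < K + p" "a s < K + p" "a r = a s \<longleftrightarrow> r = s" using rs by (auto simp: a_def)
    have "(E * transpose_mat E) $$ (r, s) = (\<Sum>t<T. e (a r) t * e (a s) t)"
      using rs Ec by (auto simp: scalar_prod_def E_def a_def atLeast0LessThan intro!: sum.cong)
    also have "\<dots> = of_bool (r = s)" using ip_e[OF a(1,2)] a(3) by (simp add: ip_def)
    finally show "(E * transpose_mat E) $$ (r, s) = 1\<^sub>m (p + K) $$ (r, s)" using rs by simp
  qed (use Ec in auto)
  have YY: "?Y * transpose_mat ?Y = N * transpose_mat N"
  proof -
    have "transpose_mat ?Y = transpose_mat E * transpose_mat N" unfolding Y
      by (rule transpose_mult[OF Nc Ec])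
    then have "?Y * transpose_mat ?Y = N * E * (transpose_mat E * transpose_mat N)" using Y by simp
    also have "\<dots> = N * (E * (transpose_mat E * transpose_mat N))"
      using Nc Ec by (intro assoc_mult_mat[of _ "p + K" "p + K" _ T]) auto
    also have "E * (transpose_mat E * transpose_mat N) = E * transpose_mat E * transpose_mat N"
      using Nc Ec by (intro assoc_mult_mat[symmetric, of _ "p + K" T _ "p + K"]) auto
    also have "\<dots> = transpose_mat N" unfolding EE using Nc by auto
    finally show ?thesis .
  qed
  \<comment> \<open>If T = 0, the factor 1 / T is 0, but then K + p = 0 and the matrices are
    empty.\<close>
  have "K + p \<le> T" using orthonormal_le_card[OF _ e_orthonormal] by simp
  then have TS: "real T \<cdot>\<^sub>m sample_cov (p + K) T (joint_vec X f) \<omega> = N * transpose_mat N"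
    unfolding sample_cov_def YY using Nc by (intro eq_matI) auto
  have Lii: "L $$ (i, i) = sqrt (rss {..<T} h (K + i) (h (K + i)))" if "i < p" for i
    using that c_eq[of "K + i" "K + i"] by (simp add: L_def)
  have Lt: "L $$ (i, j) = 0" if "i < j" "j < p" for i j
    using that c_eq[of "K + i" "K + j"] by (simp add: L_def)
  have dL: "det L = (\<Prod>i<p. sqrt (rss {..<T} h (K + i) (h (K + i))))"
    using det_lower_triangular_prod[OF Lt Lc] Lii by simp
  have "det L \<noteq> 0" unfolding dL using rss_pos by (auto simp: less_imp_neq[symmetric])
  then obtain Li where Li: "Li \<in> carrier_mat p p" "Li * L = 1\<^sub>m p" using inverse_of_det_nonzero[OF Lc]
    by blast
  have Gt: "G $$ (i, j) = 0" if "i < j" "j < K" for i j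
    using that c_eq[of i j] by (simp add: G_def)
  have "det G = (\<Prod>i<K. sqrt (rss {..<T} h i (h i)))"
    using det_lower_triangular_prod[OF Gt Gc] c_eq by (simp add: G_def)
  then have "det G \<noteq> 0" using rss_pos by (auto simp: less_imp_neq[symmetric])
  then obtain Gi where Gi: "Gi \<in> carrier_mat K K" "Gi * G = 1\<^sub>m K" using inverse_of_det_nonzero[OF Gc]
    by blast
  have W: "W = L * transpose_mat L"
    unfolding W_def V11_inv_def V_mat_def TS
    by (rule mat_inv_upper_left_block_gram[OF Lc Li Gc Gi Mc N_def])
  show "W \<in> carrier_mat p p" unfolding W using Lc by auto
  \<comment> \<open>Row i of L contains the coordinates of error row i from K on, so its squared
    length is the squared distance to the factor span alone.\<close>
  show "W $$ (i, i) = rss {..<T} h K (h (K + i))" if i: "i < p" for i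
  proof -
    have "W $$ (i, i) = (\<Sum>l<p. (c (K + i) (K + l))\<^sup>2)"
      unfolding W using i by (simp add: L_def scalar_prod_def atLeast0LessThan power2_eq_square)
    also have "\<dots> = (\<Sum>l\<in>{K..<K + p}. (c (K + i) l)\<^sup>2)"
      by (rule sum.reindex_bij_witness[of _ "\<lambda>l. l - K" "\<lambda>l. K + l"]) auto
    finally show ?thesis using rss_eq_tail[of "K + i" K] i by simp
  qed
  have "det W = det L * det L" unfolding W using det_mult[OF Lc transpose_carrier_mat[THEN iffD2, OF
    Lc]] det_transpose[OF Lc] by simp
  also have "\<dots> = (\<Prod>i<p. rss {..<T} h (K + i) (h (K + i)))"
    unfolding dL prod.distrib[symmetric] using rss_pos by (intro prod.cong) (auto simp: less_imp_le)
  finally show "det W = (\<Prod>i<p. rss {..<T} h (K + i) (h (K + i)))" .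
qed

section \<open>The Gaussian factor model\<close>

lemma positive_definite_diag:
  assumes "positive_definite_mat k A" "i < k"
  shows "0 < A $$ (i, i)"
proof -
  have A: "A \<in> carrier_mat k k" using assms by (simp add: positive_definite_mat_def)
  have "unit_vec k i \<noteq> (0\<^sub>v k :: real Matrix.vec)" using assms(2)
    by (auto simp: unit_vec_def vec_eq_iff)
  then have "0 < unit_vec k i \<bullet> (A *\<^sub>v unit_vec k i)"
    using assms by (simp add: positive_definite_mat_def)
  also have "unit_vec k i \<bullet> (A *\<^sub>v unit_vec k i) = A $$ (i, i)" using assms(2) A by simp
  finally show ?thesis .
qed

lemma positive_definite_kernel:
  assumes A: "positive_definite_mat k A" and z: "\<And>i. i < k \<Longrightarrow> (\<Sum>j<k. A $$ (i, j) * v j) = 0"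
    and i: "i < k"
  shows "v i = 0"
proof (rule ccontr)
  assume "v i \<noteq> 0"
  let ?v = "Matrix.vec k v"
  have Ac: "A \<in> carrier_mat k k" using A by (simp add: positive_definite_mat_def)
  have "?v \<noteq> 0\<^sub>v k" using \<open>v i \<noteq> 0\<close> i by (auto simp: vec_eq_iff)
  then have "0 < ?v \<bullet> (A *\<^sub>v ?v)" using A by (simp add: positive_definite_mat_def)
  moreover have "A *\<^sub>v ?v = 0\<^sub>v k"
    using z Ac by (intro eq_vecI) (auto simp: scalar_prod_def atLeast0LessThan)
  ultimately show False by simp
qed

lemma mvn_density_diagonal:
  assumes S: "S \<in> carrier_mat k k" and diag: "\<And>i j. i < k \<Longrightarrow> j < k \<Longrightarrow> i \<noteq> j \<Longrightarrow> S $$ (i, j) = 0"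
    and \<sigma>: "\<And>i. i < k \<Longrightarrow> S $$ (i, i) = (\<sigma> i)\<^sup>2" "\<And>i. \<sigma> i > 0"
  shows "mvn_density k (0\<^sub>v k) S (Matrix.vec k x) = (\<Prod>i<k. normal_density 0 (\<sigma> i) (x i))"
proof -
  have Sd: "S = mat_diag k (\<lambda>i. (\<sigma> i)\<^sup>2)"
    using S diag \<sigma> by (intro eq_matI) (auto simp: mat_diag_def)
  have inv: "mat_inv S = mat_diag k (\<lambda>i. 1 / (\<sigma> i)\<^sup>2)"
  proof (rule mat_inv_eqI[OF S])
    have "(\<lambda>i. (\<sigma> i)\<^sup>2 * (1 / (\<sigma> i)\<^sup>2)) = (\<lambda>i. 1)" using \<sigma>(2) by (auto simp: less_imp_neq[symmetric])
    then show "S * mat_diag k (\<lambda>i. 1 / (\<sigma> i)\<^sup>2) = 1\<^sub>m k" unfolding Sd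
      by (simp only: mat_diag_diag mat_diag_one)
  qed simp
  have det: "det S = (\<Prod>i<k. (\<sigma> i)\<^sup>2)"
    using det_lower_triangular_prod[of k S] S diag \<sigma> by simp
  have diag_mult: "(mat_diag k d *\<^sub>v Matrix.vec k x) $ i = d i * x i" if "i < k" for d i
    using that by (simp add: mat_diag_def scalar_prod_def if_distrib[of "\<lambda>a. a * _"] atLeast0LessThan
      sum.delta cong: if_cong)
  have x0: "Matrix.vec k x - 0\<^sub>v k = Matrix.vec k x" by (intro eq_vecI) auto
  have q: "Matrix.vec k x \<bullet> (mat_inv S *\<^sub>v Matrix.vec k x) = (\<Sum>i<k. (x i)\<^sup>2 / (\<sigma> i)\<^sup>2)"
  proof -
    have "mat_inv S *\<^sub>v Matrix.vec k x = Matrix.vec k (\<lambda>i. 1 / (\<sigma> i)\<^sup>2 * x i)"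
      unfolding inv by (rule eq_vecI) (simp_all add: diag_mult del: index_mult_mat_vec, simp add:
        mat_diag_def)
    then show ?thesis by (simp add: scalar_prod_def atLeast0LessThan power2_eq_square)
  qed
  have n: "sqrt ((2 * pi) ^ k * det S) = (\<Prod>i<k. sqrt (2 * pi * (\<sigma> i)\<^sup>2))"
  proof -
    have "(2 * pi) ^ k * det S = (\<Prod>i<k. 2 * pi * (\<sigma> i)\<^sup>2)" unfolding det by (simp add: prod.distrib)
    moreover have "sqrt (\<Prod>i<n. g i) = (\<Prod>i<n. sqrt (g i))" for g :: "nat \<Rightarrow> real" and n :: nat
      by (induction n) (simp_all add: real_sqrt_mult)
    ultimately show ?thesis by simp
  qed
  have "mvn_density k (0\<^sub>v k) S (Matrix.vec k x) = exp (\<Sum>i<k. - (x i)\<^sup>2 / (2 * (\<sigma> i)\<^sup>2)) / (\<Prod>i<k. sqrt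
    (2 * pi * (\<sigma> i)\<^sup>2))"
  proof -
    have "- (\<Sum>i<k. (x i)\<^sup>2 / (\<sigma> i)\<^sup>2) / 2 = (\<Sum>i<k. - (x i)\<^sup>2 / (2 * (\<sigma> i)\<^sup>2))"
      unfolding sum_negf[symmetric] sum_divide_distrib by (intro sum.cong refl) simp
    then show ?thesis unfolding mvn_density_def x0 q n by simp
  qed
  also have "\<dots> = (\<Prod>i<k. normal_density 0 (\<sigma> i) (x i))"
  proof -
    have "(\<Prod>i<k. normal_density 0 (\<sigma> i) (x i)) = (\<Prod>i<k. exp (- (x i)\<^sup>2 / (2 * (\<sigma> i)\<^sup>2)) / sqrt (2 * pi
      * (\<sigma> i)\<^sup>2))"
      by (intro prod.cong refl) (simp add: normal_density_def)
    then show ?thesis unfolding prod_dividef exp_sum[OF finite_lessThan] by simp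
  qed
  finally show ?thesis .
qed

lemma sets_PiM_lborel: "sets (PiM I (\<lambda>_. lborel :: real measure)) = sets (PiM I (\<lambda>_. borel))"
  by (intro sets_PiM_cong) auto

lemma integral_linear_combination:
  fixes g :: "nat \<Rightarrow> 'a \<Rightarrow> real"
  assumes "\<And>k. k < n \<Longrightarrow> integrable M (g k)" "integrable M h"
  shows "integrable M (\<lambda>\<omega>. (\<Sum>k<n. a k * g k \<omega>) + h \<omega>)"
    and "(\<integral>\<omega>. (\<Sum>k<n. a k * g k \<omega>) + h \<omega> \<partial>M) = (\<Sum>k<n. a k * (\<integral>\<omega>. g k \<omega> \<partial>M)) + (\<integral>\<omega>. h \<omega> \<partial>M)"
proof -
  have 1: "integrable M (\<lambda>\<omega>. a k * g k \<omega>)" if "k \<in> {..<n}" for k using assms(1) that by simp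
  show "integrable M (\<lambda>\<omega>. (\<Sum>k<n. a k * g k \<omega>) + h \<omega>)"
    by (intro Bochner_Integration.integrable_add Bochner_Integration.integrable_sum 1 assms(2))
  show "(\<integral>\<omega>. (\<Sum>k<n. a k * g k \<omega>) + h \<omega> \<partial>M) = (\<Sum>k<n. a k * (\<integral>\<omega>. g k \<omega> \<partial>M)) + (\<integral>\<omega>. h \<omega> \<partial>M)"
  proof -
    have "(\<integral>\<omega>. (\<Sum>k<n. a k * g k \<omega>) + h \<omega> \<partial>M) = (\<integral>\<omega>. (\<Sum>k<n. a k * g k \<omega>) \<partial>M) + (\<integral>\<omega>. h \<omega> \<partial>M)"
      by (intro Bochner_Integration.integral_add Bochner_Integration.integrable_sum 1 assms(2))
    also have "(\<integral>\<omega>. (\<Sum>k<n. a k * g k \<omega>) \<partial>M) = (\<Sum>k<n. \<integral>\<omega>. a k * g k \<omega> \<partial>M)"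
      by (intro Bochner_Integration.integral_sum 1)
    finally show ?thesis by simp
  qed
qed

section \<open>Second moments of the model and the null hypothesis\<close>

context gaussian_factor_model
begin

lemma factor_dim: "t < T \<Longrightarrow> \<omega> \<in> space M \<Longrightarrow> f t \<omega> \<in> carrier_vec K"
  using factor_normal by (auto simp: normal_vector_def)

lemma error_dim: "t < T \<Longrightarrow> \<omega> \<in> space M \<Longrightarrow> u t \<omega> \<in> carrier_vec p"
  using error_normal by (auto simp: normal_vector_def)

lemma coords_factor_measurable: "t < T \<Longrightarrow> coords K (f t) \<in> measurable M (coord_space K)"
  using factor_normal[of t] distributed_measurable
  by (fastforce simp: normal_vector_def measurable_cong_sets[OF refl sets_PiM_lborel])

lemma coords_error_measurable: "t < T \<Longrightarrow> coords p (u t) \<in> measurable M (coord_space p)"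
  using error_normal[of t] distributed_measurable
  by (fastforce simp: normal_vector_def measurable_cong_sets[OF refl sets_PiM_lborel])

lemma factor_measurable: "t < T \<Longrightarrow> k < K \<Longrightarrow> (\<lambda>\<omega>. f t \<omega> $ k) \<in> borel_measurable M"
  using measurable_compose[OF coords_factor_measurable measurable_component_singleton[of k]]
  by (simp add: coords_def)

lemma error_measurable: "t < T \<Longrightarrow> i < p \<Longrightarrow> (\<lambda>\<omega>. u t \<omega> $ i) \<in> borel_measurable M"
  using measurable_compose[OF coords_error_measurable measurable_component_singleton[of i]]
  by (simp add: coords_def)

lemma factor_moment: "t < T \<Longrightarrow> k < K \<Longrightarrow> l < K \<Longrightarrow> (\<integral>\<omega>. f t \<omega> $ k * f t \<omega> $ l \<partial>M) = \<Sigma>f $$ (k, l)"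
  using factor_cov[of t] factor_mean[of t] by (auto simp: cov_mat_def)

lemma error_moment: "t < T \<Longrightarrow> i < p \<Longrightarrow> j < p \<Longrightarrow> (\<integral>\<omega>. u t \<omega> $ i * u t \<omega> $ j \<partial>M) = \<Sigma>u $$ (i, j)"
  using error_cov[of t] error_mean[of t] by (auto simp: cov_mat_def)

lemma factor_expectation: "t < T \<Longrightarrow> k < K \<Longrightarrow> (\<integral>\<omega>. f t \<omega> $ k \<partial>M) = 0"
  using factor_mean[of t] by (auto simp: mean_vec_def vec_eq_iff)

lemma error_expectation: "t < T \<Longrightarrow> i < p \<Longrightarrow> (\<integral>\<omega>. u t \<omega> $ i \<partial>M) = 0"
  using error_mean[of t] by (auto simp: mean_vec_def vec_eq_iff)

text \<open>A non-integrable function has integral 0, so a positive second moment is genuine.\<close>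

lemma factor_square_integrable: "t < T \<Longrightarrow> k < K \<Longrightarrow> integrable M (\<lambda>\<omega>. (f t \<omega> $ k)\<^sup>2)"
  using factor_moment[of t k k] positive_definite_diag[OF factor_cov_pos, of k]
    not_integrable_integral_eq
  by (fastforce simp: power2_eq_square)

lemma error_square_integrable: "t < T \<Longrightarrow> i < p \<Longrightarrow> integrable M (\<lambda>\<omega>. (u t \<omega> $ i)\<^sup>2)"
  using error_moment[of t i i] positive_definite_diag[OF error_cov_pos, of i] not_integrable_integral_eq
  by (fastforce simp: power2_eq_square)

lemma integrable_product_of_squares:
  assumes [measurable]: "X1 \<in> borel_measurable M" "X2 \<in> borel_measurable M"
    and "integrable M (\<lambda>\<omega>. (X1 \<omega>)\<^sup>2)" "integrable M (\<lambda>\<omega>. (X2 \<omega>)\<^sup>2)"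
  shows "integrable M (\<lambda>\<omega>. X1 \<omega> * X2 \<omega> :: real)"
proof (rule Bochner_Integration.integrable_bound)
  show "integrable M (\<lambda>\<omega>. (X1 \<omega>)\<^sup>2 + (X2 \<omega>)\<^sup>2)" using assms by simp
  have "\<bar>a * b\<bar> \<le> a\<^sup>2 + b\<^sup>2" for a b :: real
  proof -
    have "2 * (\<bar>a\<bar> * \<bar>b\<bar>) \<le> \<bar>a\<bar>\<^sup>2 + \<bar>b\<bar>\<^sup>2" using sum_squares_bound[of "\<bar>a\<bar>" "\<bar>b\<bar>"] by simp
    moreover have "0 \<le> \<bar>a\<bar> * \<bar>b\<bar>" by simp
    ultimately show ?thesis unfolding abs_mult power2_abs by linarith
  qed
  then show "AE \<omega> in M. norm (X1 \<omega> * X2 \<omega>) \<le> norm ((X1 \<omega>)\<^sup>2 + (X2 \<omega>)\<^sup>2)" by (intro AE_I2) simp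
qed measurable

lemma factor_error_uncorrelated:
  assumes t: "t < T" and k: "k < K" and i: "i < p"
  shows "(\<integral>\<omega>. f t \<omega> $ k * u t \<omega> $ i \<partial>M) = 0"
proof -
  have "indep_var borel ((\<lambda>x. x t k) \<circ> (\<lambda>\<omega>. \<lambda>t\<in>{..<T}. coords K (f t) \<omega>)) borel ((\<lambda>x. x t i) \<circ> (\<lambda>\<omega>.
    \<lambda>t\<in>{..<T}. coords p (u t) \<omega>))"
    using t k i measurable_nested_component[of t "{..<T}" k "{..<K}" "\<lambda>_ _. borel"]
      measurable_nested_component[of t "{..<T}" i "{..<p}" "\<lambda>_ _. borel"]
    by (intro indep_var_compose[OF factor_error_indep]) auto
  then have "indep_var borel (\<lambda>\<omega>. f t \<omega> $ k) borel (\<lambda>\<omega>. u t \<omega> $ i)"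
    using t k i by (simp add: comp_def coords_def)
  moreover have "integrable M (\<lambda>\<omega>. f t \<omega> $ k)" "integrable M (\<lambda>\<omega>. u t \<omega> $ i)"
    using factor_square_integrable[OF t k] factor_measurable[OF t k] error_square_integrable[OF t i]
      error_measurable[OF t i]
    by (auto intro: square_integrable_imp_integrable)
  ultimately show ?thesis
    using factor_expectation[OF t k] by (simp add: indep_var_lebesgue_integral)
qed

lemma joint_vec_coordinate:
  assumes "t < T" "\<omega> \<in> space M" "r < p + K"
  shows "joint_vec X f t \<omega> $ r = (if r < p then (\<Sum>k<K. B $$ (r, k) * f t \<omega> $ k)
    + u t \<omega> $ r else f t \<omega> $ (r - p))"
proof -
  have d: "f t \<omega> \<in> carrier_vec K" "u t \<omega> \<in> carrier_vec p" using assms factor_dim error_dim by auto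
  then have "dim_vec (X t \<omega>) = p" using model[OF assms(1,2)] loadings by simp
  then show ?thesis using assms d loadings model[OF assms(1,2)]
    by (simp add: joint_vec_def scalar_prod_def atLeast0LessThan)
qed

text \<open>In the joint covariance, the rows of X are B times the rows of f plus the error
  covariance padded by zeros. This row relation identifies the upper-left block of the inverse
  without blockwise inversion.\<close>

lemma joint_cov_entries:
  assumes t: "t < T"
  defines "C \<equiv> cov_mat M (p + K) (joint_vec X f t)"
  shows "\<And>k l. k < K \<Longrightarrow> l < K \<Longrightarrow> C $$ (p + k, p + l) = \<Sigma>f $$ (k, l)"
    and "\<And>r s. r < p \<Longrightarrow> s < p + K \<Longrightarrow>
      C $$ (r, s) = (\<Sum>k<K. B $$ (r, k) * C $$ (p + k, s)) + (if s < p then \<Sigma>u $$ (r, s) else 0)"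
proof -
  let ?Y = "\<lambda>r \<omega>. joint_vec X f t \<omega> $ r"
  \<comment> \<open>Explicit coordinates of the joint vector; the model equation holds on
    \<open>space M\<close>, which is enough to rewrite the integrals.\<close>
  define Z where "Z r \<omega> = (if r < p then (\<Sum>k<K. B $$ (r, k) * f t \<omega> $ k)
    + u t \<omega> $ r else f t \<omega> $ (r - p))" for r \<omega>
  have YZ: "?Y r \<omega> = Z r \<omega>" if "\<omega> \<in> space M" "r < p + K" for r \<omega>
    unfolding Z_def using joint_vec_coordinate[OF t that] .
  note fm = factor_measurable[OF t] and um = error_measurable[OF t]
  have fi: "integrable M (\<lambda>\<omega>. f t \<omega> $ k)" if "k < K" for k
    using factor_square_integrable[OF t that] fm[OF that]
      by (rule square_integrable_imp_integrable[rotated])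
  have ui: "integrable M (\<lambda>\<omega>. u t \<omega> $ i)" if "i < p" for i
    using error_square_integrable[OF t that] um[OF that]
      by (rule square_integrable_imp_integrable[rotated])
  have ff: "integrable M (\<lambda>\<omega>. f t \<omega> $ k * f t \<omega> $ l)" if "k < K" "l < K" for k l
    using that by (intro integrable_product_of_squares fm factor_square_integrable[OF t])
  have uu: "integrable M (\<lambda>\<omega>. u t \<omega> $ i * u t \<omega> $ j)" if "i < p" "j < p" for i j
    using that by (intro integrable_product_of_squares um error_square_integrable[OF t])
  have fu: "integrable M (\<lambda>\<omega>. f t \<omega> $ k * u t \<omega> $ i)" if "k < K" "i < p" for k i
    using that by (intro integrable_product_of_squares um fm error_square_integrable[OF t]
      factor_square_integrable[OF t])
  have EZ: "(\<integral>\<omega>. Z r \<omega> \<partial>M) = 0" if "r < p + K" for r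
  proof (cases "r < p")
    case True
    then show ?thesis
      using integral_linear_combination(2)[where n = K and a
        = "\<lambda>k. B $$ (r, k)", OF fi ui[OF True]] factor_expectation[OF t] error_expectation[OF t]
      by (simp add: Z_def)
  next
    case False
    then show ?thesis using that factor_expectation[OF t, of "r - p"] by (simp add: Z_def)
  qed
  have mean: "mean_vec M (p + K) (joint_vec X f t) $ r = 0" if "r < p + K" for r
  proof -
    have "(\<integral>\<omega>. ?Y r \<omega> \<partial>M) = (\<integral>\<omega>. Z r \<omega> \<partial>M)" using that by (intro Bochner_Integration.integral_cong
      refl YZ)
    then show ?thesis using that EZ[OF that] by (simp add: mean_vec_def)
  qed
  have C: "C $$ (r, s) = (\<integral>\<omega>. Z r \<omega> * Z s \<omega> \<partial>M)" if "r < p + K" "s < p + K" for r s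
  proof -
    have "(\<integral>\<omega>. ?Y r \<omega> * ?Y s \<omega> \<partial>M) = (\<integral>\<omega>. Z r \<omega> * Z s \<omega> \<partial>M)"
      using that by (intro Bochner_Integration.integral_cong refl) (simp add: YZ)
    then show ?thesis using that by (simp add: C_def cov_mat_def mean)
  qed
  have fZ: "integrable M (\<lambda>\<omega>. f t \<omega> $ k * Z s \<omega>)" if "k < K" "s < p + K" for k s
  proof (cases "s < p")
    case True
    have "(\<lambda>\<omega>. f t \<omega> $ k * Z s \<omega>) = (\<lambda>\<omega>. (\<Sum>l<K. B $$ (s, l) * (f t \<omega> $ k * f t \<omega> $ l))
      + f t \<omega> $ k * u t \<omega> $ s)"
      using True by (auto simp: Z_def distrib_left sum_distrib_left mult_ac)
    then show ?thesis
      using integral_linear_combination(1)[where n = K and a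
        = "\<lambda>l. B $$ (s, l)", OF ff[OF that(1)] fu[OF that(1) True]] by simp
  next
    case False
    then show ?thesis using ff that by (simp add: Z_def)
  qed
  have uZ: "integrable M (\<lambda>\<omega>. u t \<omega> $ i * Z s \<omega>) \<and> (\<integral>\<omega>. u t \<omega> $ i * Z s \<omega> \<partial>M)
    = (if s < p then \<Sigma>u $$ (i, s) else 0)"
    if "i < p" "s < p + K" for i s
  proof (cases "s < p")
    case True
    have "(\<lambda>\<omega>. u t \<omega> $ i * Z s \<omega>) = (\<lambda>\<omega>. (\<Sum>l<K. B $$ (s, l) * (f t \<omega> $ l * u t \<omega> $ i))
      + u t \<omega> $ i * u t \<omega> $ s)"
      using True by (auto simp: Z_def distrib_left sum_distrib_left mult_ac)
    then show ?thesis
      using integral_linear_combination[where n = K and a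
        = "\<lambda>l. B $$ (s, l)", OF fu[OF _ that(1)] uu[OF that(1) True]]
        factor_error_uncorrelated[OF t] error_moment[OF t] that True by simp
  next
    case False
    then show ?thesis using fu[of "s - p" i] that factor_error_uncorrelated[OF t, of "s - p" i]
      by (simp add: Z_def mult.commute)
  qed
  show "C $$ (p + k, p + l) = \<Sigma>f $$ (k, l)" if "k < K" "l < K" for k l
    using that factor_moment[OF t that] by (simp add: C Z_def)
  show "C $$ (r, s) = (\<Sum>k<K. B $$ (r, k) * C $$ (p + k, s)) + (if s < p then \<Sigma>u $$ (r, s) else 0)"
    if r: "r < p" and s: "s < p + K" for r s
  proof -
    have "C $$ (r, s) = (\<integral>\<omega>. Z r \<omega> * Z s \<omega> \<partial>M)" using r s by (intro C) auto
    also have "\<dots> = (\<integral>\<omega>. (\<Sum>k<K. B $$ (r, k) * (f t \<omega> $ k * Z s \<omega>)) + u t \<omega> $ r * Z s \<omega> \<partial>M)"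
      using r by (simp add: Z_def[of r] distrib_right sum_distrib_right mult.assoc)
    also have "\<dots> = (\<Sum>k<K. B $$ (r, k) * (\<integral>\<omega>. f t \<omega> $ k * Z s \<omega> \<partial>M)) + (\<integral>\<omega>. u t \<omega> $ r * Z s \<omega> \<partial>M)"
      using uZ[OF r s] by (intro integral_linear_combination(2) fZ s) auto
    also have "(\<Sum>k<K. B $$ (r, k) * (\<integral>\<omega>. f t \<omega> $ k * Z s \<omega> \<partial>M)) = (\<Sum>k<K. B $$ (r, k) * C $$ (p + k, s))"
      using s by (intro sum.cong refl) (simp add: C Z_def[of "p + _"])
    finally show ?thesis using uZ[OF r s] by simp
  qed
qed

text \<open>Applied to the columns of the inverse V, the row relation leaves the identity \<Sigma>u
  V11 = 1. A diagonal V11 therefore forces a diagonal \<Sigma>u, and for normal errors this means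
  independent coordinates.\<close>

lemma error_cov_diagonal:
  assumes t: "t < T" and \<Omega>: "\<Omega> = precision_mat M (p + K) (joint_vec X f t)"
    and diag: "diagonal_mat (upper_left_block p \<Omega>)" and ij: "i < p" "j < p" "i \<noteq> j"
  shows "\<Sigma>u $$ (i, j) = 0"
proof -
  let ?n = "p + K"
  define C where "C = cov_mat M ?n (joint_vec X f t)"
  have Cc: "C \<in> carrier_mat ?n ?n" by (simp add: C_def cov_mat_def)
  note e = joint_cov_entries[OF t, folded C_def]
  have split: "(\<Sum>s<?n. g s) = (\<Sum>s<p. g s) + (\<Sum>l<K. g (p + l))" for g :: "nat \<Rightarrow> real"
    by (induction K) auto
  have top: "(\<Sum>s<?n. C $$ (r, s) * v s) = (\<Sum>k<K. B $$ (r, k) * (\<Sum>s<?n. C $$ (p + k, s) * v s))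
    + (\<Sum>s<p. \<Sigma>u $$ (r, s) * v s)"
    if "r < p" for r v
  proof -
    have "(\<Sum>s<?n. C $$ (r, s) * v s) = (\<Sum>s<?n. (\<Sum>k<K. B $$ (r, k) * (C $$ (p + k, s) * v s))
      + (if s < p then \<Sigma>u $$ (r, s) else 0) * v s)"
      using that by (intro sum.cong refl, subst e(2)) (auto simp: distrib_right sum_distrib_right
        mult.assoc)
    also have "\<dots> = (\<Sum>k<K. B $$ (r, k) * (\<Sum>s<?n. C $$ (p + k, s) * v s))
      + (\<Sum>s<?n. (if s < p then \<Sigma>u $$ (r, s) else 0) * v s)"
      by (simp add: sum.distrib sum_distrib_left) (rule sum.swap)
    also have "(\<Sum>s<?n. (if s < p then \<Sigma>u $$ (r, s) else 0) * v s) = (\<Sum>s<p. \<Sigma>u $$ (r, s) * v s)"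
      unfolding split by simp
    finally show ?thesis .
  qed
  \<comment> \<open>By \<open>top\<close>, the upper part of a kernel vector lies in the kernel of
    \<Sigma>u and is 0; its lower part is then in the kernel of \<Sigma>f.\<close>
  have "det C \<noteq> 0"
  proof
    assume "det C = 0"
    then obtain w where w: "w \<in> carrier_vec ?n" "w \<noteq> 0\<^sub>v ?n" "C *\<^sub>v w = 0\<^sub>v ?n"
      using det_0_iff_vec_prod_zero_field[OF Cc] by blast
    define v where "v s = w $ s" for s
    have z: "(\<Sum>s<?n. C $$ (r, s) * v s) = 0" if "r < ?n" for r
    proof -
      have "(\<Sum>s<?n. C $$ (r, s) * v s) = (C *\<^sub>v w) $ r"
        using that w(1) Cc by (simp add: scalar_prod_def v_def atLeast0LessThan)
      then show ?thesis unfolding w(3) using that by simp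
    qed
    have "(\<Sum>s<p. \<Sigma>u $$ (r, s) * v s) = 0" if "r < p" for r
      using top[OF that, of v] z that by simp
    from positive_definite_kernel[OF error_cov_pos this] have v1: "v s = 0" if "s < p" for s
      using that by blast
    have "(\<Sum>l<K. \<Sigma>f $$ (k, l) * v (p + l)) = 0" if "k < K" for k
      using z[of "p + k"] that v1 e(1) unfolding split by simp
    then have v2: "v (p + l) = 0" if "l < K" for l
      using positive_definite_kernel[OF factor_cov_pos, of "\<lambda>l. v (p + l)" l] that by blast
    have "w $ s = 0" if "s < ?n" for s
      using v1[of s] v2[of "s - p"] that by (cases "s < p") (auto simp: v_def)
    then have "w = 0\<^sub>v ?n" using w(1) by (intro eq_vecI) auto
    with w(2) show False by simp
  qed
  then obtain V where V: "V \<in> carrier_mat ?n ?n" "C * V = 1\<^sub>m ?n" using inverse_of_det_nonzero[OF Cc]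
    by blast
  have \<Omega>V: "\<Omega> = V" unfolding \<Omega> precision_mat_def C_def[symmetric] by (rule mat_inv_eqI[OF Cc V])
  have CV: "(\<Sum>s<?n. C $$ (r, s) * V $$ (s, q)) = of_bool (r = q)" if "r < ?n" "q < ?n" for r q
  proof -
    have "(\<Sum>s<?n. C $$ (r, s) * V $$ (s, q)) = (C * V) $$ (r, q)"
      using that Cc V(1) by (simp add: scalar_prod_def atLeast0LessThan)
    then show ?thesis unfolding V(2) using that by simp
  qed
  \<comment> \<open>In a column q < p the rows p + k of the product C V are 0, so the loadings term
    disappears.\<close>
  have SV: "(\<Sum>s<p. \<Sigma>u $$ (r, s) * V $$ (s, q)) = of_bool (r = q)" if "r < p" "q < p" for r q
    using top[OF that(1), of "\<lambda>s. V $$ (s, q)"] CV that by simp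
  have Vd: "V $$ (s, q) = 0" if "s < p" "q < p" "s \<noteq> q" for s q
    using diag that unfolding \<Omega>V diagonal_mat_def by (auto simp: upper_left_block_def)
  have one: "\<Sigma>u $$ (r, q) * V $$ (q, q) = of_bool (r = q)" if "r < p" "q < p" for r q
  proof -
    have "(\<Sum>s<p. \<Sigma>u $$ (r, s) * V $$ (s, q)) = (\<Sum>s<p. if s = q then \<Sigma>u $$ (r, q) * V $$ (q, q) else 0)"
      using that Vd by (intro sum.cong) auto
    then show ?thesis using SV[OF that] that by simp
  qed
  \<comment> \<open>The pair (j, j) shows that \<open>V $$ (j, j)\<close> is nonzero, and the pair
    (i, j) then makes the covariance vanish.\<close>
  show ?thesis using one[OF ij(1,2)] one[OF ij(2,2)] ij(3) by auto
qed

end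

section \<open>Measurability of the statistic\<close>

lemma measurable_det:
  assumes "\<And>\<omega>. \<omega> \<in> space M \<Longrightarrow> A \<omega> \<in> carrier_mat n n"
    and m: "\<And>i j. i < n \<Longrightarrow> j < n \<Longrightarrow> (\<lambda>\<omega>. A \<omega> $$ (i, j)) \<in> borel_measurable M"
  shows "(\<lambda>\<omega>. det (A \<omega>) :: real) \<in> borel_measurable M"
proof -
  have "(\<lambda>\<omega>. \<Sum>\<pi> \<in> {\<pi>. \<pi> permutes {0..<n}}. signof \<pi> * (\<Prod>i = 0..<n. A \<omega> $$ (i, \<pi> i)))
    \<in> borel_measurable M"
    by (intro borel_measurable_sum borel_measurable_times borel_measurable_const borel_measurable_prod
      m)
       (auto dest: permutes_in_image)
  then show ?thesis
    by (rule measurable_cong[THEN iffD1, rotated]) (simp add: det_def'[OF assms(1)])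
qed

text \<open>The explicit formula needed for measurability: rational in the entries on nonsingular
  matrices, and one fixed value elsewhere.\<close>

lemma mat_inv_cases:
  assumes A: "A \<in> carrier_mat n n"
  shows "mat_inv A = (if det A \<noteq> 0 then (1 / det A) \<cdot>\<^sub>m adj_mat A else the None)"
proof (cases "det A = 0")
  case False
  have "A * ((1 / det A) \<cdot>\<^sub>m adj_mat A) = (1 / det A) \<cdot>\<^sub>m (A * adj_mat A)"
    using A adj_mat(1)[OF A] by (intro mult_smult_distrib) auto
  also have "\<dots> = 1\<^sub>m n" unfolding adj_mat(2)[OF A] using False by (intro eq_matI) auto
  finally show ?thesis using False mat_inv_eqI[OF A] adj_mat(1)[OF A] by simp
next
  case True
  have "mat_inverse A = None"
  proof (cases "mat_inverse A")
    case (Some C)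
    from mat_inverse(2)[OF A this] have "A * C = 1\<^sub>m n" "C \<in> carrier_mat n n" by auto
    then have "det A * det C = 1" using det_mult[OF A] by (metis det_one)
    then show ?thesis using True by simp
  qed
  then show ?thesis using True by (simp add: mat_inv_def)
qed

lemma measurable_mat_inv:
  assumes A: "\<And>\<omega>. \<omega> \<in> space M \<Longrightarrow> A \<omega> \<in> carrier_mat n n"
    and m: "\<And>i j. i < n \<Longrightarrow> j < n \<Longrightarrow> (\<lambda>\<omega>. A \<omega> $$ (i, j)) \<in> borel_measurable M"
  shows "i < n \<Longrightarrow> j < n \<Longrightarrow> (\<lambda>\<omega>. mat_inv (A \<omega>) $$ (i, j)) \<in> borel_measurable M"
    and "(\<lambda>\<omega>. det (mat_inv (A \<omega>))) \<in> borel_measurable M"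
proof -
  have [measurable]: "(\<lambda>\<omega>. det (A \<omega>)) \<in> borel_measurable M" by (rule measurable_det[OF A m])
  show "(\<lambda>\<omega>. mat_inv (A \<omega>) $$ (i, j)) \<in> borel_measurable M" if ij: "i < n" "j < n"
  proof -
    have [measurable]: "(\<lambda>\<omega>. det (mat_delete (A \<omega>) j i)) \<in> borel_measurable M"
    proof (rule measurable_det)
      show "mat_delete (A \<omega>) j i \<in> carrier_mat (n - 1) (n - 1)" if "\<omega> \<in> space M" for \<omega>
        using A[OF that] by (auto simp: mat_delete_def)
      fix i' j' assume ij': "i' < n - 1" "j' < n - 1"
      have "(\<lambda>\<omega>. A \<omega> $$ (if i' < j then i' else Suc i', if j' < i then j' else Suc j'))
        \<in> borel_measurable M"
        using ij' by (intro m) auto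
      then show "(\<lambda>\<omega>. mat_delete (A \<omega>) j i $$ (i', j')) \<in> borel_measurable M"
      proof (rule measurable_cong[THEN iffD1, rotated])
        fix \<omega> assume "\<omega> \<in> space M"
        from carrier_matD[OF A[OF this]]
        show "A \<omega> $$ (if i' < j then i' else Suc i', if j' < i then j' else Suc j')
          = mat_delete (A \<omega>) j i $$ (i', j')"
          using ij' by (simp add: mat_delete_def)
      qed
    qed
    have "(\<lambda>\<omega>. if det (A \<omega>) \<noteq> 0 then (1 / det (A \<omega>)) * ((- 1) ^ (j + i) * det (mat_delete (A \<omega>) j i))
        else (the None :: real Matrix.mat) $$ (i, j)) \<in> borel_measurable M"
      by measurable
    then show ?thesis
    proof (rule measurable_cong[THEN iffD1, rotated])
      fix \<omega> assume "\<omega> \<in> space M"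
      note Aw = A[OF this]
      show "(if det (A \<omega>) \<noteq> 0 then (1 / det (A \<omega>)) * ((- 1) ^ (j + i) * det (mat_delete (A \<omega>) j i))
          else (the None :: real Matrix.mat) $$ (i, j)) = mat_inv (A \<omega>) $$ (i, j)"
        using ij Aw by (simp add: mat_inv_cases[OF Aw] adj_mat_def cofactor_def)
    qed
  qed
  \<comment> \<open>The dimension of \<open>the None\<close> is unknown, so this determinant is not
    derived from the entries of the inverse: it is 1 / det or a constant.\<close>
  have "(\<lambda>\<omega>. if det (A \<omega>) \<noteq> 0 then 1 / det (A \<omega>) else det (the None :: real Matrix.mat))
    \<in> borel_measurable M"
    by measurable
  then show "(\<lambda>\<omega>. det (mat_inv (A \<omega>))) \<in> borel_measurable M"
  proof (rule measurable_cong[THEN iffD1, rotated])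
    fix \<omega> assume "\<omega> \<in> space M"
    note Aw = A[OF this]
    show "(if det (A \<omega>) \<noteq> 0 then 1 / det (A \<omega>) else det (the None :: real Matrix.mat))
      = det (mat_inv (A \<omega>))"
    proof (cases "det (A \<omega>) = 0")
      case False
      obtain Ai where Ai: "Ai \<in> carrier_mat n n" "A \<omega> * Ai = 1\<^sub>m n"
        using inverse_of_det_nonzero[OF Aw False] by blast
      then have "det (A \<omega>) * det Ai = 1" using det_mult[OF Aw Ai(1)] by simp
      then show ?thesis using False mat_inv_eqI[OF Aw Ai] by (simp add: field_simps)
    qed (simp add: mat_inv_cases[OF Aw])
  qed
qed

context gaussian_factor_model
begin

lemma measurable_T_LR: "T_LR p K T (joint_vec X f) \<in> borel_measurable M"
proof -
  let ?n = "p + K"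
  let ?W = "\<lambda>\<omega>. real T \<cdot>\<^sub>m sample_cov ?n T (joint_vec X f) \<omega>"
  have Y: "(\<lambda>\<omega>. joint_vec X f t \<omega> $ r) \<in> borel_measurable M" if t: "t < T" and r: "r < ?n" for t r
  proof -
    have "(\<lambda>\<omega>. if r < p then (\<Sum>k<K. B $$ (r, k) * f t \<omega> $ k) + u t \<omega> $ r else f t \<omega> $ (r - p))
      \<in> borel_measurable M"
    proof (cases "r < p")
      case True
      then show ?thesis using factor_measurable[OF t] error_measurable[OF t True]
        by (auto intro!: borel_measurable_add borel_measurable_sum borel_measurable_times)
    next
      case False
      then show ?thesis using factor_measurable[OF t, of "r - p"] r by simp
    qed
    then show ?thesis
      by (rule measurable_cong[THEN iffD1, rotated]) (use joint_vec_coordinate[OF t _ r] in simp)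
  qed
  have Wc: "?W \<omega> \<in> carrier_mat ?n ?n" for \<omega>
    by (auto simp: sample_cov_def data_mat_def mat_of_cols_def)
  have W: "(\<lambda>\<omega>. ?W \<omega> $$ (i, j)) \<in> borel_measurable M" if "i < ?n" "j < ?n" for i j
  proof -
    have "?W \<omega> $$ (i, j) = real T * (1 / real T * (\<Sum>t<T. joint_vec X f t \<omega> $ i * joint_vec X f t \<omega> $
      j))" for \<omega>
      using that by (simp add: sample_cov_def data_mat_def mat_of_cols_def scalar_prod_def
        atLeast0LessThan)
    moreover have "(\<lambda>\<omega>. real T * (1 / real T * (\<Sum>t<T. joint_vec X f t \<omega> $ i * joint_vec X f t \<omega> $ j)))
      \<in> borel_measurable M"
      using that by (intro borel_measurable_times borel_measurable_const borel_measurable_sum Y) auto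
    ultimately show ?thesis by simp
  qed
  let ?V = "\<lambda>\<omega>. upper_left_block p (V_mat ?n T (joint_vec X f) \<omega>)"
  have Vc: "?V \<omega> \<in> carrier_mat p p" for \<omega> by (simp add: upper_left_block_def)
  have V: "(\<lambda>\<omega>. ?V \<omega> $$ (i, j)) \<in> borel_measurable M" if "i < p" "j < p" for i j
    using measurable_mat_inv(1)[OF Wc W, of i j] that by (simp add: upper_left_block_def V_mat_def)
  have [measurable]: "(\<lambda>\<omega>. V11_inv p K T (joint_vec X f) \<omega> $$ (i, i)) \<in> borel_measurable M" if "i
    \<in> {..<p}" for i
    using measurable_mat_inv(1)[OF Vc V, of i i] that by (simp add: V11_inv_def)
  have [measurable]: "(\<lambda>\<omega>. det (V11_inv p K T (joint_vec X f) \<omega>)) \<in> borel_measurable M"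
    using measurable_mat_inv(2)[OF Vc V] by (simp add: V11_inv_def)
  show ?thesis unfolding T_LR_def[abs_def] by measurable
qed

section \<open>The law of the statistic\<close>

definition rows :: "'a \<Rightarrow> nat \<Rightarrow> nat \<Rightarrow> real" where
  "rows \<omega> k t = (if k < K then f t \<omega> $ k else u t \<omega> $ (k - K))"

text \<open>A density common to all columns is all that is extracted; it suffices for almost sure
  linear independence of the factor rows. By 0 < T there is a column from which its properties can
  be read.\<close>

lemma distr_factors:
  assumes "0 < T"
  obtains \<phi> where "\<phi> \<in> borel_measurable (PiM {..<K} (\<lambda>_. lborel))"
    "prob_space (density (PiM {..<K} (\<lambda>_. lborel)) \<phi>)"
    "distr M (PiM {..<T} (\<lambda>_. coord_space K)) (\<lambda>\<omega>. \<lambda>t\<in>{..<T}. coords K (f t) \<omega>)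
      = PiM {..<T} (\<lambda>_. density (PiM {..<K} (\<lambda>_. lborel)) \<phi>)"
proof -
  let ?L = "PiM {..<K} (\<lambda>_. lborel :: real measure)"
  define \<phi> where "\<phi> x = ennreal (mvn_density K (0\<^sub>v K) \<Sigma>f (Matrix.vec K x))" for x
  have d: "distributed M ?L (coords K (f t)) \<phi>" if "t < T" for t
    using factor_normal[OF that] factor_mean[OF that] factor_cov[OF that]
    by (simp add: normal_vector_def \<phi>_def[abs_def])
  have D: "distr M (coord_space K) (coords K (f t)) = density ?L \<phi>" if "t < T" for t
  proof -
    have "distr M (coord_space K) (coords K (f t)) = distr M ?L (coords K (f t))"
      by (intro distr_cong refl sets_PiM_lborel[symmetric])
    then show ?thesis using distributed_distr_eq_density[OF d[OF that]] by simp
  qed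
  have "prob_space (density ?L \<phi>)"
    unfolding D[OF assms, symmetric] by (rule prob_space_distr[OF coords_factor_measurable[OF assms]])
  moreover have "\<phi> \<in> borel_measurable ?L"
    using distributed_borel_measurable[OF d[OF assms]] .
  moreover have "distr M (PiM {..<T} (\<lambda>_. coord_space K)) (\<lambda>\<omega>. \<lambda>t\<in>{..<T}. coords K (f t) \<omega>)
      = PiM {..<T} (\<lambda>t. distr M (coord_space K) (coords K (f t)))"
    using assms factor_indep coords_factor_measurable
    by (subst indep_vars_iff_distr_eq_PiM'[symmetric]) auto
  moreover have "PiM {..<T} (\<lambda>t. distr M (coord_space K) (coords K (f t)))
    = PiM {..<T} (\<lambda>_. density ?L \<phi>)"
    by (intro PiM_cong refl D) auto
  ultimately show ?thesis using that by simp
qed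

text \<open>The diagonal covariance splits the column density into a product, so all error entries
  become independent centred normal variables.\<close>

lemma distr_errors:
  assumes "0 < T" and diag: "diagonal_mat \<Sigma>u"
  obtains \<sigma> where "\<And>k. \<sigma> k > 0"
    "distr M (PiM {..<T} (\<lambda>_. coord_space p)) (\<lambda>\<omega>. \<lambda>t\<in>{..<T}. coords p (u t) \<omega>)
      = PiM {..<T} (\<lambda>_. PiM {..<p} (\<lambda>k. centred_normal (\<sigma> k)))"
proof -
  let ?L = "PiM {..<p} (\<lambda>_. lborel :: real measure)"
  \<comment> \<open>The value 1 beyond p keeps every scale positive.\<close>
  define \<sigma> where "\<sigma> k = (if k < p then sqrt (\<Sigma>u $$ (k, k)) else 1)" for k
  have \<sigma>: "\<sigma> k > 0" for k using positive_definite_diag[OF error_cov_pos] by (simp add: \<sigma>_def)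
  have Sc: "\<Sigma>u \<in> carrier_mat p p" using error_cov_pos by (simp add: positive_definite_mat_def)
  have S2: "\<Sigma>u $$ (i, i) = (\<sigma> i)\<^sup>2" if "i < p" for i
    using positive_definite_diag[OF error_cov_pos that] that by (simp add: \<sigma>_def)
  have D: "distr M (coord_space p) (coords p (u t)) = PiM {..<p} (\<lambda>k. centred_normal (\<sigma> k))"
    if "t < T" for t
  proof -
    have "distr M (coord_space p) (coords p (u t)) = distr M ?L (coords p (u t))"
      by (intro distr_cong refl sets_PiM_lborel[symmetric])
    also have "\<dots> = density ?L (\<lambda>x. ennreal (mvn_density p (0\<^sub>v p) \<Sigma>u (Matrix.vec p x)))"
      using error_normal[OF that] error_mean[OF that] error_cov[OF that]
      by (intro distributed_distr_eq_density) (simp add: normal_vector_def)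
    also have "\<dots> = density ?L (\<lambda>x. \<Prod>k<p. ennreal (normal_density 0 (\<sigma> k) (x k)))"
    proof -
      have "mvn_density p (0\<^sub>v p) \<Sigma>u (Matrix.vec p x) = (\<Prod>k<p. normal_density 0 (\<sigma> k) (x k))" for x
        using diag Sc by (intro mvn_density_diagonal[OF Sc] S2 \<sigma>) (auto simp: diagonal_mat_def)
      then show ?thesis by (simp add: prod_ennreal)
    qed
    also have "\<dots> = PiM {..<p} (\<lambda>k. centred_normal (\<sigma> k))"
      by (rule PiM_centred_normal_eq_density[symmetric]) (auto intro: \<sigma>)
    finally show ?thesis .
  qed
  have "distr M (PiM {..<T} (\<lambda>_. coord_space p)) (\<lambda>\<omega>. \<lambda>t\<in>{..<T}. coords p (u t) \<omega>)
      = PiM {..<T} (\<lambda>t. distr M (coord_space p) (coords p (u t)))"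
    using assms error_indep coords_error_measurable
    by (subst indep_vars_iff_distr_eq_PiM'[symmetric]) auto
  also have "\<dots> = PiM {..<T} (\<lambda>_. PiM {..<p} (\<lambda>k. centred_normal (\<sigma> k)))"
    by (intro PiM_cong refl D) auto
  finally show ?thesis using that \<sigma> by blast
qed

lemma rows_law:
  assumes T: "0 < T" and KT: "K + p \<le> T"
    and diag: "diagonal_mat \<Sigma>u"
  shows "(\<integral>\<omega>. row_product {..<T} K p \<tau> (rows \<omega>) \<partial>M) = char_product (T - K) p \<tau>"
    and "AE \<omega> in M. nondegenerate {..<T} (rows \<omega>) (K + p)"
proof -
  let ?SF = "PiM {..<T} (\<lambda>_. coord_space K)" and ?SU = "PiM {..<T} (\<lambda>_. coord_space p)"
  define Fv where "Fv \<omega> = (\<lambda>t\<in>{..<T}. coords K (f t) \<omega>)" for \<omega>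
  define Uv where "Uv \<omega> = (\<lambda>t\<in>{..<T}. coords p (u t) \<omega>)" for \<omega>
  obtain \<phi> where \<phi>: "\<phi> \<in> borel_measurable (PiM {..<K} (\<lambda>_. lborel))"
    "prob_space (density (PiM {..<K} (\<lambda>_. lborel)) \<phi>)"
    "distr M ?SF Fv = PiM {..<T} (\<lambda>_. density (PiM {..<K} (\<lambda>_. lborel)) \<phi>)"
    using distr_factors[OF T] unfolding Fv_def[abs_def] .
  obtain \<sigma> where \<sigma>: "\<And>k. \<sigma> k > 0" "distr M ?SU Uv = PiM {..<T} (\<lambda>_. PiM {..<p} (\<lambda>k. centred_normal (\<sigma>
    k)))"
    using distr_errors[OF T diag] unfolding Uv_def[abs_def] by blast
  have ind: "random_variable ?SF Fv" "random_variable ?SU Uv"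
    "distr M ?SF Fv \<Otimes>\<^sub>M distr M ?SU Uv = distr M (?SF \<Otimes>\<^sub>M ?SU) (\<lambda>\<omega>. (Fv \<omega>, Uv \<omega>))"
    using factor_error_indep unfolding Fv_def[symmetric] Uv_def[symmetric] indep_var_distribution_eq
      by auto
  have FU [measurable]: "(\<lambda>\<omega>. (Fv \<omega>, Uv \<omega>)) \<in> measurable M (?SF \<Otimes>\<^sub>M ?SU)"
    using ind(1,2) by measurable
  have posF: "AE F in distr M ?SF Fv. nondegenerate {..<T} (\<lambda>k t. F t k) K"
    unfolding \<phi>(3) using KT \<phi>(1,2) by (intro AE_nondegenerate_of_densities) auto
  have prF: "prob_space (distr M ?SF Fv)" by (rule prob_space_distr[OF ind(1)])
  have eq: "rows \<omega> k t = joint_rows K (Fv \<omega>) (Uv \<omega>) k t" if "k < K + p" "t < T" for \<omega> k t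
    using that by (auto simp: rows_def joint_rows_def Fv_def Uv_def coords_def)
  let ?g = "\<lambda>z. row_product {..<T} K p \<tau> (joint_rows K (fst z) (snd z))"
  have mg: "?g \<in> borel_measurable (?SF \<Otimes>\<^sub>M ?SU)"
    by (intro measurable_row_product measurable_joint_rows) auto
  have "(\<integral>\<omega>. row_product {..<T} K p \<tau> (rows \<omega>) \<partial>M) = (\<integral>\<omega>. ?g (Fv \<omega>, Uv \<omega>) \<partial>M)"
    unfolding fst_conv snd_conv using eq
    by (intro Bochner_Integration.integral_cong refl row_product_cong) auto
  also have "\<dots> = (\<integral>z. ?g z \<partial>(distr M ?SF Fv \<Otimes>\<^sub>M distr M ?SU Uv))"
    unfolding ind(3) by (rule integral_distr[symmetric, OF FU mg])
  also have "\<dots> = char_product (T - K) p \<tau>"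
    by (rule integral_joint_rows(1)[OF \<sigma>(1) KT prF _ posF \<sigma>(2)]) simp
  finally show "(\<integral>\<omega>. row_product {..<T} K p \<tau> (rows \<omega>) \<partial>M) = char_product (T - K) p \<tau>" .
  have "AE z in distr M ?SF Fv \<Otimes>\<^sub>M distr M ?SU Uv. nondegenerate {..<T} (joint_rows K (fst z) (snd z))
    (K + p)"
    by (rule integral_joint_rows(2)[OF \<sigma>(1) KT prF _ posF \<sigma>(2)]) simp
  then have "AE \<omega> in M. nondegenerate {..<T} (joint_rows K (Fv \<omega>) (Uv \<omega>)) (K + p)"
    unfolding ind(3) using AE_distrD[OF FU] by fastforce
  moreover have "nondegenerate {..<T} (joint_rows K (Fv \<omega>) (Uv \<omega>)) (K + p)
    = nondegenerate {..<T} (rows \<omega>) (K + p)" for \<omega>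
    using eq by (intro nondegenerate_cong) auto
  ultimately show "AE \<omega> in M. nondegenerate {..<T} (rows \<omega>) (K + p)" by simp
qed

lemma V11_inv_rows:
  assumes "\<omega> \<in> space M" "nondegenerate {..<T} (rows \<omega>) (K + p)"
  shows "V11_inv p K T (joint_vec X f) \<omega> \<in> carrier_mat p p"
    and "\<And>i. i < p \<Longrightarrow> V11_inv p K T (joint_vec X f) \<omega> $$ (i, i) = rss {..<T} (rows \<omega>) K (rows \<omega> (K + i))"
    and "det (V11_inv p K T (joint_vec X f) \<omega>) = (\<Prod>i<p. rss {..<T} (rows \<omega>) (K + i) (rows \<omega> (K + i)))"
  using V11_inv_residuals[of T "rows \<omega>" K p f \<omega> u B X] assms loadings factor_dim error_dim model
  by (auto simp: rows_def)

text \<open>More rows subtract more squares. The diagonal of the inverse of V11 thus inherits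
  positivity from the successive distances.\<close>

lemma rss_antimono: "q \<le> r \<Longrightarrow> rss I h r z \<le> rss I h q z"
  unfolding rss_eq by (intro diff_left_mono sum_mono2) auto

lemma det_correlation_mat:
  assumes W: "W \<in> carrier_mat n n" and pos: "\<And>i. i < n \<Longrightarrow> W $$ (i, i) > 0"
  shows "det (correlation_mat n W) = det W / (\<Prod>i<n. W $$ (i, i))"
proof -
  let ?D = "mat_diag n (\<lambda>i. (W $$ (i, i)) powr (- 1 / 2))"
  have Dc: "?D \<in> carrier_mat n n" by simp
  have dD: "det ?D = (\<Prod>i<n. (W $$ (i, i)) powr (- 1 / 2))"
    by (subst det_lower_triangular_prod[OF _ Dc]) (auto simp: mat_diag_def)
  have "det (correlation_mat n W) = det ?D * det W * det ?D"
    unfolding correlation_mat_def using det_mult[OF mult_carrier_mat[OF Dc W] Dc] det_mult[OF Dc W]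
      by simp
  also have "\<dots> = det W * (\<Prod>i<n. (W $$ (i, i)) powr (- 1 / 2) * (W $$ (i, i)) powr (- 1 / 2))"
    unfolding dD prod.distrib by simp
  also have "(\<Prod>i<n. (W $$ (i, i)) powr (- 1 / 2) * (W $$ (i, i)) powr (- 1 / 2))
    = (\<Prod>i<n. 1 / W $$ (i, i))"
    using pos by (intro prod.cong refl) (simp add: powr_add[symmetric] powr_minus_divide less_imp_le)
  finally show ?thesis by (simp add: prod_dividef)
qed

lemma AE_nondegenerate:
  assumes KT: "K + p \<le> T" and diag: "diagonal_mat \<Sigma>u"
  shows "AE \<omega> in M. nondegenerate {..<T} (rows \<omega>) (K + p)"
  using rows_law(2)[OF _ KT diag] KT by (cases "T = 0") (auto simp: nondegenerate_def)

text \<open>The identity is almost sure: the powers - 1/2 turn into reciprocals of the diagonal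
  entries because these are positive, which is established on nondegenerate data.\<close>

lemma AE_T_LR_eq_det_R:
  assumes KT: "K + p \<le> T" and diag: "diagonal_mat \<Sigma>u"
  shows "AE \<omega> in M. T_LR p K T (joint_vec X f) \<omega> = det (R_mat p K T (joint_vec X f) \<omega>) powr (- real T
    / 2)"
  using AE_nondegenerate[OF assms] AE_space
proof eventually_elim
  case (elim \<omega>)
  note V = V11_inv_rows[OF elim(2,1)]
  have "V11_inv p K T (joint_vec X f) \<omega> $$ (i, i) > 0" if "i < p" for i
  proof -
    have "0 < rss {..<T} (rows \<omega>) (K + i) (rows \<omega> (K + i))" using elim that
      by (simp add: nondegenerate_def)
    also have "\<dots> \<le> rss {..<T} (rows \<omega>) K (rows \<omega> (K + i))" by (rule rss_antimono) simp
    finally show ?thesis using V(2)[OF that] by simp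
  qed
  then show ?case unfolding T_LR_def R_mat_def by (subst det_correlation_mat[OF V(1)]) auto
qed

text \<open>On nondegenerate data, 2/T times the log-statistic is minus the sum of the log-ratios;
  hence the argument - x / s. The shift m and the scale s are arbitrary constants at this
  point.\<close>

lemma char_T_LR:
  assumes T: "0 < T" and KT: "K + p \<le> T"
    and diag: "diagonal_mat \<Sigma>u"
  shows "char (distr M borel (\<lambda>\<omega>. (2 / real T * ln (T_LR p K T (joint_vec X f) \<omega>) + m) / s)) x
    = exp (\<i> * of_real (x * m / s)) * char_product (T - K) p (- x / s)"
proof -
  let ?S = "\<lambda>\<omega>. T_LR p K T (joint_vec X f) \<omega>"
  have [measurable]: "?S \<in> borel_measurable M" by (rule measurable_T_LR)
  let ?a = "\<lambda>\<omega> k. rss {..<T} (rows \<omega>) (K + k) (rows \<omega> (K + k))" and ?b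
    = "\<lambda>\<omega> k. rss {..<T} (rows \<omega>) K (rows \<omega> (K + k))"
  have "char (distr M borel (\<lambda>\<omega>. (2 / real T * ln (?S \<omega>) + m) / s)) x
    = (\<integral>\<omega>. iexp (x * ((2 / real T * ln (?S \<omega>) + m) / s)) \<partial>M)"
    unfolding char_def by (rule integral_distr) auto
  also have "\<dots> = (\<integral>\<omega>. exp (\<i> * of_real (x * m / s)) * row_product {..<T} K p (- x / s) (rows \<omega>) \<partial>M)"
  proof (rule integral_cong_AE)
    show "AE \<omega> in M. iexp (x * ((2 / real T * ln (?S \<omega>) + m) / s))
      = exp (\<i> * of_real (x * m / s)) * row_product {..<T} K p (- x / s) (rows \<omega>)"
      using rows_law(2)[OF T KT diag] AE_space
    proof eventually_elim
      case (elim \<omega>)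
      note V = V11_inv_rows[OF elim(2,1)]
      have a: "?a \<omega> k > 0" if "k < p" for k using elim that by (simp add: nondegenerate_def)
      have b: "?b \<omega> k > 0" if "k < p" for k
        using less_le_trans[OF a[OF that] rss_antimono[of K "K + k"]] by simp
      have "ln (?S \<omega>) = - real T / 2 * ln ((\<Prod>i<p. ?a \<omega> i) / (\<Prod>i<p. ?b \<omega> i))"
        unfolding T_LR_def using V a b by (simp add: ln_powr prod_pos)
      also have "ln ((\<Prod>i<p. ?a \<omega> i) / (\<Prod>i<p. ?b \<omega> i)) = (\<Sum>i<p. ln (?a \<omega> i) - ln (?b \<omega> i))"
      proof -
        have "0 < (\<Prod>i<p. ?a \<omega> i)" "0 < (\<Prod>i<p. ?b \<omega> i)" using a b by (auto intro!: prod_pos)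
        moreover have "ln (\<Prod>i<p. ?a \<omega> i) = (\<Sum>i<p. ln (?a \<omega> i))" "ln (\<Prod>i<p. ?b \<omega> i)
          = (\<Sum>i<p. ln (?b \<omega> i))"
          using a b by (subst ln_prod; fastforce)+
        moreover have "ln (y / z) = ln y - ln z" if "0 < y" "0 < z" for y z :: real
          using that by (simp add: ln_div)
        ultimately show ?thesis by (simp only: sum_subtractf)
      qed
      finally have S: "2 / real T * ln (?S \<omega>) = - (\<Sum>i<p. ln (?a \<omega> i) - ln (?b \<omega> i))" using T by simp
      have "iexp (x * ((- (\<Sum>i<p. d i) + m) / s))
        = exp (\<i> * of_real (x * m / s) + (\<Sum>i<p. \<i> * of_real ((- x / s) * d i)))" for d
      proof -
        have "(\<Sum>i<p. \<i> * of_real ((- x / s) * d i)) = \<i> * complex_of_real ((- x / s) * (\<Sum>i<p. d i))"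
          by (simp add: sum_distrib_left)
        moreover have "x * ((- L + m) / s) = x * m / s + (- x / s) * L" for L
          by (simp add: add_divide_distrib diff_divide_distrib algebra_simps)
        ultimately show ?thesis by (simp only: of_real_add distrib_left)
      qed
      note this[of "\<lambda>i. ln (?a \<omega> i) - ln (?b \<omega> i)"]
      then have "iexp (x * ((2 / real T * ln (?S \<omega>) + m) / s))
        = exp (\<i> * of_real (x * m / s) + (\<Sum>i<p. \<i> * of_real ((- x / s) * (ln (?a \<omega> i) - ln (?b \<omega> i)))))"
        unfolding S .
      also have "\<dots> = exp (\<i> * of_real (x * m / s)) * row_product {..<T} K p (- x / s) (rows \<omega>)"
        unfolding exp_add exp_sum[OF finite_lessThan] using a
          by (simp add: row_product_def row_factor_def)
      finally show ?case .
    qed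
    have mr: "(\<lambda>\<omega>. rows \<omega> k t) \<in> borel_measurable M" if "k < K + p" "t < T" for k t
      using that factor_measurable[of t k] error_measurable[of t "k - K"]
        by (cases "k < K") (auto simp: rows_def)
    show "(\<lambda>\<omega>. exp (\<i> * of_real (x * m / s)) * row_product {..<T} K p (- x / s) (rows \<omega>))
      \<in> borel_measurable M"
      by (intro borel_measurable_times borel_measurable_const measurable_row_product mr) auto
  qed measurable
  also have "\<dots> = exp (\<i> * of_real (x * m / s)) * char_product (T - K) p (- x / s)"
    using rows_law(1)[OF T KT diag, of "- x / s"] by simp
  finally show ?thesis .
qed

end

section \<open>Convergence of the characteristic functions\<close>

lemma char_product_eq:
  assumes "p < N"
  shows "char_product N p y = exp (log_char_logdet N (N - p) y)"
proof -
  \<comment> \<open>Substitution j = N - k: error row k, counted from 0, leaves N - k residual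
    degrees of freedom.\<close>
  have "char_product N p y = (\<Prod>j\<in>{N - p<..N}. beta_char (real j / 2) (real N / 2) y)"
    unfolding char_product_def
    by (rule prod.reindex_bij_witness[of _ "\<lambda>j. N - j" "\<lambda>k. N - k"]) (use assms in auto)
  then show ?thesis using assms by (simp add: exp_log_char_logdet beta_char_def)
qed

lemma LR_normalisers:
  assumes "p < N" "real N = real T - real K"
  shows "mu_LR p K T = mean_approx N (N - p)" "sigma_LR p K T = sqrt (var_approx N (N - p))"
proof -
  have m: "real (N - p) = real N - real p" using assms(1) by simp
  have q: "real (N - p) / real N = 1 - real p / real N" using assms(1)
    by (simp add: m diff_divide_distrib)
  have "real p - 1 - real N + 3 / 2 = 1 / 2 - real (N - p)" unfolding m by simp
  then show "mu_LR p K T = mean_approx N (N - p)"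
    unfolding mu_LR_def mean_approx_def q assms(2)[symmetric] by (simp add: m)
  show "sigma_LR p K T = sqrt (var_approx N (N - p))"
    unfolding sigma_LR_def var_approx_def q assms(2)[symmetric] by (simp add: m)
qed

theorem theorem6:
  fixes M :: "nat \<Rightarrow> 'a measure"
    and p K T :: "nat \<Rightarrow> nat"
    and B \<Sigma>f \<Sigma>u :: "nat \<Rightarrow> real Matrix.mat"
    and f u X Y :: "nat \<Rightarrow> nat \<Rightarrow> 'a \<Rightarrow> real Matrix.vec"
    and \<Omega> :: "nat \<Rightarrow> real Matrix.mat"
    and c d :: real
  assumes model: "\<And>n. gaussian_factor_model (M n) (p n) (K n) (T n)
                        (B n) (\<Sigma>f n) (\<Sigma>u n) (f n) (u n) (X n)"
    and Y_def: "\<And>n. Y n = joint_vec (X n) (f n)"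
    and \<Omega>_def: "\<And>n t. t < T n \<Longrightarrow> \<Omega> n = precision_mat (M n) (p n + K n) (Y n t)"
    and dims: "\<And>n. K n + p n \<le> T n"
    and diverge: "filterlim (\<lambda>n. real (T n) - real (K n)) at_top sequentially"
    and H0_diagonal: "\<And>n. diagonal_mat (upper_left_block (p n) (\<Omega> n))"
    and H0_positive: "\<And>n i. i < p n \<Longrightarrow> 0 < \<Omega> n $$ (i, i)"
    and regime: "((\<lambda>n. real (p n) / (real (T n) - real (K n))) \<longlonglongrightarrow> c \<and> 0 < c \<and> c < 1) \<or>
                 ((\<lambda>n. real (T n) - real (K n) - real (p n)) \<longlonglongrightarrow> d \<and> 4 \<le> d)"
  shows "(\<forall>n. AE \<omega> in M n. T_LR (p n) (K n) (T n) (Y n) \<omega> =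
                 det (R_mat (p n) (K n) (T n) (Y n) \<omega>) powr (- real (T n) / 2)) \<and>
         weak_conv_m
           (\<lambda>n. distr (M n) borel (\<lambda>\<omega>.
              (2 / real (T n) * ln (T_LR (p n) (K n) (T n) (Y n) \<omega>) + mu_LR (p n) (K n) (T n))
              / sigma_LR (p n) (K n) (T n)))
           std_normal_distribution"
proof (intro conjI allI)
  have KT: "K n + p n \<le> T n" for n by (rule dims)
  have diag: "diagonal_mat (\<Sigma>u n)" for n
  proof -
    interpret gaussian_factor_model "M n" "p n" "K n" "T n" "B n" "\<Sigma>f n" "\<Sigma>u n" "f n" "u n" "X n"
      by (rule model)
    have Sc: "\<Sigma>u n \<in> carrier_mat (p n) (p n)" using error_cov_pos
      by (simp add: positive_definite_mat_def)
    \<comment> \<open>For p = 0 the sample may be empty and \<Omega> unconstrained, but \<Sigma>u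
      then has no entries.\<close>
    show ?thesis
    proof (cases "p n = 0")
      case False
      then have "0 < T n" using KT[of n] by simp
      then show ?thesis
        using error_cov_diagonal[OF _ _ H0_diagonal[of n]] \<Omega>_def[of 0 n] Sc
        by (auto simp: diagonal_mat_def Y_def)
    qed (use Sc in \<open>simp add: diagonal_mat_def\<close>)
  qed
  show "AE \<omega> in M n. T_LR (p n) (K n) (T n) (Y n) \<omega> =
      det (R_mat (p n) (K n) (T n) (Y n) \<omega>) powr (- real (T n) / 2)" for n
    unfolding Y_def by (rule gaussian_factor_model.AE_T_LR_eq_det_R[OF model KT diag])
  define N where "N n = T n - K n" for n
  have N: "real (N n) = real (T n) - real (K n)" for n using KT[of n] by (simp add: N_def)
  have pN: "p n \<le> N n" for n using KT[of n] by (simp add: N_def)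
  have "filterlim N at_top sequentially"
    unfolding filterlim_at_top
  proof
    fix Z :: nat
    have "\<forall>\<^sub>F n in sequentially. real Z \<le> real (T n) - real (K n)"
      using diverge unfolding filterlim_at_top by blast
    then show "\<forall>\<^sub>F n in sequentially. Z \<le> N n" by eventually_elim (simp flip: N)
  qed
  note sc = scaling_conditions[OF this pN regime[folded N]]
  obtain s where s: "s > 0" "\<forall>\<^sub>F n in sequentially. sqrt (var_approx (N n) (N n - p n)) \<ge> s"
    using sc(2) by blast
  let ?Z = "\<lambda>n \<omega>. (2 / real (T n) * ln (T_LR (p n) (K n) (T n) (Y n) \<omega>)
    + mu_LR (p n) (K n) (T n)) / sigma_LR (p n) (K n) (T n)"
  show "weak_conv_m (\<lambda>n. distr (M n) borel (?Z n)) std_normal_distribution"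
  proof (rule levy_continuity)
    show "real_distribution std_normal_distribution" by (rule real_dist_normal_dist)
    show "real_distribution (distr (M n) borel (?Z n))" for n
    proof -
      interpret gaussian_factor_model "M n" "p n" "K n" "T n" "B n" "\<Sigma>f n" "\<Sigma>u n" "f n" "u n" "X n"
        by (rule model)
      have [measurable]: "T_LR (p n) (K n) (T n) (Y n) \<in> borel_measurable (M n)"
        unfolding Y_def by (rule measurable_T_LR)
      show ?thesis by (rule real_distribution_distr) measurable
    qed
    fix t :: real
    let ?\<sigma> = "\<lambda>n. sqrt (var_approx (N n) (N n - p n))"
    have "(\<lambda>n. exp (\<i> * of_real (t * mean_approx (N n) (N n - p n) / ?\<sigma> n)
            + log_char_logdet (N n) (N n - p n) (- t / ?\<sigma> n))) \<longlonglongrightarrow> exp (- of_real (t^2 / 2))"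
    proof (rule log_char_logdet_normalised_limit[OF _ s(2,1) _ sc(3)])
      show "\<forall>\<^sub>F n in sequentially. 1 \<le> N n - p n \<and> N n - p n \<le> N n"
        using sc(1) by eventually_elim simp
      show "\<forall>\<^sub>F n in sequentially. (?\<sigma> n)\<^sup>2 = var_approx (N n) (N n - p n)"
        using sc(1) by eventually_elim (simp add: var_approx_pos less_imp_le)
    qed
    \<comment> \<open>The finitely many n with p = 0 or p = N are left out, since the normalisation
      degenerates there.\<close>
    moreover have "\<forall>\<^sub>F n in sequentially. char (distr (M n) borel (?Z n)) t
       = exp (\<i> * of_real (t * mean_approx (N n) (N n - p n) / ?\<sigma> n)
         + log_char_logdet (N n) (N n - p n) (- t / ?\<sigma> n))"
      using sc(1)
    proof eventually_elim
      case (elim n)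
      then have p: "p n < N n" "0 < T n" by (auto simp: N_def)
      have "char (distr (M n) borel (?Z n)) t
        = exp (\<i> * of_real (t * mean_approx (N n) (N n - p n) / ?\<sigma> n))
          * char_product (T n - K n) (p n) (- t / ?\<sigma> n)"
        unfolding Y_def LR_normalisers[OF p(1) N]
        by (rule gaussian_factor_model.char_T_LR[OF model p(2) KT diag])
      also have "char_product (T n - K n) (p n) (- t / ?\<sigma> n)
        = exp (log_char_logdet (N n) (N n - p n) (- t / ?\<sigma> n))"
        using char_product_eq[OF p(1)] by (simp add: N_def)
      finally show ?case by (simp add: exp_add)
    qed
    ultimately have "(\<lambda>n. char (distr (M n) borel (?Z n)) t) \<longlonglongrightarrow> exp (- of_real (t^2 / 2))"
      by (simp only: tendsto_cong)
    also have "exp (- of_real (t^2 / 2)) = char std_normal_distribution t"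
      by (simp add: char_std_normal_distribution exp_of_real[symmetric])
    finally show "(\<lambda>n. char (distr (M n) borel (?Z n)) t) \<longlonglongrightarrow> char std_normal_distribution t" .
  qed
qed

end
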